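(* If $K$ is a degree $6$ real rational knot in $\mathbb{RP}^3$ and there is a real plane in $\mathbb{RP}^3$ that intersects $K$ in at most two real points, then $K$ is rigidly isotopic (in the space of degree $6$ real rational knots in $\mathbb{RP}^3$) to the stereographic projection of a degree $8$ real rational curve in $S^3$ with one double point.
   Context: $S^3$ denotes the real quadric $x_1^2+x_2^2+x_3^2+x_4^2=x_0^2$ in $\mathbb{RP}^4$. A real rational curve of degree $d$ in $\mathbb{RP}^n$ (in particular in $S^3\subset \mathbb{RP}^4$) is given by a parametrization $k=[k_0:\dots:k_n]:\mathbb{RP}^1\to\mathbb{RP}^n$ with $k_i$ real homogeneous polynomials of degree $d$ without common (complex) root; the same polynomials define $\mathbb{C}k:\mathbb{CP}^1\to\mathbb{CP}^n$. It is a real rational knot if $\mathbb{C}k$ is an injective immersion. "With one double point" means that the curve has exactly one double point and is otherwise non-singular. A rigid isotopy is a continuous path in the space of real rational knots of a fixed degree. For $p\in S^3$ and a hyperplane $\mathbb{RP}^3\subset\mathbb{RP}^4$ disjoint from $S^3$, the stereographic projection $\pi_p$ sends $\alpha\in S^3\setminus\{p\}$ to the intersection of the line $p\alpha$ with $\mathbb{RP}^3$; it extends to complex points. For a real rational curve $C\subset S^3$, $\pi_p(C)$ is the rational curve that is the closure of $\pi_p(\mathbb{C}C\setminus\mathbb{C}T_p)$, with $T_p$ the tangent hyperplane to $S^3$ at $p$. Here the projection is taken from the double point of the degree $8$ curve, so that the projected curve has degree $6$. *)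

theory Defs
  imports "HOL-Analysis.Analysis" "HOL-Computational_Algebra.Polynomial"
begin

section \<open>Projective spaces\<close>

text \<open>The point \<open>[v]\<close> of projective space, as the set of nonzero multiples of \<open>v\<close>. It is only
  meaningful for \<open>v \<noteq> 0\<close>. Points of \<open>n\<close>-dimensional projective space have \<open>n + 1\<close> homogeneous
  coordinates, so a finite index type with \<open>n + 1\<close> elements is used.\<close>

definition proj :: "'a::field ^ 'n \<Rightarrow> ('a ^ 'n) set" where
  "proj v = {c *s v | c. c \<noteq> 0}"

definition proj_space :: "('a::field ^ 'n) set set" where
  "proj_space = {proj v | v. v \<noteq> 0}"

text \<open>The quotient topology: \<open>\<Union>U\<close> is the preimage of \<open>U\<close> among the nonzero vectors.\<close>

definition proj_topology :: "('a::real_normed_field ^ 'n) set topology" where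
  "proj_topology = topology (\<lambda>U. U \<subseteq> proj_space \<and> open (\<Union>U))"

lemma proj_self: "v \<in> proj v"
  unfolding proj_def by (rule CollectI, rule exI[of _ 1]) simp

lemma proj_eqI:
  assumes "w \<in> proj v"
  shows "proj w = proj v"
proof -
  obtain c where c: "c \<noteq> 0" "w = c *s v"
    using assms unfolding proj_def by blast
  have "\<exists>b. b \<noteq> 0 \<and> a *s w = b *s v" if "a \<noteq> 0" for a
    by (rule exI[of _ "a * c"]) (use c that in \<open>simp add: vector_smult_assoc\<close>)
  moreover have "\<exists>b. b \<noteq> 0 \<and> a *s v = b *s w" if "a \<noteq> 0" for a
    by (rule exI[of _ "a / c"]) (use c that in \<open>simp add: vector_smult_assoc\<close>)
  ultimately show ?thesis
    unfolding proj_def by blast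
qed

lemma proj_space_disjoint:
  assumes "P \<in> proj_space" "Q \<in> proj_space" "v \<in> P" "v \<in> Q"
  shows "P = Q"
proof -
  obtain a b where "P = proj a" "Q = proj b"
    using assms(1,2) unfolding proj_space_def by blast
  then show ?thesis
    using assms(3,4) proj_eqI by metis
qed

lemma istopology_proj:
  "istopology (\<lambda>U. U \<subseteq> proj_space \<and> open (\<Union>U :: ('a::real_normed_field ^ 'n) set))"
proof -
  have Int: "\<Union>(U \<inter> V) = \<Union>U \<inter> \<Union>V" if "U \<subseteq> proj_space" "V \<subseteq> proj_space"
    for U V :: "('a ^ 'n) set set"
  proof
    show "\<Union>U \<inter> \<Union>V \<subseteq> \<Union>(U \<inter> V)"
    proof
      fix v assume "v \<in> \<Union>U \<inter> \<Union>V"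
      then obtain P Q where PQ: "P \<in> U" "Q \<in> V" "v \<in> P" "v \<in> Q" by blast
      then have "P = Q" using that by (intro proj_space_disjoint[of P Q v]) auto
      with PQ show "v \<in> \<Union>(U \<inter> V)" by blast
    qed
  qed blast
  have Un: "\<Union>(\<Union>\<U>) = (\<Union>U\<in>\<U>. \<Union>U)" for \<U> :: "('a ^ 'n) set set set"
    by blast
  show ?thesis
    unfolding istopology_def
  proof (intro conjI allI impI)
    fix U V :: "('a ^ 'n) set set"
    assume U: "U \<subseteq> proj_space \<and> open (\<Union>U)" and V: "V \<subseteq> proj_space \<and> open (\<Union>V)"
    then show "U \<inter> V \<subseteq> proj_space" by blast
    show "open (\<Union>(U \<inter> V))" using U V by (simp only: Int open_Int)
  next
    fix \<U> :: "('a ^ 'n) set set set"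
    assume \<U>: "\<forall>U\<in>\<U>. U \<subseteq> proj_space \<and> open (\<Union>U)"
    then show "\<Union>\<U> \<subseteq> proj_space" by blast
    show "open (\<Union>(\<Union>\<U>))" unfolding Un using \<U> by (intro open_UN) blast
  qed
qed

lemma openin_proj_topology:
  "openin proj_topology U \<longleftrightarrow> U \<subseteq> proj_space \<and> open (\<Union>U)"
  unfolding proj_topology_def by (simp add: topology_inverse'[OF istopology_proj])

definition cvec :: "real ^ 'n \<Rightarrow> complex ^ 'n" where
  "cvec v = (\<chi> j. of_real (v $ j))"

definition cmat :: "real ^ 'n ^ 'm \<Rightarrow> complex ^ 'n ^ 'm" where
  "cmat A = (\<chi> i j. of_real (A $ i $ j))"

section \<open>Real rational curves and knots\<close>

text \<open>A real binary form of degree \<open>d\<close> is stored as its dehomogenization, a univariate polynomial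
  \<open>p\<close> with \<open>degree p \<le> d\<close>; \<open>d\<close> has to be supplied to recover the form. A curve in projective
  space is the vector of its component forms. The value below is taken at real
  or complex parameters, according to \<open>'a\<close>.\<close>

definition form_eval :: "nat \<Rightarrow> real poly ^ 'n \<Rightarrow> 'a::real_normed_field ^ 2 \<Rightarrow> 'a ^ 'n" where
  "form_eval d k x = (\<chi> j. \<Sum>i\<le>d. of_real (coeff (k $ j) i) * (x $ 1) ^ i * (x $ 2) ^ (d - i))"

definition real_rational_curve :: "nat \<Rightarrow> real poly ^ 'n \<Rightarrow> bool" where
  "real_rational_curve d k \<longleftrightarrow>
     (\<forall>j. degree (k $ j) \<le> d) \<and> (\<forall>x::complex ^ 2. x \<noteq> 0 \<longrightarrow> form_eval d k x \<noteq> 0)"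

text \<open>The tangent space of projective space at \<open>[v]\<close> is the space of vectors modulo multiples
  of \<open>v\<close>; the condition says that the differential induced on these quotients is injective.\<close>

definition complex_immersion :: "nat \<Rightarrow> real poly ^ 'n \<Rightarrow> bool" where
  "complex_immersion d k \<longleftrightarrow>
     (\<forall>(x::complex ^ 2) v c. x \<noteq> 0 \<and>
        frechet_derivative (form_eval d k) (at x) v = c *s form_eval d k x
        \<longrightarrow> (\<exists>a. v = a *s x))"

definition complex_injective :: "nat \<Rightarrow> real poly ^ 'n \<Rightarrow> bool" where
  "complex_injective d k \<longleftrightarrow>
     (\<forall>(x::complex ^ 2) y. x \<noteq> 0 \<and> y \<noteq> 0 \<and> proj (form_eval d k x) = proj (form_eval d k y)
        \<longrightarrow> proj x = proj y)"

definition real_rational_knot :: "nat \<Rightarrow> real poly ^ 'n \<Rightarrow> bool" where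
  "real_rational_knot d k \<longleftrightarrow>
     real_rational_curve d k \<and> complex_injective d k \<and> complex_immersion d k"

definition real_points :: "nat \<Rightarrow> real poly ^ 'n \<Rightarrow> (real ^ 'n) set set" where
  "real_points d k = {proj (form_eval d k x) | x :: real ^ 2. x \<noteq> 0}"

definition complex_points :: "nat \<Rightarrow> real poly ^ 'n \<Rightarrow> (complex ^ 'n) set set" where
  "complex_points d k = {proj (form_eval d k x) | x :: complex ^ 2. x \<noteq> 0}"

text \<open>Component forms are determined by the parametrization only up to a common nonzero real
  factor. A path of parametrizations up to such factors lifts to a path of coefficient vectors
  starting at any chosen representative of the initial point, hence the factor
  appears only at the terminal point.\<close>

definition rigidly_isotopic :: "nat \<Rightarrow> real poly ^ 'n \<Rightarrow> real poly ^ 'n \<Rightarrow> bool" where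
  "rigidly_isotopic d k k' \<longleftrightarrow>
     (\<exists>\<gamma> :: real \<Rightarrow> real poly ^ 'n.
        (\<forall>i j. continuous_on {0..1} (\<lambda>u. coeff (\<gamma> u $ j) i)) \<and>
        (\<forall>u\<in>{0..1}. real_rational_knot d (\<gamma> u)) \<and>
        \<gamma> 0 = k \<and> (\<exists>c. c \<noteq> 0 \<and> \<gamma> 1 = (\<chi> j. smult c (k' $ j))))"

text \<open>The curve has \<open>P\<close> as its only double point (two parameters, both branches immersed)
  and is otherwise non-singular. Conjugate parameters are allowed, so a real double point
  may be solitary.\<close>

definition fibre :: "nat \<Rightarrow> real poly ^ 'n \<Rightarrow> (complex ^ 'n) set \<Rightarrow> (complex ^ 2) set set" where
  "fibre d k P = {proj x | x. x \<noteq> 0 \<and> proj (form_eval d k x) = P}"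

definition one_double_point :: "nat \<Rightarrow> real poly ^ 'n \<Rightarrow> (complex ^ 'n) set \<Rightarrow> bool" where
  "one_double_point d k P \<longleftrightarrow>
     real_rational_curve d k \<and> complex_immersion d k \<and> card (fibre d k P) = 2 \<and>
     (\<forall>Q X Y. Q \<noteq> P \<and> X \<in> fibre d k Q \<and> Y \<in> fibre d k Q \<longrightarrow> X = Y)"

section \<open>The sphere and its stereographic projections\<close>

text \<open>The index type \<open>5\<close> has the elements \<open>0, 1, 2, 3, 4\<close>.\<close>

definition S3 :: "(real ^ 5) set set" where
  "S3 = {proj v | v. v \<noteq> 0 \<and> (v $ 1)\<^sup>2 + (v $ 2)\<^sup>2 + (v $ 3)\<^sup>2 + (v $ 4)\<^sup>2 = (v $ 0)\<^sup>2}"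

text \<open>Complex points of the tangent hyperplane of the sphere at the real point \<open>[p]\<close>.\<close>

definition complex_tangent :: "real ^ 5 \<Rightarrow> (complex ^ 5) set set" where
  "complex_tangent p = {proj v | v. v \<noteq> 0 \<and>
     of_real (p $ 1) * v $ 1 + of_real (p $ 2) * v $ 2 + of_real (p $ 3) * v $ 3
       + of_real (p $ 4) * v $ 4 = of_real (p $ 0) * v $ 0}"

text \<open>A hyperplane disjoint from the sphere, identified with projective 3-space by the
  injective linear map \<open>A\<close>.\<close>

definition disjoint_hyperplane :: "real ^ 4 ^ 5 \<Rightarrow> bool" where
  "disjoint_hyperplane A \<longleftrightarrow> inj ((*v) A) \<and> {proj (A *v y) | y. y \<noteq> 0} \<inter> S3 = {}"

text \<open>The intersection, in the coordinates given by \<open>A\<close>, of the line through \<open>[p]\<close> and \<open>[a]\<close> with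
  the hyperplane; a single point if \<open>[p]\<close> lies on the sphere and \<open>[a]\<close> differs from it.\<close>

definition stereographic :: "real ^ 4 ^ 5 \<Rightarrow> real ^ 5 \<Rightarrow> complex ^ 5 \<Rightarrow> (complex ^ 4) set set" where
  "stereographic A p a = {proj y | y. y \<noteq> 0 \<and> (\<exists>s t. cmat A *v y = s *s cvec p + t *s a)}"

definition stereographic_curve ::
    "real ^ 4 ^ 5 \<Rightarrow> real ^ 5 \<Rightarrow> nat \<Rightarrow> real poly ^ 5 \<Rightarrow> (complex ^ 4) set set" where
  "stereographic_curve A p d k = proj_topology closure_of
     (\<Union>a\<in>{a. a \<noteq> 0 \<and> proj a \<in> complex_points d k - complex_tangent p}. stereographic A p a)"

end

theory Submission
  imports Defs "HOL-Computational_Algebra.Fundamental_Theorem_Algebra"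
begin

text \<open>
  Let \<open>q\<close> be the quadratic form of the sphere, \<open>B = -q\<close> its (positive definite) restriction to the
  hyperplane, and \<open>[p]\<close> a point of the sphere. The inverse of the projection from \<open>p\<close> is
  \<open>y \<mapsto> B(y,y) p - 2 B(m,y) y\<close>, where \<open>m\<close> is the \<open>q\<close>-orthogonal projection of \<open>p\<close> to the hyperplane.
  Composed with a sextic \<open>K\<close> it has degree 12, but if four of the six points of \<open>K\<close> on the plane
  \<open>B(m,y) = 0\<close> lie on the empty conic \<open>B(y,y) = 0\<close>, then a common factor \<open>r\<close> of degree 4 cancels. What
  remains has degree 8, and it maps the other two points of the plane section to \<open>p\<close>.

  A plane with at most two real points on \<open>K\<close> meets it, after a small perturbation of \<open>K\<close>, in at least
  two pairs of conjugate points \<open>a, cnj a, b, cnj b\<close>, not all on a line. The real lines through the two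
  pairs meet in a point \<open>w\<close>, so that \<open>a \<sim> w + \<i>v\<close> and \<open>b \<sim> w + \<i>v'\<close> in suitable coordinates; the two pairs
  lie on the empty conic for which \<open>w, v, v'\<close> is orthonormal. Gram--Schmidt moves this conic to the given
  one through invertible linear maps. Small perturbations are rigid isotopies because being a knot is
  an open condition, namely the nonvanishing of the divided minors
  \<open>(k\<^sub>a(x) k\<^sub>b(y) - k\<^sub>b(x) k\<^sub>a(y)) / (x\<^sub>1 y\<^sub>2 - x\<^sub>2 y\<^sub>1)\<close> on a compact set.
\<close>

section \<open>Binary forms\<close>


text \<open>\<open>A\<close> prescribes the hyperplane and thereby the quadric of its isotropic
  points, so the curve has to be moved to the quadric and \<open>p\<close> is constructed last. A
  general linear map could lie in the wrong component of the invertible matrices; a triangular one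
  with positive diagonal cannot. Cancelling \<open>r\<close> alone does not give a node. The two
  residual points of the plane section must be distinct, so that two branches pass through
  \<open>p\<close>, and they must avoid the empty conic, since otherwise both summands of the lift
  vanish there and the degree drops further. The factors of the section may also have common roots
  or roots at infinity. Every such coincidence is removed by a perturbation in a small parameter
  \<open>e\<close>: the condition becomes the nonvanishing of a polynomial in \<open>e\<close> with
  nonzero top coefficient, so several conditions hold together for some small \<open>e > 0\<close>.
  All perturbed curves stay in one coefficient ball around \<open>K\<close> that consists of knots.
  It is convex, so one segment replaces a chain of isotopies.\<close>

definition bform :: "nat \<Rightarrow> real poly \<Rightarrow> 'a::real_normed_field ^ 2 \<Rightarrow> 'a" where
  "bform d p x = (\<Sum>i\<le>d. of_real (coeff p i) * (x $ 1) ^ i * (x $ 2) ^ (d - i))"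

lemma form_eval_nth [simp]: "form_eval d k x $ j = bform d (k $ j) x"
  by (simp add: form_eval_def bform_def)

lemma bform_0 [simp]: "bform d 0 x = 0"
  by (simp add: bform_def)

lemma bform_add: "bform d (p + q) x = bform d p x + bform d q x"
  by (simp add: bform_def algebra_simps sum.distrib)

lemma bform_smult: "bform d (smult c p) x = of_real c * bform d p x"
  by (simp add: bform_def algebra_simps sum_distrib_left)

lemma bform_diff: "bform d (p - q) x = bform d p x - bform d q x"
  by (simp add: bform_def algebra_simps sum_subtractf)

lemma bform_sum: "bform d (\<Sum>i\<in>I. f i) x = (\<Sum>i\<in>I. bform d (f i) x)"
  by (induction I rule: infinite_finite_induct) (auto simp: bform_add)

lemma bform_scale: "bform d p (c *s x) = c ^ d * bform d p x"
proof -
  have "of_real (coeff p i) * (c * x$1) ^ i * (c * x$2) ^ (d - i) =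
      c ^ d * (of_real (coeff p i) * (x$1) ^ i * (x$2) ^ (d - i))" if "i \<le> d" for i
  proof -
    have "c ^ d = c ^ i * c ^ (d - i)" using that by (simp flip: power_add)
    then show ?thesis by (simp add: power_mult_distrib mult_ac)
  qed
  then show ?thesis unfolding bform_def sum_distrib_left vector_smult_component
    by (intro sum.cong) simp_all
qed

lemma form_eval_scale: "form_eval d k (c *s x) = c ^ d *s form_eval d k x"
  by (simp add: vec_eq_iff bform_scale)

lemma bform_affine:
  fixes x :: "'a::real_normed_field ^ 2"
  assumes "degree p \<le> d" "x $ 2 \<noteq> 0"
  shows "bform d p x = (x $ 2) ^ d * poly (map_poly of_real p) (x $ 1 / x $ 2)"
proof -
  have "degree (map_poly of_real p :: 'a poly) \<le> d"
    using assms(1) by (simp add: degree_map_poly)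
  then have e1: "poly (map_poly of_real p) (x $ 1 / x $ 2)
      = (\<Sum>i\<le>d. of_real (coeff p i) * (x $ 1 / x $ 2) ^ i)"
    unfolding poly_altdef by (intro sum.mono_neutral_cong_left) (auto simp: degree_map_poly coeff_map_poly intro: le_degree)
  have e2: "x $ 2 ^ d * (of_real (coeff p i) * (x $ 1 / x $ 2) ^ i) =
      (of_real (coeff p i) * x $ 1 ^ i * x $ 2 ^ (d - i) :: 'a)" if "i \<le> d" for i
    using that assms(2) by (simp add: power_divide power_diff field_simps)
  show ?thesis
    unfolding bform_def e1 sum_distrib_left by (intro sum.cong refl) (metis e2 atMost_iff)
qed

lemma bform_infinity:
  assumes "x $ 2 = 0"
  shows "bform d p x = of_real (coeff p d) * (x $ 1) ^ d"
proof -
  have "bform d p x = (\<Sum>i\<le>d. if i = d then of_real (coeff p d) * (x $ 1) ^ d else 0)"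
    unfolding bform_def by (rule sum.cong) (auto simp: assms)
  then show ?thesis by simp
qed

lemma coeff_mult_top:
  fixes p q :: "'a::comm_semiring_0 poly"
  assumes "degree p \<le> d" "degree q \<le> e"
  shows "coeff (p * q) (d + e) = coeff p d * coeff q e"
proof -
  have "coeff (p * q) (d + e) = (\<Sum>i\<le>d + e. if i = d then coeff p d * coeff q e else 0)"
    unfolding coeff_mult
  proof (rule sum.cong[OF refl])
    fix i assume "i \<in> {..d + e}"
    then show "coeff p i * coeff q (d + e - i) = (if i = d then coeff p d * coeff q e else 0)"
      using assms by (cases i d rule: linorder_cases) (auto simp: coeff_eq_0)
  qed
  then show ?thesis by simp
qed

lemma map_poly_of_real_mult:
  "map_poly of_real (p * q) = (map_poly of_real p * map_poly of_real q :: 'a::real_normed_field poly)"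
  by (simp add: poly_eq_iff coeff_map_poly coeff_mult)

lemma map_poly_of_real_add:
  "map_poly of_real (p + q) = (map_poly of_real p + map_poly of_real q :: 'a::real_normed_field poly)"
  by (simp add: poly_eq_iff coeff_map_poly)

text \<open>The formal degrees \<open>d\<close> and \<open>e\<close> may exceed the actual ones, so
  the point at infinity needs its own argument: only the coefficients of formal top degree count
  there, and these multiply.\<close>

lemma bform_mult:
  assumes "degree p \<le> d" "degree q \<le> e"
  shows "bform (d + e) (p * q) x = bform d p x * bform e q x"
proof (cases "x $ 2 = 0")
  case True
  then show ?thesis
    by (simp add: bform_infinity coeff_mult_top[OF assms] power_add mult_ac)
next
  case False
  have "degree (p * q) \<le> d + e" using degree_mult_le[of p q] assms by linarith
  then show ?thesis
    using False assms by (simp add: bform_affine map_poly_of_real_mult power_add mult_ac)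
qed

section \<open>Proportional vectors and vanishing minors\<close>

definition wedge :: "'a::comm_ring_1 ^ 2 \<Rightarrow> 'a ^ 2 \<Rightarrow> 'a" where
  "wedge x y = x $ 1 * y $ 2 - x $ 2 * y $ 1"

lemma wedge_eq_0D:
  fixes x y :: "'a::field ^ 2"
  assumes "wedge x y = 0" "x \<noteq> 0"
  obtains c where "y = c *s x"
proof (cases "x $ 1 = 0")
  case True
  then have "x $ 2 \<noteq> 0" using assms(2) by (auto simp: vec_eq_iff forall_2)
  with True assms(1) have "y = (y $ 2 / x $ 2) *s x"
    by (auto simp: vec_eq_iff forall_2 wedge_def)
  then show ?thesis by (rule that)
next
  case False
  with assms(1) have "y = (y $ 1 / x $ 1) *s x"
    by (auto simp: vec_eq_iff forall_2 wedge_def field_simps)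
  then show ?thesis by (rule that)
qed

lemma wedge_scale [simp]: "wedge x (c *s x) = 0"
  by (simp add: wedge_def)

lemma ex_wedge_neq_0:
  fixes x :: "'a::field ^ 2"
  assumes "x \<noteq> 0" obtains y where "wedge x y \<noteq> 0"
proof (cases "x $ 1 = 0")
  case True
  then have "wedge x (axis 1 1) \<noteq> 0"
    using assms by (auto simp: wedge_def axis_def vec_eq_iff forall_2)
  then show ?thesis by (rule that)
next
  case False
  then have "wedge x (axis 2 1) \<noteq> 0" by (simp add: wedge_def axis_def)
  then show ?thesis by (rule that)
qed

lemma proj_eq_iff: "proj v = proj w \<longleftrightarrow> (\<exists>c. c \<noteq> 0 \<and> w = c *s v)"
  using proj_self[of w] proj_eqI[of w v] unfolding proj_def by blast

lemma proj_scale [simp]: "c \<noteq> 0 \<Longrightarrow> proj (c *s v) = proj v"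
  by (metis proj_eq_iff)

lemma proportional_iff_minors:
  fixes v w :: "'a::field ^ 'n"
  assumes "v \<noteq> 0"
  shows "(\<forall>a b. v $ a * w $ b = v $ b * w $ a) \<longleftrightarrow> (\<exists>c. w = c *s v)"
proof
  assume *: "\<forall>a b. v $ a * w $ b = v $ b * w $ a"
  obtain a where a: "v $ a \<noteq> 0" using assms by (auto simp: vec_eq_iff)
  have "w $ b = w $ a / v $ a * v $ b" for b
    using *[rule_format, of a b] a by (simp add: field_simps)
  then have "w = (w $ a / v $ a) *s v"
    unfolding vec_eq_iff vector_smult_component by blast
  then show "\<exists>c. w = c *s v" by blast
qed auto

section \<open>Continuity and differentiability of forms\<close>

lemma continuous_on_bform [continuous_intros]:
  fixes f :: "'b::topological_space \<Rightarrow> complex ^ 2"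
  assumes "continuous_on S f"
  shows "continuous_on S (\<lambda>x. bform d p (f x))"
  unfolding bform_def by (intro continuous_intros assms)

lemma bform_differentiable:
  fixes x :: "complex ^ 2"
  shows "bform d p differentiable (at x)"
proof -
  have nth: "(\<lambda>x :: complex ^ 2. x $ i) differentiable (at x)" for i x
    by (intro bounded_linear_imp_differentiable bounded_linear_vec_nth)
  show ?thesis unfolding bform_def
    by (intro differentiable_sum ballI differentiable_mult differentiable_power differentiable_const nth finite_atMost)
qed

lemma form_eval_has_derivative:
  "(form_eval d k has_derivative
     (\<lambda>v. \<chi> j. frechet_derivative (bform d (k $ j)) (at x) v)) (at (x :: complex ^ 2))"
proof -
  have eq: "form_eval d k = (\<lambda>x. \<chi> j. bform d (k $ j) x)" by (auto simp: vec_eq_iff)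
  have "((\<lambda>x. \<chi> j. bform d (k $ j) x) has_derivative
     (\<lambda>v. \<chi> j. frechet_derivative (bform d (k $ j)) (at x) v)) (at x)"
    unfolding has_derivative_componentwise_within[of "\<lambda>x. \<chi> j. _ j x"]
  proof
    fix b :: "complex ^ 'a" assume "b \<in> Basis"
    then obtain j u where b: "b = axis j u" "u \<in> Basis" by (auto simp: Basis_vec_def)
    have "((\<lambda>x. bform d (k $ j) x) has_derivative frechet_derivative (bform d (k $ j)) (at x)) (at x)"
      by (simp flip: frechet_derivative_works add: bform_differentiable)
    from has_derivative_inner_left[OF this, of u]
    show "((\<lambda>x. (\<chi> j. bform d (k $ j) x) \<bullet> b) has_derivative
      (\<lambda>v. (\<chi> j. frechet_derivative (bform d (k $ j)) (at x) v) \<bullet> b)) (at x)"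
      by (simp add: b inner_axis)
  qed
  then show ?thesis by (subst eq)
qed

lemma frechet_derivative_form_eval:
  "frechet_derivative (form_eval d k) (at (x :: complex ^ 2)) v $ j =
   frechet_derivative (bform d (k $ j)) (at x) v"
  using frechet_derivative_at[OF form_eval_has_derivative, of d k x, symmetric] by simp

section \<open>The Bezoutian criterion and openness of the knot condition\<close>


text \<open>An antisymmetrized pair of monomials vanishes for proportional \<open>x\<close> and
  \<open>y\<close>, so \<open>wedge x y\<close> divides it. For \<open>j \<le> i\<close> the
  quotient comes from the factorization of a difference of powers with exponent
  \<open>i - j\<close>, after the common monomial is taken out. Continuity serves the compactness
  argument for openness, differentiability the passage to the diagonal.\<close>

lemma bezout_kernel_exists:
  assumes "i \<le> d" "j \<le> d"
  shows "\<exists>E :: complex ^ 2 \<Rightarrow> complex ^ 2 \<Rightarrow> complex.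
    (\<forall>x y. x $ 1 ^ i * x $ 2 ^ (d - i) * (y $ 1 ^ j * y $ 2 ^ (d - j))
        - x $ 1 ^ j * x $ 2 ^ (d - j) * (y $ 1 ^ i * y $ 2 ^ (d - i)) = wedge x y * E x y) \<and>
    (\<forall>c e x y. E (c *s x) (e *s y) = (c * e) ^ (d - 1) * E x y) \<and>
    continuous_on UNIV (\<lambda>(x, y). E x y) \<and>
    (\<forall>x y. E x differentiable (at y))"
  using assms
proof (induction j i rule: linorder_wlog)
  case (le j i)
  define E :: "complex ^ 2 \<Rightarrow> complex ^ 2 \<Rightarrow> complex" where "E = (\<lambda>x y. (x $ 2 * y $ 2) ^ (d - i) * (x $ 1 * y $ 1) ^ j *
     (\<Sum>l<i - j. (x $ 2 * y $ 1) ^ (i - j - Suc l) * (x $ 1 * y $ 2) ^ l))"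
  show ?case
  proof (intro exI[of _ E] conjI allI)
    fix x y :: "complex ^ 2"
    have ij: "z ^ i = z ^ j * z ^ (i - j)" "z ^ (d - j) = z ^ (d - i) * z ^ (i - j)" for z :: complex
      using le by (simp_all flip: power_add)
    have "wedge x y * E x y = (x $ 2 * y $ 2) ^ (d - i) * (x $ 1 * y $ 1) ^ j *
       ((x $ 1 * y $ 2) ^ (i - j) - (x $ 2 * y $ 1) ^ (i - j))"
      unfolding power_diff_sumr2 E_def wedge_def by (simp add: mult_ac)
    then show "x $ 1 ^ i * x $ 2 ^ (d - i) * (y $ 1 ^ j * y $ 2 ^ (d - j))
        - x $ 1 ^ j * x $ 2 ^ (d - j) * (y $ 1 ^ i * y $ 2 ^ (d - i)) = wedge x y * E x y"
      by (simp add: ij power_mult_distrib algebra_simps)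
  next
    fix c e :: complex and x y :: "complex ^ 2"
    have "(c * x $ 2 * (e * y $ 2)) ^ (d - i) * (c * x $ 1 * (e * y $ 1)) ^ j *
        ((c * x $ 2 * (e * y $ 1)) ^ (i - j - Suc l) * (c * x $ 1 * (e * y $ 2)) ^ l) =
        (c * e) ^ (d - 1) * ((x $ 2 * y $ 2) ^ (d - i) * (x $ 1 * y $ 1) ^ j *
        ((x $ 2 * y $ 1) ^ (i - j - Suc l) * (x $ 1 * y $ 2) ^ l))" if "l < i - j" for l
    proof -
      have "d - 1 = (d - i) + j + (i - j - Suc l) + l" using that le by linarith
      then have "(c * e) ^ (d - 1) = (c * e) ^ (d - i) * (c * e) ^ j * (c * e) ^ (i - j - Suc l) * (c * e) ^ l"
        by (simp only: power_add)
      then show ?thesis by (simp only: power_mult_distrib) (simp only: mult_ac)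
    qed
    then show "E (c *s x) (e *s y) = (c * e) ^ (d - 1) * E x y"
      unfolding E_def sum_distrib_left vector_smult_component by (intro sum.cong refl) (metis lessThan_iff)
  next
    show "continuous_on UNIV (\<lambda>(x, y). E x y)"
      unfolding E_def case_prod_beta by (intro continuous_intros)
  next
    fix x y
    have nth: "(\<lambda>x :: complex ^ 2. x $ i) differentiable (at x)" for i x
      by (intro bounded_linear_imp_differentiable bounded_linear_vec_nth)
    show "E x differentiable (at y)" unfolding E_def
      by (intro differentiable_sum ballI differentiable_mult differentiable_power
          differentiable_const nth finite_lessThan)
  qed
next
  case (sym j i)
  then obtain E :: "complex ^ 2 \<Rightarrow> complex ^ 2 \<Rightarrow> complex" where
    1: "\<And>x y. x $ 1 ^ j * x $ 2 ^ (d - j) * (y $ 1 ^ i * y $ 2 ^ (d - i))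
        - x $ 1 ^ i * x $ 2 ^ (d - i) * (y $ 1 ^ j * y $ 2 ^ (d - j)) = wedge x y * E x y" and
    2: "\<And>c e x y. E (c *s x) (e *s y) = (c * e) ^ (d - 1) * E x y" and
    3: "continuous_on UNIV (\<lambda>(x, y). E x y)" and 4: "\<And>x y. E x differentiable (at y)"
    by blast
  show ?case
  proof (intro exI[of _ "\<lambda>x y. - E x y"] conjI allI)
    show "continuous_on UNIV (\<lambda>(x, y). - E x y)"
      using continuous_on_minus[OF 3] by (simp add: case_prod_unfold)
    show "(\<lambda>y. - E x y) differentiable (at y)" for x y
      using 4 by (intro differentiable_minus)
    show "- E (c *s x) (e *s y) = (c * e) ^ (d - 1) * - E x y" for c e x y
      by (simp add: 2)
    show "x $ 1 ^ i * x $ 2 ^ (d - i) * (y $ 1 ^ j * y $ 2 ^ (d - j))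
        - x $ 1 ^ j * x $ 2 ^ (d - j) * (y $ 1 ^ i * y $ 2 ^ (d - i)) = wedge x y * - E x y" for x y
      using 1[of x y] by (simp add: algebra_simps)
  qed
qed

text \<open>The chosen properties determine the function: where \<open>wedge x y\<close> is nonzero
  by division, elsewhere by continuity.\<close>

definition bezout_kernel :: "nat \<Rightarrow> nat \<Rightarrow> nat \<Rightarrow> complex ^ 2 \<Rightarrow> complex ^ 2 \<Rightarrow> complex" where
  "bezout_kernel d i j = (SOME E.
    (\<forall>x y. x $ 1 ^ i * x $ 2 ^ (d - i) * (y $ 1 ^ j * y $ 2 ^ (d - j))
        - x $ 1 ^ j * x $ 2 ^ (d - j) * (y $ 1 ^ i * y $ 2 ^ (d - i)) = wedge x y * E x y) \<and>
    (\<forall>c e x y. E (c *s x) (e *s y) = (c * e) ^ (d - 1) * E x y) \<and>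
    continuous_on UNIV (\<lambda>(x, y). E x y) \<and>
    (\<forall>x y. E x differentiable (at y)))"

lemma
  assumes "i \<le> d" "j \<le> d"
  shows bezout_kernel_wedge: "x $ 1 ^ i * x $ 2 ^ (d - i) * (y $ 1 ^ j * y $ 2 ^ (d - j))
        - x $ 1 ^ j * x $ 2 ^ (d - j) * (y $ 1 ^ i * y $ 2 ^ (d - i)) = wedge x y * bezout_kernel d i j x y"
    and bezout_kernel_scale: "bezout_kernel d i j (c *s x) (e *s y) = (c * e) ^ (d - 1) * bezout_kernel d i j x y"
    and continuous_on_bezout_kernel: "continuous_on UNIV (\<lambda>(x, y). bezout_kernel d i j x y)"
    and bezout_kernel_differentiable: "bezout_kernel d i j x differentiable (at y)"
  using someI_ex[OF bezout_kernel_exists[OF assms], folded bezout_kernel_def] by blast+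

text \<open>The classical Bezoutian of two binary forms: the minor of their values at
  \<open>x\<close> and \<open>y\<close>, divided by \<open>wedge x y\<close>. The sum runs over
  ordered pairs of exponents, hence the factor 1/2.\<close>

definition bezoutian :: "nat \<Rightarrow> real poly \<Rightarrow> real poly \<Rightarrow> complex ^ 2 \<Rightarrow> complex ^ 2 \<Rightarrow> complex" where
  "bezoutian d p q x y = (\<Sum>i\<le>d. \<Sum>j\<le>d.
     of_real (coeff p i * coeff q j - coeff q i * coeff p j) / 2 * bezout_kernel d i j x y)"

lemma bezoutian_wedge:
  "bform d p x * bform d q y - bform d q x * bform d p y = wedge x y * bezoutian d p q x y"
proof -
  define X where "X = (\<lambda>(x :: complex ^ 2) i. x $ 1 ^ i * x $ 2 ^ (d - i))"
  define W where "W = (\<lambda>i j. complex_of_real (coeff p i * coeff q j - coeff q i * coeff p j))"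
  have eq: "bform d r u = (\<Sum>i\<le>d. of_real (coeff r i) * X u i)" for r u
    by (simp add: bform_def X_def mult_ac)
  have L: "bform d p x * bform d q y - bform d q x * bform d p y = (\<Sum>i\<le>d. \<Sum>j\<le>d. W i j * (X x i * X y j))"
    unfolding eq sum_product W_def
    by (simp add: sum_subtractf[symmetric] algebra_simps)
  \<comment> \<open>The coefficients \<open>W\<close> are antisymmetric, so exchanging the indices
    shows that both halves of the antisymmetrized sum contribute equally.\<close>
  have "(\<Sum>i\<le>d. \<Sum>j\<le>d. W i j * (X x j * X y i)) = (\<Sum>i\<le>d. \<Sum>j\<le>d. W j i * (X x i * X y j))"
    by (rule sum.swap)
  also have "\<dots> = - (\<Sum>i\<le>d. \<Sum>j\<le>d. W i j * (X x i * X y j))"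
    by (simp add: W_def sum_negf[symmetric] algebra_simps)
  finally have S: "(\<Sum>i\<le>d. \<Sum>j\<le>d. W i j * (X x j * X y i)) = - (\<Sum>i\<le>d. \<Sum>j\<le>d. W i j * (X x i * X y j))" .
  have "wedge x y * bezoutian d p q x y
     = (\<Sum>i\<le>d. \<Sum>j\<le>d. W i j / 2 * (wedge x y * bezout_kernel d i j x y))"
    by (simp add: bezoutian_def W_def sum_distrib_left mult_ac)
  also have "\<dots> = (\<Sum>i\<le>d. \<Sum>j\<le>d. W i j / 2 * (X x i * X y j - X x j * X y i))"
    by (intro sum.cong refl) (simp add: bezout_kernel_wedge[symmetric] X_def)
  also have "\<dots> = ((\<Sum>i\<le>d. \<Sum>j\<le>d. W i j * (X x i * X y j)) - (\<Sum>i\<le>d. \<Sum>j\<le>d. W i j * (X x j * X y i))) / 2"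
    by (simp add: sum_subtractf[symmetric] sum_divide_distrib diff_divide_distrib algebra_simps)
  also have "\<dots> = (\<Sum>i\<le>d. \<Sum>j\<le>d. W i j * (X x i * X y j))"
    unfolding S by simp
  finally show ?thesis using L by simp
qed

lemma bezoutian_scale:
  "bezoutian d p q (c *s x) (e *s y) = (c * e) ^ (d - 1) * bezoutian d p q x y"
  unfolding bezoutian_def sum_distrib_left
  by (intro sum.cong refl) (simp add: bezout_kernel_scale)

lemma bezoutian_differentiable: "bezoutian d p q x differentiable (at y)"
  unfolding bezoutian_def
  by (intro differentiable_sum differentiable_mult differentiable_const ballI finite_atMost
      bezout_kernel_differentiable) auto

text \<open>\<open>bezoutian_wedge\<close> is differentiated in the second point at
  \<open>y = x\<close>. The factor \<open>wedge x y\<close> vanishes there, so only its own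
  derivative survives. Diagonal values of the Bezoutian thus detect a failure of immersion.\<close>

lemma bezoutian_diagonal:
  "bform d p x * frechet_derivative (bform d q) (at x) v
     - bform d q x * frechet_derivative (bform d p) (at x) v = wedge x v * bezoutian d p q x x"
proof -
  have D: "(bform d r has_derivative frechet_derivative (bform d r) (at x)) (at x)" for r
    by (simp flip: frechet_derivative_works add: bform_differentiable)
  have B: "(bezoutian d p q x has_derivative frechet_derivative (bezoutian d p q x) (at x)) (at x)"
    by (simp flip: frechet_derivative_works add: bezoutian_differentiable)
  have w: "(wedge x has_derivative wedge x) (at x)"
    unfolding wedge_def
    by (intro has_derivative_diff has_derivative_mult_right bounded_linear_imp_has_derivative
        bounded_linear_vec_nth)
  have "((\<lambda>y. bform d p x * bform d q y - bform d q x * bform d p y) has_derivative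
      (\<lambda>v. bform d p x * frechet_derivative (bform d q) (at x) v
     - bform d q x * frechet_derivative (bform d p) (at x) v)) (at x)"
    by (intro has_derivative_diff has_derivative_mult_right D)
  moreover have "((\<lambda>y. bform d p x * bform d q y - bform d q x * bform d p y) has_derivative
      (\<lambda>v. wedge x x * frechet_derivative (bezoutian d p q x) (at x) v + wedge x v * bezoutian d p q x x)) (at x)"
    unfolding bezoutian_wedge by (intro has_derivative_mult w B)
  ultimately have "(\<lambda>v. bform d p x * frechet_derivative (bform d q) (at x) v
     - bform d q x * frechet_derivative (bform d p) (at x) v) =
      (\<lambda>v. wedge x x * frechet_derivative (bezoutian d p q x) (at x) v + wedge x v * bezoutian d p q x x)"
    by (rule has_derivative_unique)
  from fun_cong[OF this, of v] show ?thesis by (simp add: wedge_def)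
qed

lemma wedge_neq_0D: "wedge x y \<noteq> 0 \<Longrightarrow> proj x \<noteq> proj y"
  by (auto simp: proj_eq_iff)

text \<open>The knot conditions merge into one nonvanishing statement: off the diagonal it separates
  the images of distinct parameters, on the diagonal it makes the differential injective, and a base
  point would kill all minors.\<close>

lemma real_rational_knot_iff_bezoutian:
  fixes k :: "real poly ^ 'n"
  shows "real_rational_knot d k \<longleftrightarrow> (\<forall>j. degree (k $ j) \<le> d) \<and>
    (\<forall>x y. x \<noteq> 0 \<longrightarrow> y \<noteq> 0 \<longrightarrow> (\<exists>a b. bezoutian d (k $ a) (k $ b) x y \<noteq> 0))"
    (is "?K \<longleftrightarrow> ?D \<and> ?B")
proof (intro iffI conjI allI impI)
  assume K: ?K
  then show "degree (k $ j) \<le> d" for j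
    by (simp add: real_rational_knot_def real_rational_curve_def)
  fix x y :: "complex ^ 2" assume x: "x \<noteq> 0" and y: "y \<noteq> 0"
  have nz: "form_eval d k x \<noteq> 0" "form_eval d k y \<noteq> 0"
    using K x y by (auto simp: real_rational_knot_def real_rational_curve_def)
  show "\<exists>a b. bezoutian d (k $ a) (k $ b) x y \<noteq> 0"
  proof (rule ccontr)
    assume "\<not> ?thesis"
    then have 0: "bezoutian d (k $ a) (k $ b) x y = 0" for a b by blast
    show False
    proof (cases "wedge x y = 0")
      case False
      have "form_eval d k x $ a * form_eval d k y $ b = form_eval d k x $ b * form_eval d k y $ a" for a b
        using bezoutian_wedge[of d "k $ a" x "k $ b" y] 0 by simp
      then obtain c where "form_eval d k y = c *s form_eval d k x"
        using proportional_iff_minors[OF nz(1)] by blast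
      moreover then have "c \<noteq> 0" using nz by auto
      ultimately have "proj (form_eval d k x) = proj (form_eval d k y)"
        by (auto simp: proj_eq_iff)
      then have "proj x = proj y"
        using K x y unfolding real_rational_knot_def complex_injective_def by blast
      with False wedge_neq_0D show False by blast
    next
      case True
      then obtain c where c: "y = c *s x" using wedge_eq_0D x by metis
      with y have "c \<noteq> 0" by auto
      \<comment> \<open>Bihomogeneity moves the vanishing from \<open>(x, c *s x)\<close> to the
        diagonal.\<close>
      have 0: "bezoutian d (k $ a) (k $ b) x x = 0" for a b
        using 0[of a b] bezoutian_scale[of d "k $ a" "k $ b" 1 x c x] \<open>c \<noteq> 0\<close> c by simp
      obtain v where v: "wedge x v \<noteq> 0" using ex_wedge_neq_0 x by blast
      have "form_eval d k x $ a * frechet_derivative (form_eval d k) (at x) v $ b =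
        form_eval d k x $ b * frechet_derivative (form_eval d k) (at x) v $ a" for a b
        using bezoutian_diagonal[of d "k $ a" x "k $ b" v] 0[of a b]
        by (simp add: frechet_derivative_form_eval)
      then obtain e where "frechet_derivative (form_eval d k) (at x) v = e *s form_eval d k x"
        using proportional_iff_minors[OF nz(1)] by blast
      then obtain a where "v = a *s x"
        using K x unfolding real_rational_knot_def complex_immersion_def by blast
      with v show False by simp
    qed
  qed
next
  assume *: "?D \<and> ?B"
  have w0: "wedge x y = 0" if xy: "x \<noteq> 0" "y \<noteq> 0"
    "\<And>a b. bform d (k $ a) x * bform d (k $ b) y = bform d (k $ b) x * bform d (k $ a) y" for x y :: "complex ^ 2"
  proof -
    obtain a b where "bezoutian d (k $ a) (k $ b) x y \<noteq> 0" using * xy by blast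
    then show ?thesis using bezoutian_wedge[of d "k $ a" x "k $ b" y] xy(3)[of a b] by simp
  qed
  \<comment> \<open>At a base point all minors with an arbitrary second point vanish; a second point
    that is not proportional to \<open>x\<close> then contradicts \<open>w0\<close>.\<close>
  have nz: "form_eval d k x \<noteq> 0" if x: "x \<noteq> 0" for x :: "complex ^ 2"
  proof
    assume "form_eval d k x = 0"
    then have "bform d (k $ a) x = 0" for a by (metis form_eval_nth zero_index)
    moreover obtain y where y: "wedge x y \<noteq> 0" using ex_wedge_neq_0 x by blast
    moreover then have "y \<noteq> 0" by (auto simp: wedge_def)
    ultimately show False using w0[of x y] x by simp
  qed
  show ?K unfolding real_rational_knot_def real_rational_curve_def complex_injective_def complex_immersion_def
  proof (intro conjI allI impI nz; (elim conjE)?)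
    show "degree (k $ j) \<le> d" for j using * by blast
  next
    fix x y :: "complex ^ 2" assume x: "x \<noteq> 0" and y: "y \<noteq> 0" and "proj (form_eval d k x) = proj (form_eval d k y)"
    then obtain c where "form_eval d k y = c *s form_eval d k x" unfolding proj_eq_iff by blast
    then have "bform d (k $ a) y = c * bform d (k $ a) x" for a
      by (metis form_eval_nth vector_smult_component)
    then have "wedge x y = 0" using w0[OF x y] by simp
    then obtain c where c: "y = c *s x" using wedge_eq_0D x by metis
    with y have "c \<noteq> 0" by auto
    with c show "proj x = proj y" by simp
  next
    fix x v :: "complex ^ 2" and c assume x: "x \<noteq> 0"
      and "frechet_derivative (form_eval d k) (at x) v = c *s form_eval d k x"
    then have eq: "frechet_derivative (bform d (k $ a)) (at x) v = c * bform d (k $ a) x" for a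
      by (metis form_eval_nth vector_smult_component frechet_derivative_form_eval)
    obtain a b where "bezoutian d (k $ a) (k $ b) x x \<noteq> 0" using * x by blast
    then have "wedge x v = 0" using bezoutian_diagonal[of d "k $ a" x "k $ b" v] by (simp add: eq)
    then show "\<exists>a. v = a *s x" using wedge_eq_0D x by metis
  qed
qed

text \<open>Compactness: non-knots converging to \<open>k\<close> have common zeros of all their
  Bezoutians, and bihomogeneity places these on a product of unit spheres. A limit point is a common
  zero of the Bezoutians of \<open>k\<close>.\<close>

lemma real_rational_knot_open:
  fixes k :: "real poly ^ 'n"
  assumes "real_rational_knot d k"
  shows "\<exists>\<delta>>0. \<forall>k' :: real poly ^ 'n.
    (\<forall>j. degree (k' $ j) \<le> d \<and> (\<forall>i\<le>d. \<bar>coeff (k' $ j) i - coeff (k $ j) i\<bar> < \<delta>)) \<longrightarrow> real_rational_knot d k'"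
proof (rule ccontr)
  assume "\<not> ?thesis"
  then have "\<exists>k' :: real poly ^ 'n. (\<forall>j. degree (k' $ j) \<le> d \<and>
      (\<forall>i\<le>d. \<bar>coeff (k' $ j) i - coeff (k $ j) i\<bar> < \<delta>)) \<and> \<not> real_rational_knot d k'" if "\<delta> > 0" for \<delta>
    using that by blast
  then have "\<exists>k' :: real poly ^ 'n. (\<forall>j. degree (k' $ j) \<le> d \<and>
      (\<forall>i\<le>d. \<bar>coeff (k' $ j) i - coeff (k $ j) i\<bar> < inverse (real (Suc n)))) \<and> \<not> real_rational_knot d k'" for n
    by simp
  then obtain k' :: "nat \<Rightarrow> real poly ^ 'n" where k': "\<And>n j. degree (k' n $ j) \<le> d"
      "\<And>n j i. i \<le> d \<Longrightarrow> \<bar>coeff (k' n $ j) i - coeff (k $ j) i\<bar> < inverse (real (Suc n))"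
      "\<And>n. \<not> real_rational_knot d (k' n)"
    by metis
  have lim: "(\<lambda>n. coeff (k' n $ j) i) \<longlonglongrightarrow> coeff (k $ j) i" if "i \<le> d" for i j
  proof (rule Lim_transform[OF tendsto_const])
    show "(\<lambda>n. coeff (k' n $ j) i - coeff (k $ j) i) \<longlonglongrightarrow> 0"
      by (rule Lim_null_comparison[OF _ LIMSEQ_inverse_real_of_nat])
        (use k'(2)[OF that] in \<open>auto intro!: always_eventually less_imp_le\<close>)
  qed
  define S where "S = sphere (0 :: complex ^ 2) 1 \<times> sphere (0 :: complex ^ 2) 1"
  have "\<exists>z. z \<in> S \<and> (\<forall>a b. bezoutian d (k' n $ a) (k' n $ b) (fst z) (snd z) = 0)" for n
  proof -
    obtain x y where xy: "x \<noteq> 0" "y \<noteq> 0" "\<And>a b. bezoutian d (k' n $ a) (k' n $ b) x y = 0"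
      using k'(1,3) real_rational_knot_iff_bezoutian by metis
    define u where "u = of_real (inverse (norm x)) *s x"
    define v where "v = of_real (inverse (norm y)) *s y"
    have sc: "complex_of_real r *s z = r *\<^sub>R z" for r and z :: "complex ^ 2"
      by (simp only: vec_eq_iff vector_smult_component vector_scaleR_component) (simp add: scaleR_conv_of_real)
    have "bezoutian d (k' n $ a) (k' n $ b) u v = 0" for a b
      unfolding u_def v_def bezoutian_scale xy(3) by simp
    moreover have "(u, v) \<in> S" using xy(1,2) by (simp add: S_def u_def v_def sc del: of_real_inverse)
    ultimately show ?thesis by force
  qed
  then obtain z where z: "\<And>n. z n \<in> S"
    "\<And>n a b. bezoutian d (k' n $ a) (k' n $ b) (fst (z n)) (snd (z n)) = 0" by metis
  have "compact S" unfolding S_def by (intro compact_Times compact_sphere)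
  then obtain l r where l: "l \<in> S" "strict_mono r" "(z \<circ> r) \<longlonglongrightarrow> l"
    using z(1) unfolding compact_def by metis
  have "bezoutian d (k $ a) (k $ b) (fst l) (snd l) = 0" for a b
  proof -
    have "(\<lambda>n. bezout_kernel d i j (fst ((z \<circ> r) n)) (snd ((z \<circ> r) n))) \<longlonglongrightarrow> bezout_kernel d i j (fst l) (snd l)"
      if "i \<le> d" "j \<le> d" for i j
      using continuous_on_tendsto_compose[OF continuous_on_bezout_kernel[OF that] l(3)]
      by (simp add: case_prod_unfold)
    moreover have lr: "(\<lambda>n. coeff (k' (r n) $ j) i) \<longlonglongrightarrow> coeff (k $ j) i" if "i \<le> d" for i j
      using LIMSEQ_subseq_LIMSEQ[OF lim[OF that] l(2)] by (simp add: o_def)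
    ultimately have "(\<lambda>n. bezoutian d (k' (r n) $ a) (k' (r n) $ b) (fst ((z \<circ> r) n)) (snd ((z \<circ> r) n)))
       \<longlonglongrightarrow> bezoutian d (k $ a) (k $ b) (fst l) (snd l)"
      unfolding bezoutian_def by (intro tendsto_intros) auto
    then have "(\<lambda>n. 0) \<longlonglongrightarrow> bezoutian d (k $ a) (k $ b) (fst l) (snd l)"
      by (simp add: z(2))
    then show ?thesis using LIMSEQ_unique tendsto_const by blast
  qed
  moreover have "fst l \<noteq> 0" "snd l \<noteq> 0" using l(1) by (auto simp: S_def)
  ultimately show False using assms real_rational_knot_iff_bezoutian by metis
qed

section \<open>Linear images of curves\<close>


definition lin_image :: "real ^ 'n ^ 'm \<Rightarrow> real poly ^ 'n \<Rightarrow> real poly ^ 'm" where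
  "lin_image R k = (\<chi> i. \<Sum>j\<in>UNIV. smult (R $ i $ j) (k $ j))"

lemma lin_image_nth: "lin_image R k $ i = (\<Sum>j\<in>UNIV. smult (R $ i $ j) (k $ j))"
  by (simp add: lin_image_def)

lemma degree_lin_image: "(\<And>j. degree (k $ j) \<le> d) \<Longrightarrow> degree (lin_image R k $ i) \<le> d"
  unfolding lin_image_nth by (intro degree_sum_le) (auto intro: order.trans[OF degree_smult_le])

lemma bform_lin_image:
  "bform d (lin_image R k $ i) x = (\<Sum>j\<in>UNIV. of_real (R $ i $ j) * bform d (k $ j) x)"
  by (simp add: lin_image_nth bform_sum bform_smult)

lemma form_eval_lin_image: "form_eval d (lin_image R k) x = cmat R *v form_eval d k x"
  by (simp add: vec_eq_iff bform_lin_image cmat_def matrix_vector_mult_def)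

lemma lin_image_mult: "lin_image S (lin_image R k) = lin_image (S ** R) k"
proof -
  have "(\<Sum>j\<in>UNIV. \<Sum>l\<in>UNIV. S $ i $ j * (R $ j $ l * coeff (k $ l) n)) =
    (\<Sum>l\<in>UNIV. \<Sum>j\<in>UNIV. S $ i $ j * (R $ j $ l * coeff (k $ l) n))" for i n
    by (rule sum.swap)
  then show ?thesis
    by (simp add: vec_eq_iff poly_eq_iff lin_image_nth matrix_matrix_mult_def coeff_sum
        sum_distrib_left sum_distrib_right mult.assoc)
qed

lemma lin_image_mat_1 [simp]: "lin_image (mat 1) k = k"
proof -
  have "(\<Sum>j\<in>UNIV. smult (mat 1 $ i $ j) (k $ j)) = (\<Sum>j\<in>UNIV. if j = i then k $ i else 0)" for i
    by (intro sum.cong) (auto simp: mat_def)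
  then show ?thesis by (simp add: vec_eq_iff lin_image_nth)
qed

section \<open>Bilinearity of the Bezoutian\<close>

lemma bezoutian_swap: "bezoutian d q p x y = - bezoutian d p q x y"
  by (simp add: bezoutian_def sum_negf[symmetric] algebra_simps diff_divide_distrib)

lemma bezoutian_smult_left: "bezoutian d (smult c p) q x y = of_real c * bezoutian d p q x y"
  by (simp add: bezoutian_def sum_distrib_left algebra_simps diff_divide_distrib)

lemma bezoutian_add_left: "bezoutian d (p + p') q x y = bezoutian d p q x y + bezoutian d p' q x y"
  by (simp add: bezoutian_def sum.distrib[symmetric] algebra_simps diff_divide_distrib add_divide_distrib)

lemma bezoutian_0_left [simp]: "bezoutian d 0 q x y = 0"
  by (simp add: bezoutian_def)

lemma bezoutian_sum_left: "bezoutian d (\<Sum>i\<in>I. f i) q x y = (\<Sum>i\<in>I. bezoutian d (f i) q x y)"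
  by (induction I rule: infinite_finite_induct) (auto simp: bezoutian_add_left)

lemma bezoutian_lin_image_left:
  "bezoutian d (lin_image R k $ a) q x y = (\<Sum>i\<in>UNIV. of_real (R $ a $ i) * bezoutian d (k $ i) q x y)"
  by (simp add: lin_image_nth bezoutian_sum_left bezoutian_smult_left)

text \<open>The Bezoutian is bilinear and antisymmetric. If all Bezoutians of the image vanish at a
  pair of points, the inverse matrix applied in one slot and then in the other makes those of
  \<open>k\<close> vanish too.\<close>

lemma real_rational_knot_lin_image:
  fixes R :: "real ^ 'n ^ 'n"
  assumes "real_rational_knot d k" "invertible R"
  shows "real_rational_knot d (lin_image R k)"
proof -
  obtain S where "S ** R = mat 1" using assms(2) unfolding invertible_def by blast
  then have k: "k = lin_image S (lin_image R k)" by (simp add: lin_image_mult)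
  have "\<exists>a b. bezoutian d (lin_image R k $ a) (lin_image R k $ b) x y \<noteq> 0" if "x \<noteq> 0" "y \<noteq> 0" for x y
  proof (rule ccontr)
    assume "\<not> ?thesis"
    then have "bezoutian d (lin_image R k $ a) (lin_image R k $ b) x y = 0" for a b by blast
    then have "bezoutian d (k $ a) (lin_image R k $ b) x y = 0" for a b
      by (subst k) (simp add: bezoutian_lin_image_left)
    then have "bezoutian d (lin_image R k $ b) (k $ a) x y = 0" for a b
      by (metis bezoutian_swap neg_equal_0_iff_equal)
    then have "bezoutian d (k $ b) (k $ a) x y = 0" for a b
      by (subst (1) k) (simp add: bezoutian_lin_image_left)
    then show False using assms(1) that unfolding real_rational_knot_iff_bezoutian by blast
  qed
  then show ?thesis using assms(1) unfolding real_rational_knot_iff_bezoutian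
    by (simp add: degree_lin_image)
qed

section \<open>Real and imaginary parts of complex vectors\<close>

definition re_vec :: "complex ^ 'n \<Rightarrow> real ^ 'n" where "re_vec z = (\<chi> j. Re (z $ j))"
definition im_vec :: "complex ^ 'n \<Rightarrow> real ^ 'n" where "im_vec z = (\<chi> j. Im (z $ j))"

lemma re_im_vec: "z = cvec (re_vec z) + \<i> *s cvec (im_vec z)"
  by (simp add: vec_eq_iff re_vec_def im_vec_def cvec_def complex_eq_iff)

lemma cvec_nth [simp]: "cvec v $ j = of_real (v $ j)"
  by (simp add: cvec_def)

lemma cvec_0 [simp]: "cvec 0 = 0"
  by (simp add: vec_eq_iff)

lemma cvec_eq_0_iff [simp]: "cvec v = 0 \<longleftrightarrow> v = 0"
  by (simp add: vec_eq_iff)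

lemma re_vec_cmat: "re_vec (cmat A *v z) = A *v re_vec z"
  by (simp add: vec_eq_iff re_vec_def cmat_def matrix_vector_mult_def)

lemma im_vec_cmat: "im_vec (cmat A *v z) = A *v im_vec z"
  by (simp add: vec_eq_iff im_vec_def cmat_def matrix_vector_mult_def)

lemma complex_vec_eqI: "re_vec v = re_vec w \<Longrightarrow> im_vec v = im_vec w \<Longrightarrow> v = w"
  by (simp add: vec_eq_iff re_vec_def im_vec_def complex_eq_iff)

lemma re_vec_0 [simp]: "re_vec 0 = 0" and im_vec_0 [simp]: "im_vec 0 = 0"
  by (simp_all add: re_vec_def im_vec_def vec_eq_iff)

lemma bform_of_real:
  "bform d p (cvec x) = complex_of_real (bform d p x)"
  by (simp add: bform_def)

lemma form_eval_cvec: "form_eval d k (cvec x) = cvec (form_eval d k x)"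
  by (simp add: vec_eq_iff bform_of_real)

section \<open>Derivatives of binary forms\<close>

abbreviation bform_deriv :: "nat \<Rightarrow> real poly \<Rightarrow> complex ^ 2 \<Rightarrow> complex ^ 2 \<Rightarrow> complex" where
  "bform_deriv d p x \<equiv> frechet_derivative (bform d p) (at x)"

lemma bform_has_derivative: "(bform d p has_derivative bform_deriv d p x) (at x)"
  by (simp flip: frechet_derivative_works add: bform_differentiable)

lemma bform_deriv_eqI: "(bform d p has_derivative D) (at x) \<Longrightarrow> bform_deriv d p x v = D v"
  using frechet_derivative_at by metis

lemma bform_deriv_diff: "bform_deriv d (p - q) x v = bform_deriv d p x v - bform_deriv d q x v"
proof (rule bform_deriv_eqI)
  have "((\<lambda>x. bform d p x - bform d q x) has_derivative (\<lambda>v. bform_deriv d p x v - bform_deriv d q x v)) (at x)"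
    by (intro has_derivative_diff bform_has_derivative)
  then show "(bform d (p - q) has_derivative (\<lambda>v. bform_deriv d p x v - bform_deriv d q x v)) (at x)"
    by (simp add: bform_diff[abs_def])
qed

lemma bform_deriv_smult: "bform_deriv d (smult c p) x v = of_real c * bform_deriv d p x v"
proof (rule bform_deriv_eqI)
  have "((\<lambda>x. of_real c * bform d p x) has_derivative (\<lambda>v. of_real c * bform_deriv d p x v)) (at x)"
    by (intro has_derivative_mult_right bform_has_derivative)
  then show "(bform d (smult c p) has_derivative (\<lambda>v. of_real c * bform_deriv d p x v)) (at x)"
    by (simp add: bform_smult[abs_def])
qed

lemma bform_deriv_mult:
  assumes "degree p \<le> d" "degree q \<le> e"
  shows "bform_deriv (d + e) (p * q) x v = bform d p x * bform_deriv e q x v + bform_deriv d p x v * bform e q x"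
proof (rule bform_deriv_eqI)
  have "((\<lambda>x. bform d p x * bform e q x) has_derivative
     (\<lambda>v. bform d p x * bform_deriv e q x v + bform_deriv d p x v * bform e q x)) (at x)"
    by (intro has_derivative_mult bform_has_derivative)
  then show "(bform (d + e) (p * q) has_derivative
     (\<lambda>v. bform d p x * bform_deriv e q x v + bform_deriv d p x v * bform e q x)) (at x)"
    by (simp add: bform_mult[OF assms, abs_def])
qed

lemma bform_deriv_lin_image:
  "bform_deriv d (lin_image R k $ i) x v = (\<Sum>j\<in>UNIV. of_real (R $ i $ j) * bform_deriv d (k $ j) x v)"
proof (rule bform_deriv_eqI)
  have "((\<lambda>x. \<Sum>j\<in>UNIV. of_real (R $ i $ j) * bform d (k $ j) x) has_derivative
     (\<lambda>v. \<Sum>j\<in>UNIV. of_real (R $ i $ j) * bform_deriv d (k $ j) x v)) (at x)"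
    by (intro has_derivative_sum has_derivative_mult_right bform_has_derivative)
  then show "(bform d (lin_image R k $ i) has_derivative
     (\<lambda>v. \<Sum>j\<in>UNIV. of_real (R $ i $ j) * bform_deriv d (k $ j) x v)) (at x)"
    by (simp add: bform_lin_image[abs_def])
qed

section \<open>Closures in the projective topology\<close>

lemma topspace_proj: "topspace (proj_topology :: ('a::real_normed_field ^ 'n) set topology) = proj_space"
proof -
  have "\<Union>(proj_space :: ('a ^ 'n) set set) = - {0}"
  proof (intro equalityI subsetI)
    fix v :: "'a ^ 'n" assume "v \<in> - {0}"
    then have "proj v \<in> proj_space" by (auto simp: proj_space_def)
    then show "v \<in> \<Union> proj_space" using proj_self by blast
  qed (auto simp: proj_space_def proj_def)
  then have "openin proj_topology (proj_space :: ('a ^ 'n) set set)"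
    by (simp add: openin_proj_topology open_Compl)
  then show ?thesis unfolding topspace_def openin_proj_topology by blast
qed

lemma continuous_on_form_eval:
  "continuous_on S (form_eval d k :: complex ^ 2 \<Rightarrow> _)"
proof -
  have "continuous_on S (\<lambda>x :: complex ^ 2. \<chi> j. bform d (k $ j) x)"
    by (intro continuous_intros)
  moreover have eq: "form_eval d k = (\<lambda>x :: complex ^ 2. \<chi> j. bform d (k $ j) x)"
    by (auto simp: vec_eq_iff)
  ultimately show ?thesis by (subst eq)
qed

text \<open>On the unit sphere the parameter ranges over a compact set, and the vanishing of minors
  is a closed condition on parameter and vector; projecting along a compact factor preserves
  closedness. The scalar \<open>c = 0\<close> puts the vertex into the cone, so the complement is
  exactly the union of the classes off the curve.\<close>

lemma closed_cone_over_curve: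
  assumes "real_rational_curve d (k :: real poly ^ 'n)"
  shows "closed {v. \<exists>c. \<exists>x :: complex ^ 2. x \<noteq> 0 \<and> v = c *s form_eval d k x}"
proof -
  let ?S = "sphere (0 :: complex ^ 2) 1"
  have "{v. \<exists>c. \<exists>x :: complex ^ 2. x \<noteq> 0 \<and> v = c *s form_eval d k x} =
    {v. \<exists>x. x \<in> ?S \<and> (x, v) \<in> {z. \<forall>a b. form_eval d k (fst z) $ a * snd z $ b = form_eval d k (fst z) $ b * snd z $ a}}"
    (is "?L = ?R")
  proof (intro equalityI subsetI)
    fix v assume "v \<in> ?L"
    then obtain c and x :: "complex ^ 2" where x: "x \<noteq> 0" "v = c *s form_eval d k x" by blast
    define u where "u = of_real (inverse (norm x)) *s x"
    have "u = inverse (norm x) *\<^sub>R x"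
      unfolding u_def by (simp only: vec_eq_iff vector_smult_component vector_scaleR_component)
        (simp add: scaleR_conv_of_real)
    then have "u \<in> ?S" using x by simp
    moreover have "form_eval d k u = of_real (inverse (norm x)) ^ d *s form_eval d k x"
      unfolding u_def by (rule form_eval_scale)
    then have "form_eval d k u $ a * v $ b = form_eval d k u $ b * v $ a" for a b
      by (simp add: x(2))
    ultimately show "v \<in> ?R" by auto
  next
    fix v assume "v \<in> ?R"
    then obtain x where x: "x \<in> ?S" "\<forall>a b. form_eval d k x $ a * v $ b = form_eval d k x $ b * v $ a"
      by auto
    then have "x \<noteq> 0" by auto
    then have "form_eval d k x \<noteq> 0" using assms by (simp add: real_rational_curve_def)
    then show "v \<in> ?L" using x(2) \<open>x \<noteq> 0\<close> proportional_iff_minors by blast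
  qed
  moreover have "closed ?R"
  proof (rule closed_compact_projection[OF compact_sphere])
    show "closed {z :: (complex ^ 2) \<times> (complex ^ 'n). \<forall>a b. form_eval d k (fst z) $ a * snd z $ b = form_eval d k (fst z) $ b * snd z $ a}"
      unfolding form_eval_nth
      by (intro closed_Collect_all closed_Collect_eq continuous_intros)
  qed
  ultimately show ?thesis by simp
qed

text \<open>By continuity a dense set \<open>U\<close> of parameters has a dense image in the curve,
  and the curve is closed. This evaluates the closure in \<open>stereographic_curve\<close>, where
  the parameters over the tangent hyperplane are missing.\<close>

lemma closure_of_curve_points:
  assumes k: "real_rational_curve d (k :: real poly ^ 'n)"
    and U: "0 \<notin> U" "\<And>x :: complex ^ 2. x \<noteq> 0 \<Longrightarrow> x \<in> closure U"
  shows "proj_topology closure_of {proj (form_eval d k x) | x. x \<in> U} = complex_points d k"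
proof -
  let ?F = "form_eval d k :: complex ^ 2 \<Rightarrow> complex ^ 'n"
  have nz: "?F x \<noteq> 0" if "x \<noteq> 0" for x using k that by (simp add: real_rational_curve_def)
  show ?thesis
  proof (intro equalityI)
    show "complex_points d k \<subseteq> proj_topology closure_of {proj (?F x) | x. x \<in> U}"
    proof
      fix P assume "P \<in> complex_points d k"
      then obtain x where x: "x \<noteq> 0" "P = proj (?F x)" unfolding complex_points_def by blast
      show "P \<in> proj_topology closure_of {proj (?F x) | x. x \<in> U}"
        unfolding in_closure_of topspace_proj
      proof (intro conjI allI impI)
        show "P \<in> proj_space" using x nz by (auto simp: proj_space_def)
        fix T assume T: "P \<in> T \<and> openin proj_topology T"
        then have "open (?F -` \<Union>T)"
          by (intro open_vimage) (auto simp: openin_proj_topology continuous_on_form_eval)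
        moreover have "x \<in> ?F -` \<Union>T" using T x proj_self by blast
        ultimately obtain u where u: "u \<in> U" "u \<in> ?F -` \<Union>T"
          using U(2)[OF x(1)] unfolding closure_iff_nhds_not_empty by blast
        then obtain Q where Q: "Q \<in> T" "?F u \<in> Q" by blast
        then have "Q = proj (?F u)"
          using T unfolding openin_proj_topology proj_space_def using proj_eqI by blast
        then show "\<exists>y. y \<in> {proj (?F x) | x. x \<in> U} \<and> y \<in> T" using Q u by blast
      qed
    qed
    have "openin proj_topology (proj_space - complex_points d k)"
      unfolding openin_proj_topology
    proof (intro conjI)
      let ?Z = "{v. \<exists>c. \<exists>x :: complex ^ 2. x \<noteq> 0 \<and> v = c *s ?F x}"
      have "\<Union>(proj_space - complex_points d k) = - ?Z"
      proof (intro equalityI subsetI)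
        fix v assume "v \<in> \<Union>(proj_space - complex_points d k)"
        then obtain P where P: "P \<in> proj_space" "P \<notin> complex_points d k" "v \<in> P" by blast
        then have Pv: "P = proj v" "v \<noteq> 0" unfolding proj_space_def proj_def
          using proj_eqI[unfolded proj_def] by (blast, auto simp: proj_def)
        have "v \<noteq> c *s ?F x" if "x \<noteq> 0" for c x
        proof
          assume v: "v = c *s ?F x"
          then have "c \<noteq> 0" using Pv(2) by auto
          then have "P = proj (?F x)" using Pv(1) v by simp
          then show False using P(2) that by (auto simp: complex_points_def)
        qed
        then show "v \<in> - ?Z" by blast
      next
        fix v assume v: "v \<in> - ?Z"
        have "v \<noteq> 0"
        proof
          assume "v = 0"
          then have "v = 0 *s ?F 1" by simp
          moreover have "(1 :: complex ^ 2) \<noteq> 0" by simp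
          ultimately show False using v by blast
        qed
        moreover have "proj v \<notin> complex_points d k"
        proof
          assume "proj v \<in> complex_points d k"
          then obtain x :: "complex ^ 2" where x: "x \<noteq> 0" "proj v = proj (?F x)"
            unfolding complex_points_def by blast
          then have "v \<in> proj (?F x)" using proj_self[of v] by simp
          then show False using v x(1) unfolding proj_def by blast
        qed
        ultimately have "proj v \<in> proj_space - complex_points d k"
          by (auto simp: proj_space_def)
        then show "v \<in> \<Union>(proj_space - complex_points d k)" using proj_self by blast
      qed
      then show "open (\<Union>(proj_space - complex_points d k))"
        using closed_cone_over_curve[OF k] by (simp add: open_Compl)
    qed blast
    moreover have "complex_points d k \<subseteq> proj_space"
      using nz by (auto simp: complex_points_def proj_space_def)
    ultimately have "closedin proj_topology (complex_points d k)"
      by (simp add: closedin_def topspace_proj)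
    moreover have "{proj (?F x) | x. x \<in> U} \<subseteq> complex_points d k"
      using U(1) unfolding complex_points_def by blast
    ultimately show "proj_topology closure_of {proj (?F x) | x. x \<in> U} \<subseteq> complex_points d k"
      by (rule closure_of_minimal[rotated])
  qed
qed

text \<open>A nonzero form vanishes on finitely many lines through the origin only. A real
  translation of \<open>x\<close> along a coordinate axis avoids them for all but finitely many
  \<open>t\<close>; the second coordinate is moved if it is zero, otherwise the first.\<close>

lemma closure_form_nonzero:
  assumes f: "f \<noteq> 0" "degree f \<le> d" and x: "(x :: complex ^ 2) \<noteq> 0"
  shows "x \<in> closure {x. x \<noteq> 0 \<and> bform d f x \<noteq> 0}"
proof -
  define F where "F = map_poly complex_of_real f"
  have "F \<noteq> 0" using f by (simp add: F_def map_poly_eq_0_iff)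
  then have fin: "finite {z. poly F z = 0}" by (rule poly_roots_finite)
  have good: "y \<in> {x. x \<noteq> 0 \<and> bform d f x \<noteq> 0}" if "y $ 2 \<noteq> 0" "poly F (y $ 1 / y $ 2) \<noteq> 0" for y
    using that f by (auto simp: bform_affine F_def)
  have ex: "\<exists>t. 0 < t \<and> t < e \<and> t \<notin> S" if "finite S" "0 < e" for S :: "real set" and e
  proof -
    have "infinite ({0<..<e} - S)" using that by (intro Diff_infinite_finite) auto
    then obtain t where "t \<in> {0<..<e} - S" using infinite_imp_nonempty by blast
    then show ?thesis by auto
  qed
  show ?thesis unfolding closure_approachable
  proof (intro allI impI)
    fix e :: real assume e: "0 < e"
    have ds: "dist (x + of_real t *s axis i 1) x = \<bar>t\<bar>" for t i
    proof -
      have "of_real t *s axis i 1 = axis i (complex_of_real t)" by (simp add: vec_eq_iff axis_def)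
      moreover have "norm (axis i (complex_of_real t)) = \<bar>t\<bar>"
        by (simp add: norm_vec_def L2_set_def axis_def if_distrib[of norm] if_distrib[of "\<lambda>x. x\<^sup>2"] cong: if_cong)
      ultimately show ?thesis by (simp add: dist_norm)
    qed
    show "\<exists>y\<in>{x. x \<noteq> 0 \<and> bform d f x \<noteq> 0}. dist y x < e"
    proof (cases "x $ 2 = 0")
      case True
      then have x1: "x $ 1 \<noteq> 0" using x by (auto simp: vec_eq_iff forall_2)
      \<comment> \<open>If \<open>x $ 1 / t\<close> is a root \<open>z\<close>, then
        \<open>t = x $ 1 / z\<close>. Real parts turn these values into a finite set of excluded
        reals.\<close>
      have "finite ((\<lambda>t. Re (x $ 1 / t)) ` {z. poly F z = 0})" using fin by blast
      from ex[OF this e] obtain t where t: "0 < t" "t < e" "t \<notin> (\<lambda>t. Re (x $ 1 / t)) ` {z. poly F z = 0}"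
        by blast
      have "poly F (x $ 1 / of_real t) \<noteq> 0"
      proof
        assume "poly F (x $ 1 / of_real t) = 0"
        moreover have "t = Re (x $ 1 / (x $ 1 / of_real t))" using x1 by simp
        ultimately show False using t(3) by blast
      qed
      then have "x + of_real t *s axis 2 1 \<in> {x. x \<noteq> 0 \<and> bform d f x \<noteq> 0}"
        using t(1) True by (intro good) (simp_all add: axis_def)
      then show ?thesis using ds[of t 2] t(1,2) by (intro bexI[of _ "x + of_real t *s axis 2 1"]) simp_all
    next
      case False
      have "finite ((\<lambda>z. Re (x $ 2 * z - x $ 1)) ` {z. poly F z = 0})" using fin by blast
      from ex[OF this e] obtain t where t: "0 < t" "t < e" "t \<notin> (\<lambda>z. Re (x $ 2 * z - x $ 1)) ` {z. poly F z = 0}"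
        by blast
      have "poly F ((x $ 1 + of_real t) / x $ 2) \<noteq> 0"
      proof
        assume "poly F ((x $ 1 + of_real t) / x $ 2) = 0"
        moreover have "t = Re (x $ 2 * ((x $ 1 + of_real t) / x $ 2) - x $ 1)" using False by simp
        ultimately show False using t(3) by blast
      qed
      then have "x + of_real t *s axis 1 1 \<in> {x. x \<noteq> 0 \<and> bform d f x \<noteq> 0}"
        using t(1) False by (intro good) (simp_all add: axis_def)
      then show ?thesis using ds[of t 1] t(1,2) by (intro bexI[of _ "x + of_real t *s axis 1 1"]) simp_all
    qed
  qed
qed

section \<open>Lifting a curve to the sphere\<close>


text \<open>The bilinear form of signature (1,4) whose real isotropic vectors represent the points
  of the sphere. Over a general commutative ring it serves real vectors, complex vectors and vectors
  of polynomials alike.\<close>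

definition lor :: "'a::comm_ring_1 ^ 5 \<Rightarrow> 'a ^ 5 \<Rightarrow> 'a" where
  "lor x y = x $ 0 * y $ 0 - x $ 1 * y $ 1 - x $ 2 * y $ 2 - x $ 3 * y $ 3 - x $ 4 * y $ 4"

lemma lor_eq_0_iff:
  "lor x y = 0 \<longleftrightarrow> x $ 1 * y $ 1 + x $ 2 * y $ 2 + x $ 3 * y $ 3 + x $ 4 * y $ 4 = x $ 0 * y $ 0"
proof -
  have "lor x y = x $ 0 * y $ 0 - (x $ 1 * y $ 1 + x $ 2 * y $ 2 + x $ 3 * y $ 3 + x $ 4 * y $ 4)"
    unfolding lor_def by (simp only: diff_diff_eq)
  then show ?thesis by (simp only: right_minus_eq) (simp only: eq_commute)
qed

lemma lor_sym: "lor x y = lor y x"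
  by (simp add: lor_def mult.commute)

lemma lor_add_left: "lor (x + x') y = lor x y + lor x' y"
  by (simp add: lor_def algebra_simps)

lemma lor_diff_left: "lor (x - x') y = lor x y - lor x' y"
  by (simp add: lor_def algebra_simps)

lemma lor_scale_left: "lor (c *s x) y = c * lor x y"
  by (simp add: lor_def algebra_simps)

lemma lor_add_right: "lor y (x + x') = lor y x + lor y x'"
  by (simp add: lor_def algebra_simps)

lemma lor_diff_right: "lor y (x - x') = lor y x - lor y x'"
  by (simp add: lor_def algebra_simps)

lemma lor_scale_right: "lor y (c *s x) = c * lor y x"
  by (simp add: lor_def algebra_simps)

lemmas lor_bilinear = lor_add_left lor_diff_left lor_scale_left lor_add_right lor_diff_right lor_scale_right

definition const_vec :: "real ^ 'n \<Rightarrow> real poly ^ 'n" where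
  "const_vec p = (\<chi> i. [:p $ i:])"

lemma lor_const_vec: "lor (const_vec p) (const_vec q) = [:lor p q:]"
  by (simp add: lor_def const_vec_def mult.commute)

lemma bform_lor_const:
  "bform d (lor (const_vec p) k) x = lor (\<chi> i. of_real (p $ i)) (form_eval d k x)"
  by (simp add: lor_def const_vec_def bform_diff bform_smult)

lemma bform_lor:
  assumes "\<And>i. degree (k $ i) \<le> d" "\<And>i. degree (l $ i) \<le> e"
  shows "bform (d + e) (lor k l) x = lor (form_eval d k x) (form_eval e l x)"
  by (simp add: lor_def bform_diff bform_mult assms)

text \<open>Here \<open>r\<close> is the factor to be cancelled, \<open>g\<close> the residual
  quadratic of the plane section and \<open>G\<close> the quotient of the quadratic form along the
  curve. The factorization of \<open>g\<close> with \<open>c \<noteq> 0\<close> keeps its roots away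
  from infinity. Their distinctness gives two branches at \<open>p\<close>, and the last assumption
  excludes base points.\<close>

locale sphere_lift =
  fixes A :: "real ^ 4 ^ 5" and p :: "real ^ 5" and k :: "real poly ^ 4"
    and r g G :: "real poly" and c \<gamma> \<gamma>' :: complex
  assumes indep: "\<And>s y. s *s p + A *v y = 0 \<Longrightarrow> s = 0 \<and> y = 0"
    and p_isotropic: "lor p p = 0"
    and knot: "real_rational_knot 6 k"
    and deg: "degree r \<le> 4" "degree g \<le> 2" "degree G \<le> 8"
    and r: "r \<noteq> 0"
    and pk: "lor (const_vec p) (lin_image A k) = - (r * g)"
    and kk: "lor (lin_image A k) (lin_image A k) = - (r * G)"
    and g: "\<And>x :: complex ^ 2. bform 2 g x = c * (x $ 1 - \<gamma> * x $ 2) * (x $ 1 - \<gamma>' * x $ 2)"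
    and c: "c \<noteq> 0" and \<gamma>: "\<gamma> \<noteq> \<gamma>'"
    and G: "\<And>x :: complex ^ 2. x \<noteq> 0 \<Longrightarrow> bform 2 g x = 0 \<Longrightarrow> bform 8 G x \<noteq> 0"
begin

text \<open>The inverse projection \<open>B(y,y) p - 2 B(m,y) y\<close> along the curve, divided by
  \<open>r\<close>: by \<open>kk\<close> and \<open>pk\<close>, \<open>B(y,y)\<close> is
  \<open>r * G\<close> and \<open>B(m,y)\<close> is \<open>r * g\<close>.\<close>

definition lift :: "real poly ^ 5" where
  "lift = (\<chi> i. smult (p $ i) G - smult 2 (g * lin_image A k $ i))"

lemma degree_k: "degree (k $ j) \<le> 6"
  using knot by (simp add: real_rational_knot_def real_rational_curve_def)

lemma k_nonzero: "x \<noteq> 0 \<Longrightarrow> form_eval 6 k x \<noteq> 0" for x :: "complex ^ 2"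
  using knot by (simp add: real_rational_knot_def real_rational_curve_def)

lemma degree_lift: "degree (lift $ i) \<le> 8"
proof -
  have "degree (g * lin_image A k $ i) \<le> 2 + 6"
    by (rule order.trans[OF degree_mult_le add_mono[OF deg(2) degree_lin_image[OF degree_k]]])
  then have "degree (smult 2 (g * lin_image A k $ i)) \<le> 8"
    by (intro order.trans[OF degree_smult_le]) simp
  moreover have "degree (smult (p $ i) G) \<le> 8"
    by (rule order.trans[OF degree_smult_le deg(3)])
  ultimately show ?thesis unfolding lift_def vec_lambda_beta by (intro degree_diff_le)
qed

lemma bform_g_mult:
  "bform 8 (g * lin_image A k $ i) x = bform 2 g x * bform 6 (lin_image A k $ i) x"
  using bform_mult[OF deg(2) degree_lin_image[OF degree_k], of A i x] by simp

lemma form_eval_lift: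
  fixes x :: "complex ^ 2"
  shows "form_eval 8 lift x = bform 8 G x *s cvec p - (2 * bform 2 g x) *s (cmat A *v form_eval 6 k x)"
  by (simp add: vec_eq_iff lift_def bform_diff bform_smult bform_g_mult
      flip: form_eval_lin_image)

text \<open>Since \<open>p\<close> and \<open>A\<close> are real, the real and imaginary parts of a
  complex relation are real relations.\<close>

lemma complex_indep:
  assumes "s *s cvec p + cmat A *v y = 0"
  shows "s = 0 \<and> y = 0"
proof -
  have "re_vec (s *s cvec p + cmat A *v y) = Re s *s p + A *v re_vec y"
    by (simp add: re_vec_cmat[symmetric]) (simp add: vec_eq_iff re_vec_def)
  moreover have "im_vec (s *s cvec p + cmat A *v y) = Im s *s p + A *v im_vec y"
    by (simp add: im_vec_cmat[symmetric]) (simp add: vec_eq_iff im_vec_def)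
  ultimately have "Re s = 0" "re_vec y = 0" "Im s = 0" "im_vec y = 0"
    using assms indep by simp_all
  then show ?thesis by (simp add: complex_eq_iff complex_vec_eqI)
qed

lemma complex_indep2:
  assumes "s *s cvec p + cmat A *v y = s' *s cvec p + cmat A *v y'"
  shows "s = s' \<and> y = y'"
  using complex_indep[of "s - s'" "y - y'"] assms
  by (simp add: algebra_simps vector_ssub_ldistrib vector_sub_rdistrib matrix_vector_mult_diff_distrib)

lemma form_eval_lift':
  fixes x :: "complex ^ 2"
  shows "form_eval 8 lift x = bform 8 G x *s cvec p + cmat A *v (- (2 * bform 2 g x) *s form_eval 6 k x)"
  unfolding form_eval_lift by (simp add: vec_eq_iff matrix_vector_mult_def sum_distrib_left sum_negf mult_ac)

lemma lor_lift: "lor lift lift = 0"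
proof -
  have L: "lift = G *s const_vec p - (2 * g) *s lin_image A k"
    by (simp add: vec_eq_iff lift_def const_vec_def mult.assoc numeral_poly)
  show ?thesis
    unfolding L lor_bilinear lor_const_vec p_isotropic pk kk lor_sym[of "lin_image A k" "const_vec p"]
    by (simp add: algebra_simps)
qed

text \<open>This form of degree 8 cuts out the contact with the tangent hyperplane at
  \<open>p\<close>: the roots of \<open>r\<close>, and each of the two parameters over
  \<open>p\<close> twice. Stereographic projection omits exactly its zeros.\<close>

lemma lor_p_lift:
  fixes x :: "complex ^ 2"
  shows "lor (cvec p) (form_eval 8 lift x) = 2 * bform 4 r x * (bform 2 g x)\<^sup>2"
proof -
  have "lor (cvec p) (cvec p) = of_real (lor p p)" by (simp add: lor_def)
  then have "lor (cvec p) (cvec p) = 0" by (simp add: p_isotropic)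
  moreover have "lor (cvec p) (cmat A *v form_eval 6 k x) = - (bform 4 r x * bform 2 g x)"
  proof -
    have "lor (cvec p) (cmat A *v form_eval 6 k x) = bform 6 (- (r * g)) x"
      unfolding pk[symmetric] bform_lor_const form_eval_lin_image cvec_def ..
    also have "\<dots> = - (bform 4 r x * bform 2 g x)"
      using bform_mult[OF deg(1,2), of x] bform_smult[of 6 "-1" "r * g" x] by simp
    finally show ?thesis .
  qed
  ultimately show ?thesis
    unfolding form_eval_lift lor_bilinear by (simp add: power2_eq_square)
qed

lemma g_root_cases:
  fixes x :: "complex ^ 2"
  assumes "x \<noteq> 0" "bform 2 g x = 0"
  shows "x $ 2 \<noteq> 0" "x $ 1 = \<gamma> * x $ 2 \<or> x $ 1 = \<gamma>' * x $ 2"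
  using assms c by (auto simp: g vec_eq_iff forall_2)

lemma real_rational_curve_lift: "real_rational_curve 8 lift"
  unfolding real_rational_curve_def
proof (intro conjI allI impI degree_lift notI)
  fix x :: "complex ^ 2" assume x: "x \<noteq> 0" and "form_eval 8 lift x = 0"
  then have "bform 8 G x = 0" "- (2 * bform 2 g x) *s form_eval 6 k x = 0"
    using complex_indep unfolding form_eval_lift' by blast+
  then show False using x k_nonzero G by auto
qed

lemma real_points_lift: "real_points 8 lift \<subseteq> S3"
proof
  fix P assume "P \<in> real_points 8 lift"
  then obtain x :: "real ^ 2" where x: "x \<noteq> 0" "P = proj (form_eval 8 lift x)"
    unfolding real_points_def by blast
  then have "form_eval 8 lift (cvec x) \<noteq> 0"
    using real_rational_curve_lift by (simp add: real_rational_curve_def)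
  then have "form_eval 8 lift x \<noteq> 0" by (simp add: form_eval_cvec)
  moreover have "lor (form_eval 8 lift x) (form_eval 8 lift x) = 0"
    using bform_lor[OF degree_lift degree_lift, of x] by (simp add: lor_lift)
  ultimately show "P \<in> S3" unfolding S3_def x(2)
    by (intro CollectI exI[of _ "form_eval 8 lift x"]) (simp only: lor_eq_0_iff power2_eq_square simp_thms)
qed

lemma proj_lift_eq_p_iff:
  fixes x :: "complex ^ 2"
  assumes "x \<noteq> 0"
  shows "proj (form_eval 8 lift x) = proj (cvec p) \<longleftrightarrow> bform 2 g x = 0"
proof
  assume "proj (form_eval 8 lift x) = proj (cvec p)"
  then obtain e where e: "e \<noteq> 0" "form_eval 8 lift x = e *s cvec p"
    by (metis proj_eq_iff)
  then have "bform 8 G x *s cvec p + cmat A *v (- (2 * bform 2 g x) *s form_eval 6 k x) = e *s cvec p + cmat A *v 0"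
    unfolding form_eval_lift' by simp
  then have "- (2 * bform 2 g x) *s form_eval 6 k x = 0" using complex_indep2 by blast
  then show "bform 2 g x = 0" using k_nonzero[OF assms] by simp
next
  assume "bform 2 g x = 0"
  then show "proj (form_eval 8 lift x) = proj (cvec p)"
    using G[OF assms] by (simp add: form_eval_lift)
qed

text \<open>The component of the tangency condition in the hyperplane reads
  \<open>g k' + g' k = e g k\<close>. Off the roots of \<open>g\<close> it contradicts the immersion
  \<open>k\<close> unless \<open>v\<close> is a multiple of \<open>x\<close>. At a root it gives
  \<open>g' = 0\<close>, which forces the same because the root is simple.\<close>

lemma complex_immersion_lift: "complex_immersion 8 lift"
  unfolding complex_immersion_def
proof (intro allI impI; elim conjE)
  fix x v :: "complex ^ 2" and e
  assume x: "x \<noteq> 0" and D: "frechet_derivative (form_eval 8 lift) (at x) v = e *s form_eval 8 lift x"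
  define k' where "k' = frechet_derivative (form_eval 6 k) (at x) v"
  define g' where "g' = bform_deriv 2 g x v"
  have "bform_deriv 8 (g * lin_image A k $ i) x v =
      bform 2 g x * bform_deriv 6 (lin_image A k $ i) x v + g' * bform 6 (lin_image A k $ i) x" for i
    using bform_deriv_mult[OF deg(2) degree_lin_image[OF degree_k], of A i x v] by (simp add: g'_def)
  moreover have "bform_deriv 6 (lin_image A k $ i) x v = (cmat A *v k') $ i" for i
    by (simp add: bform_deriv_lin_image k'_def cmat_def matrix_vector_mult_def frechet_derivative_form_eval)
  moreover have "bform 6 (lin_image A k $ i) x = (cmat A *v form_eval 6 k x) $ i" for i
    by (simp flip: form_eval_lin_image)
  ultimately have "frechet_derivative (form_eval 8 lift) (at x) v $ i =
      bform_deriv 8 G x v * cvec p $ i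
        - 2 * (bform 2 g x * (cmat A *v k') $ i + g' * (cmat A *v form_eval 6 k x) $ i)" for i
    by (simp add: frechet_derivative_form_eval lift_def bform_deriv_diff bform_deriv_smult)
  then have "frechet_derivative (form_eval 8 lift) (at x) v =
      bform_deriv 8 G x v *s cvec p
        - 2 *s (bform 2 g x *s (cmat A *v k') + g' *s (cmat A *v form_eval 6 k x))"
    by (simp add: vec_eq_iff)
  also have "\<dots> = bform_deriv 8 G x v *s cvec p
      + cmat A *v (-2 *s (bform 2 g x *s k' + g' *s form_eval 6 k x))"
    by (simp add: vec_eq_iff matrix_vector_mult_def sum_distrib_left sum_negf sum.distrib sum_subtractf algebra_simps)
  finally have "bform_deriv 8 G x v *s cvec p
      + cmat A *v (-2 *s (bform 2 g x *s k' + g' *s form_eval 6 k x)) = e *s form_eval 8 lift x"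
    using D by simp
  also have "\<dots> = (e * bform 8 G x) *s cvec p + cmat A *v (-2 *s ((e * bform 2 g x) *s form_eval 6 k x))"
    unfolding form_eval_lift' by (simp add: vec_eq_iff matrix_vector_mult_def sum_distrib_left sum_negf algebra_simps)
  finally have "-2 *s (bform 2 g x *s k' + g' *s form_eval 6 k x) = -2 *s ((e * bform 2 g x) *s form_eval 6 k x)"
    using complex_indep2 by blast
  then have eq: "bform 2 g x *s k' + g' *s form_eval 6 k x = (e * bform 2 g x) *s form_eval 6 k x"
    by (simp only: vector_mul_lcancel) simp
  show "\<exists>a. v = a *s x"
  proof (cases "bform 2 g x = 0")
    case False
    have "k' = (e - g' / bform 2 g x) *s form_eval 6 k x"
    proof -
      have "k' $ i = (e - g' / bform 2 g x) * form_eval 6 k x $ i" for i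
      proof -
        have "bform 2 g x * k' $ i + g' * form_eval 6 k x $ i = e * bform 2 g x * form_eval 6 k x $ i"
          using arg_cong[OF eq, of "\<lambda>z. z $ i"] by simp
        then show ?thesis using False by (simp add: field_simps)
      qed
      then show ?thesis unfolding vec_eq_iff vector_smult_component by blast
    qed
    then show ?thesis using knot x unfolding k'_def real_rational_knot_def complex_immersion_def by blast
  next
    case True
    then have "g' = 0" using eq k_nonzero[OF x] by simp
    moreover have "g' = c * ((x $ 1 - \<gamma> * x $ 2) * (v $ 1 - \<gamma>' * v $ 2) + (v $ 1 - \<gamma> * v $ 2) * (x $ 1 - \<gamma>' * x $ 2))"
      unfolding g'_def
    proof (rule bform_deriv_eqI)
      have nth: "((\<lambda>x :: complex ^ 2. x $ i) has_derivative (\<lambda>v. v $ i)) (at x)" for i x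
        by (intro bounded_linear_imp_has_derivative bounded_linear_vec_nth)
      have "((\<lambda>x. c * ((x $ 1 - \<gamma> * x $ 2) * (x $ 1 - \<gamma>' * x $ 2))) has_derivative
        (\<lambda>v. c * ((x $ 1 - \<gamma> * x $ 2) * (v $ 1 - \<gamma>' * v $ 2) + (v $ 1 - \<gamma> * v $ 2) * (x $ 1 - \<gamma>' * x $ 2)))) (at x)"
        by (intro has_derivative_mult_right has_derivative_mult has_derivative_diff nth)
      then show "(bform 2 g has_derivative
        (\<lambda>v. c * ((x $ 1 - \<gamma> * x $ 2) * (v $ 1 - \<gamma>' * v $ 2) + (v $ 1 - \<gamma> * v $ 2) * (x $ 1 - \<gamma>' * x $ 2)))) (at x)"
        by (simp add: g[abs_def] mult.assoc)
    qed
    ultimately have z: "(x $ 1 - \<gamma> * x $ 2) * (v $ 1 - \<gamma>' * v $ 2) + (v $ 1 - \<gamma> * v $ 2) * (x $ 1 - \<gamma>' * x $ 2) = 0"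
      using c by simp
    note x2 = g_root_cases[OF x True]
    have "wedge x v = 0"
      using x2(2)
    proof
      assume x1: "x $ 1 = \<gamma> * x $ 2"
      then have "(v $ 1 - \<gamma> * v $ 2) * ((\<gamma> - \<gamma>') * x $ 2) = 0" using z by (simp add: algebra_simps)
      then have "v $ 1 = \<gamma> * v $ 2" using x2(1) \<gamma> by simp
      then show ?thesis by (simp add: wedge_def x1)
    next
      assume x1: "x $ 1 = \<gamma>' * x $ 2"
      then have "(v $ 1 - \<gamma>' * v $ 2) * ((\<gamma>' - \<gamma>) * x $ 2) = 0" using z by (simp add: algebra_simps)
      then have "v $ 1 = \<gamma>' * v $ 2" using x2(1) \<gamma> by simp
      then show ?thesis by (simp add: wedge_def x1)
    qed
    then show ?thesis using wedge_eq_0D x by metis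
  qed
qed

lemma card_fibre_lift: "card (fibre 8 lift (proj (cvec p))) = 2"
proof -
  define u where "u = (\<lambda>z :: complex. vector [z, 1] :: complex ^ 2)"
  have u: "u z $ 1 = z" "u z $ 2 = 1" for z by (simp_all add: u_def)
  have u0: "u z \<noteq> 0" for z using u(2)[of z] by force
  have "fibre 8 lift (proj (cvec p)) = {proj (u \<gamma>), proj (u \<gamma>')}"
  proof (intro equalityI subsetI)
    fix X assume "X \<in> fibre 8 lift (proj (cvec p))"
    then obtain x where x: "x \<noteq> 0" "X = proj x" "bform 2 g x = 0"
      using proj_lift_eq_p_iff unfolding fibre_def by blast
    from g_root_cases[OF x(1,3)] have "x = x $ 2 *s u \<gamma> \<or> x = x $ 2 *s u \<gamma>'" "x $ 2 \<noteq> 0"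
      by (auto simp: vec_eq_iff forall_2 u)
    then show "X \<in> {proj (u \<gamma>), proj (u \<gamma>')}" using x(2) by (metis insertCI proj_scale)
  next
    fix X assume "X \<in> {proj (u \<gamma>), proj (u \<gamma>')}"
    then obtain z where z: "X = proj (u z)" "z = \<gamma> \<or> z = \<gamma>'" by blast
    then have "bform 2 g (u z) = 0" by (auto simp: g u)
    then show "X \<in> fibre 8 lift (proj (cvec p))"
      using proj_lift_eq_p_iff[OF u0] z(1) u0 unfolding fibre_def by blast
  qed
  moreover have "proj (u \<gamma>) \<noteq> proj (u \<gamma>')"
    using \<gamma> by (intro wedge_neq_0D) (simp add: wedge_def u)
  ultimately show ?thesis by simp
qed

text \<open>Away from \<open>p\<close> the hyperplane component is a nonzero multiple of the point
  of \<open>k\<close>, so injectivity is inherited from \<open>k\<close>.\<close>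

lemma one_double_point_lift: "one_double_point 8 lift (proj (cvec p))"
  unfolding one_double_point_def
proof (intro conjI allI impI real_rational_curve_lift complex_immersion_lift card_fibre_lift; elim conjE)
  fix Q X Y assume Q: "Q \<noteq> proj (cvec p)" and "X \<in> fibre 8 lift Q" "Y \<in> fibre 8 lift Q"
  then obtain x y where x: "x \<noteq> 0" "X = proj x" "Q = proj (form_eval 8 lift x)"
    and y: "y \<noteq> 0" "Y = proj y" "Q = proj (form_eval 8 lift y)"
    unfolding fibre_def by blast
  then have gx: "bform 2 g x \<noteq> 0" "bform 2 g y \<noteq> 0" using Q proj_lift_eq_p_iff by blast+
  obtain e where e: "e \<noteq> 0" "form_eval 8 lift y = e *s form_eval 8 lift x"
    using x(3) y(3) proj_eq_iff by metis
  have "e *s form_eval 8 lift x = (e * bform 8 G x) *s cvec p + cmat A *v (e *s (- (2 * bform 2 g x) *s form_eval 6 k x))"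
    unfolding form_eval_lift' by (simp add: vec_eq_iff matrix_vector_mult_def sum_distrib_left sum_negf algebra_simps)
  then have "- (2 * bform 2 g y) *s form_eval 6 k y = e *s (- (2 * bform 2 g x) *s form_eval 6 k x)"
    using e(2) complex_indep2 unfolding form_eval_lift'[of y] by metis
  then have "bform 2 g y * form_eval 6 k y $ i = e * bform 2 g x * form_eval 6 k x $ i" for i
    by (simp add: vec_eq_iff mult.assoc mult.left_commute[of _ 2])
  then have "form_eval 6 k y $ i = e * bform 2 g x / bform 2 g y * form_eval 6 k x $ i" for i
    using gx by (simp add: field_simps)
  then have "form_eval 6 k y = (e * bform 2 g x / bform 2 g y) *s form_eval 6 k x"
    unfolding vec_eq_iff vector_smult_component by blast
  moreover have "e * bform 2 g x / bform 2 g y \<noteq> 0" using e(1) gx by simp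
  ultimately have "proj (form_eval 6 k x) = proj (form_eval 6 k y)" using proj_eq_iff by blast
  then show "X = Y"
    using knot x y unfolding real_rational_knot_def complex_injective_def by blast
qed

lemma complex_tangent_iff:
  assumes "a \<noteq> 0"
  shows "proj a \<in> complex_tangent p \<longleftrightarrow> lor (cvec p) a = 0"
proof
  assume "proj a \<in> complex_tangent p"
  then obtain v where v: "proj a = proj v" "of_real (p $ 1) * v $ 1 + of_real (p $ 2) * v $ 2
      + of_real (p $ 3) * v $ 3 + of_real (p $ 4) * v $ 4 = of_real (p $ 0) * v $ 0"
    unfolding complex_tangent_def by blast
  have "lor (cvec p) v = 0" using v(2) unfolding lor_eq_0_iff cvec_nth .
  from v(1) obtain e where "a = e *s v" by (metis proj_eq_iff)
  then show "lor (cvec p) a = 0" using \<open>lor (cvec p) v = 0\<close> by (simp add: lor_scale_right)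
next
  assume "lor (cvec p) a = 0"
  then have "of_real (p $ 1) * a $ 1 + of_real (p $ 2) * a $ 2
      + of_real (p $ 3) * a $ 3 + of_real (p $ 4) * a $ 4 = of_real (p $ 0) * a $ 0"
    unfolding lor_eq_0_iff cvec_nth .
  then show "proj a \<in> complex_tangent p"
    using assms unfolding complex_tangent_def by blast
qed

text \<open>Where \<open>r * g\<close> is nonzero, the lift is a nonzero multiple of the point of
  \<open>k\<close> plus a multiple of \<open>p\<close>, and projection from \<open>p\<close> returns
  that point. The remaining parameters are restored by the closure.\<close>

lemma stereographic_curve_lift: "complex_points 6 k = stereographic_curve A p 8 lift"
proof -
  define U where "U = {x :: complex ^ 2. x \<noteq> 0 \<and> bform 6 (r * g) x \<noteq> 0}"
  have rg: "bform 6 (r * g) x = bform 4 r x * bform 2 g x" for x :: "complex ^ 2"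
    using bform_mult[OF deg(1,2), of x] by simp
  have "(\<Union>a\<in>{a. a \<noteq> 0 \<and> proj a \<in> complex_points 8 lift - complex_tangent p}. stereographic A p a)
     = {proj (form_eval 6 k x) | x. x \<in> U}"
  proof (intro equalityI subsetI)
    fix P assume "P \<in> (\<Union>a\<in>{a. a \<noteq> 0 \<and> proj a \<in> complex_points 8 lift - complex_tangent p}. stereographic A p a)"
    then obtain a y s t x where a: "a \<noteq> 0" "proj a \<notin> complex_tangent p"
      "proj a = proj (form_eval 8 lift x)" and x: "x \<noteq> 0"
      and y: "P = proj y" "y \<noteq> 0" "cmat A *v y = s *s cvec p + t *s a"
      unfolding complex_points_def stereographic_def by blast
    obtain e where e: "e \<noteq> 0" "a = e *s form_eval 8 lift x" using a(3) by (metis proj_eq_iff)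
    have "lor (cvec p) (form_eval 8 lift x) \<noteq> 0"
      using a(1,2) complex_tangent_iff by (auto simp: e(2) lor_scale_right)
    then have "x \<in> U" using x by (simp add: U_def rg lor_p_lift)
    have "0 *s cvec p + cmat A *v y = (s + t * e * bform 8 G x) *s cvec p
        + cmat A *v ((- (2 * t * e * bform 2 g x)) *s form_eval 6 k x)"
      unfolding vector_smult_lzero add_0 y(3) e(2) form_eval_lift'
      by (simp add: vec_eq_iff matrix_vector_mult_def sum_distrib_left sum_negf algebra_simps)
    then have "y = (- (2 * t * e * bform 2 g x)) *s form_eval 6 k x" using complex_indep2 by blast
    moreover from this have "- (2 * t * e * bform 2 g x) \<noteq> 0" using y(2) by auto
    ultimately have "P = proj (form_eval 6 k x)" using y(1) proj_scale by metis
    then show "P \<in> {proj (form_eval 6 k x) | x. x \<in> U}" using \<open>x \<in> U\<close> by blast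
  next
    fix P assume "P \<in> {proj (form_eval 6 k x) | x. x \<in> U}"
    then obtain x where x: "x \<in> U" "P = proj (form_eval 6 k x)" by blast
    then have nz: "x \<noteq> 0" "bform 4 r x \<noteq> 0" "bform 2 g x \<noteq> 0" by (auto simp: U_def rg)
    let ?a = "form_eval 8 lift x"
    have a: "?a \<noteq> 0" using nz real_rational_curve_lift by (simp add: real_rational_curve_def)
    \<comment> \<open>The formula for the lift, solved for the point in the hyperplane.\<close>
    have "cmat A *v form_eval 6 k x = (bform 8 G x / (2 * bform 2 g x)) *s cvec p + (- 1 / (2 * bform 2 g x)) *s ?a"
      unfolding form_eval_lift using nz(3) by (simp add: vec_eq_iff field_simps)
    then have "P \<in> stereographic A p ?a"
      unfolding stereographic_def x(2) using k_nonzero[OF nz(1)] by blast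
    moreover have "proj ?a \<in> complex_points 8 lift" using nz(1) by (auto simp: complex_points_def)
    moreover have "proj ?a \<notin> complex_tangent p"
      using complex_tangent_iff[OF a] nz by (simp add: lor_p_lift)
    ultimately show "P \<in> (\<Union>a\<in>{a. a \<noteq> 0 \<and> proj a \<in> complex_points 8 lift - complex_tangent p}. stereographic A p a)"
      using a by blast
  qed
  moreover have "g \<noteq> 0"
  proof
    assume "g = 0"
    \<comment> \<open>The value of the factored form at infinity is \<open>c\<close>.\<close>
    with g[of "vector [1, 0]"] c show False by simp
  qed
  then have "x \<in> closure U" if "x \<noteq> 0" for x
    unfolding U_def using that r deg(1,2) order.trans[OF degree_mult_le, of r g 6]
    by (intro closure_form_nonzero) auto
  moreover have "0 \<notin> U" by (simp add: U_def)
  ultimately show ?thesis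
    using closure_of_curve_points[of 6 k U] knot
    unfolding stereographic_curve_def real_rational_knot_def by simp
qed

end

section \<open>Orthonormalization\<close>


text \<open>The form is arbitrary because the relevant one comes from the sphere through
  \<open>A\<close>. A new generator is first made orthogonal to the old span; then only one
  component remains to be subtracted.\<close>

lemma orthogonal_projection_exists:
  fixes B :: "'v::real_vector \<Rightarrow> 'v \<Rightarrow> real"
  assumes B: "\<And>y. linear (\<lambda>x. B x y)" "\<And>x y. B x y = B y x" "\<And>x. x \<noteq> 0 \<Longrightarrow> B x x > 0"
    and "finite X"
  shows "\<exists>s\<in>span X. \<forall>x\<in>span X. B (v - s) x = 0"
  using assms(4)
proof (induction X arbitrary: v rule: finite_induct)
  case empty
  have "B v 0 = 0" using linear_0[OF B(1)] B(2) by metis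
  then show ?case by simp
next
  case (insert x X)
  have lin: "B (a - c *\<^sub>R b) y = B a y - c * B b y" for a b c y
    using linear_diff[OF B(1)] linear_scale[OF B(1)] by simp
  obtain s where s: "s \<in> span X" "\<And>y. y \<in> span X \<Longrightarrow> B (x - s) y = 0"
    using insert.IH[of x] by blast
  obtain t where t: "t \<in> span X" "\<And>y. y \<in> span X \<Longrightarrow> B (v - t) y = 0"
    using insert.IH[of v] by blast
  define x' where "x' = x - s"
  \<comment> \<open>If \<open>x\<close> already lies in the span of \<open>X\<close>, then
    \<open>x' = 0\<close> and division by zero yields \<open>c = 0\<close>, which is
    harmless.\<close>
  define c where "c = B (v - t) x' / B x' x'"
  have sub: "y \<in> span X \<Longrightarrow> y \<in> span (insert x X)" for y
    using span_mono[of X "insert x X"] by blast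
  have x': "x' \<in> span (insert x X)" unfolding x'_def
    by (intro span_diff span_base sub s) simp
  have "t + c *\<^sub>R x' \<in> span (insert x X)"
    using x' sub[OF t(1)] by (intro span_add span_scale)
  moreover have "B (v - (t + c *\<^sub>R x')) y = 0" if y: "y \<in> span (insert x X)" for y
  proof -
    obtain k where k: "y - k *\<^sub>R x \<in> span X" using y unfolding span_insert by blast
    have "y - k *\<^sub>R x + k *\<^sub>R s \<in> span X" by (intro span_add k span_scale s)
    then have ys: "y - k *\<^sub>R x' \<in> span X" by (simp add: x'_def algebra_simps)
    have eq: "v - (t + c *\<^sub>R x') = (v - t) - c *\<^sub>R x'" by simp
    have "B (v - t) x' = c * B x' x'"
      using B(3)[of x'] linear_0[OF B(1)] B(2)[of "v - t" 0] by (cases "x' = 0") (auto simp: c_def)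
    then have 1: "B (v - (t + c *\<^sub>R x')) x' = 0" by (simp add: eq lin)
    have 2: "B (v - (t + c *\<^sub>R x')) (y - k *\<^sub>R x') = 0"
      unfolding eq lin using s(2)[OF ys] t(2)[OF ys] by (simp add: x'_def)
    have "B (v - (t + c *\<^sub>R x')) y - k * B (v - (t + c *\<^sub>R x')) x' = 0"
      using 2 lin B(2) by metis
    then show ?thesis using 1 by simp
  qed
  ultimately show ?case by blast
qed

text \<open>Frames are given as flags, each vector outside the span of its predecessors, since this
  is the structure that Gram-Schmidt preserves. A count of dimensions makes them bases.\<close>

lemma
  fixes n :: "nat \<Rightarrow> real ^ 'n"
  assumes n: "\<And>i. i < CARD('n) \<Longrightarrow> n i \<notin> span (n ` {..<i})"
  shows independent_lessThan_CARD: "inj_on n {..<CARD('n)} \<and> independent (n ` {..<CARD('n)})"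
    and span_lessThan_CARD: "span (n ` {..<CARD('n)}) = UNIV"
proof -
  define N where "N = CARD('n)"
  have ind: "inj_on n {..<m} \<and> independent (n ` {..<m})" if "m \<le> N" for m
    using that
  proof (induction m)
    case (Suc m)
    then have a: "n m \<notin> span (n ` {..<m})" using n by (simp add: N_def)
    have "n m \<notin> n ` {..<m}" by (rule contrapos_nn[OF a span_base])
    with Suc a show ?case by (simp add: lessThan_Suc independent_insert)
  qed (simp add: independent_empty)
  then have "card (n ` {..<N}) = N" by (simp add: card_image)
  then have span: "span (n ` {..<N}) = UNIV"
    using ind[of N] card_eq_dim[of "n ` {..<N}" UNIV] by (auto simp: N_def)
  from span ind[of N] show "span (n ` {..<CARD('n)}) = UNIV"
    "inj_on n {..<CARD('n)} \<and> independent (n ` {..<CARD('n)})"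
    by (simp_all add: N_def)
qed

text \<open>Gram--Schmidt replaces each vector by a positive multiple of itself plus a combination of the
  earlier ones, hence the linear interpolation with the identity stays invertible.\<close>

lemma orthonormalization_path:
  fixes B :: "real ^ 'n \<Rightarrow> real ^ 'n \<Rightarrow> real" and n :: "nat \<Rightarrow> real ^ 'n"
  assumes B: "\<And>y. linear (\<lambda>x. B x y)" "\<And>x y. B x y = B y x" "\<And>x. x \<noteq> 0 \<Longrightarrow> B x x > 0"
    and n: "\<And>i. i < CARD('n) \<Longrightarrow> n i \<notin> span (n ` {..<i})"
  obtains M where
    "\<And>i j. i < CARD('n) \<Longrightarrow> j < CARD('n) \<Longrightarrow> B (M *v n i) (M *v n j) = (if i = j then 1 else 0)"
    "\<And>t. 0 \<le> t \<Longrightarrow> t \<le> 1 \<Longrightarrow> invertible ((1 - t) *\<^sub>R mat 1 + t *\<^sub>R M)"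
    "span (n ` {..<CARD('n)}) = UNIV"
proof -
  define N where "N = CARD('n)"
  have ind: "inj_on n {..<N} \<and> independent (n ` {..<N})" and span: "span (n ` {..<N}) = UNIV"
    unfolding N_def by (rule independent_lessThan_CARD[OF n], assumption, rule span_lessThan_CARD[OF n])
  have "\<exists>s\<in>span (n ` {..<i}). \<forall>x\<in>span (n ` {..<i}). B (n i - s) x = 0" for i
    by (rule orthogonal_projection_exists) (use B in auto)
  then obtain s where s: "\<And>i. s i \<in> span (n ` {..<i})"
      "\<And>i x. x \<in> span (n ` {..<i}) \<Longrightarrow> B (n i - s i) x = 0"
    by metis
  define u where "u = (\<lambda>i. n i - s i)"
  define f where "f = (\<lambda>i. (1 / sqrt (B (u i) (u i))) *\<^sub>R u i)"
  have u0: "u i \<noteq> 0" if "i < N" for i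
    using n[of i] s(1)[of i] that by (auto simp: u_def N_def)
  have Buu: "B (u i) (u i) > 0" if "i < N" for i using B(3) u0 that by blast
  have us: "u j \<in> span (n ` {..<i})" if "j < i" for i j
  proof -
    have "n ` {..<j} \<subseteq> n ` {..<i}" using that by auto
    then have "s j \<in> span (n ` {..<i})" using s(1)[of j] span_mono by blast
    moreover have "n j \<in> span (n ` {..<i})" using that by (intro span_base) auto
    ultimately show ?thesis unfolding u_def by (intro span_diff)
  qed
  have lin: "B (a *\<^sub>R x) (b *\<^sub>R y) = a * b * B x y" for a b x y
    using linear_scale[OF B(1)] B(2) by (metis mult.assoc mult.commute real_scaleR_def)
  have Bu: "B (u i) (u j) = 0" if "i \<noteq> j" for i j
    using that s(2)[OF us, of i j] s(2)[OF us, of j i] B(2) unfolding u_def by (metis linorder_neqE_nat)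
  have Bf: "B (f i) (f j) = (if i = j then 1 else 0)" if "i < N" for i j
  proof (cases "i = j")
    case True
    have "B (f i) (f i) = (1 / sqrt (B (u i) (u i))) * (1 / sqrt (B (u i) (u i))) * B (u i) (u i)"
      unfolding f_def by (rule lin)
    also have "\<dots> = 1" using Buu[OF that] by simp
    finally show ?thesis using True by simp
  next
    case False
    have "B (f i) (f j) = (1 / sqrt (B (u i) (u i))) * (1 / sqrt (B (u j) (u j))) * B (u i) (u j)"
      unfolding f_def by (rule lin)
    then show ?thesis using Bu[OF False] False by simp
  qed
  obtain F where F: "linear F" "\<And>i. i < N \<Longrightarrow> F (n i) = f i"
  proof -
    have "independent (n ` {..<N})" and inj: "inj_on n {..<N}" using ind by blast+
    from linear_independent_extend[OF this(1), of "\<lambda>x. f (inv_into {..<N} n x)"]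
    obtain F where F: "linear F" "\<forall>x\<in>n ` {..<N}. F x = f (inv_into {..<N} n x)"
      by blast
    have "F (n i) = f i" if "i < N" for i
      using F(2) inv_into_f_f[OF inj, of i] that by simp
    with F(1) show ?thesis by (rule that)
  qed
  define M where "M = matrix F"
  have M: "M *v n i = f i" if "i < N" for i
    using F that by (simp add: M_def matrix_works)
  have "invertible ((1 - t) *\<^sub>R mat 1 + t *\<^sub>R M)" (is "invertible ?R") if t: "0 \<le> t" "t \<le> 1" for t
  proof -
    define c where "c = (\<lambda>i. 1 - t + t / sqrt (B (u i) (u i)))"
    have c: "c i > 0" if "i < N" for i
    proof (cases "t = 1")
      case False
      then show ?thesis unfolding c_def using t Buu[OF that] by (intro add_pos_nonneg) auto
    qed (use Buu[OF that] in \<open>simp add: c_def\<close>)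
    have R: "?R *v n i = c i *\<^sub>R n i - (t / sqrt (B (u i) (u i))) *\<^sub>R s i" if "i < N" for i
    proof -
      have "?R *v n i = (1 - t) *\<^sub>R n i + t *\<^sub>R f i"
        by (simp add: matrix_vector_mult_add_rdistrib scaleR_matrix_vector_assoc[symmetric] M that)
      then show ?thesis by (simp add: f_def u_def c_def algebra_simps)
    qed
    have ran: "subspace (range ((*v) ?R))"
      by (intro linear_subspace_image matrix_vector_mul_linear subspace_UNIV)
    \<comment> \<open>In the order of the flag the map is triangular with diagonal entries
      \<open>c i > 0\<close>, so each \<open>n i\<close> is reached once its predecessors
      are.\<close>
    have "n i \<in> range ((*v) ?R)" if "i < N" for i
      using that
    proof (induction i rule: less_induct)
      case (less i)
      then have "n ` {..<i} \<subseteq> range ((*v) ?R)" by auto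
      then have "s i \<in> range ((*v) ?R)" using s(1) span_minimal[OF _ ran] by blast
      then have "(1 / c i) *\<^sub>R (?R *v n i + (t / sqrt (B (u i) (u i))) *\<^sub>R s i) \<in> range ((*v) ?R)"
        by (intro subspace_scale[OF ran] subspace_add[OF ran]) auto
      then show ?case using R[OF less.prems] c[OF less.prems] by simp
    qed
    then have "span (n ` {..<N}) \<subseteq> range ((*v) ?R)" by (intro span_minimal ran) auto
    then have "surj ((*v) ?R)" using span by auto
    then show ?thesis using matrix_right_invertible_surjective invertible_right_inverse by blast
  qed
  then show ?thesis using that[of M] Bf M span by (simp add: N_def)
qed

section \<open>Perturbing a sextic form\<close>


abbreviation cpoly :: "real poly \<Rightarrow> complex \<Rightarrow> complex" where
  "cpoly p \<equiv> poly (map_poly of_real p)"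

lemma cpoly_of_real: "cpoly p (of_real a) = of_real (poly p a)"
  by (induction p) (auto simp: map_poly_pCons)

lemma cpoly_root:
  assumes "degree p > 0"
  shows "\<exists>z. cpoly p z = 0"
proof (rule ccontr)
  assume "\<not> ?thesis"
  then have "constant (cpoly p)"
    using fundamental_theorem_of_algebra by blast
  then have "degree (map_poly complex_of_real p) = 0" by (simp add: constant_degree)
  then show False using assms by (simp add: degree_map_poly)
qed

text \<open>A condition that is polynomial in \<open>e\<close> fails at finitely many values only.
  Stated to the right of 0, several conditions can be met at once by an arbitrarily small
  \<open>e\<close>.\<close>

lemma eventually_at_right_poly_neq_0:
  fixes p :: "'a::real_normed_field poly"
  assumes "p \<noteq> 0"
  shows "\<forall>\<^sub>F e in at_right (0::real). poly p (of_real e) \<noteq> 0"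
proof -
  have "finite (of_real -` {z. poly p z = 0} :: real set)"
    using poly_roots_finite[OF assms] by (intro finite_vimageI) (auto simp: inj_on_def)
  moreover have "\<forall>\<^sub>F e in at_right (0::real). e \<notin> S" if "finite S" for S
    using that by induction (auto intro: eventually_conj eventually_neq_at_within)
  ultimately show ?thesis by force
qed

lemma tendsto_coeff_mult:
  fixes p q :: "real poly"
  assumes "\<And>i. ((\<lambda>e. coeff (P e) i) \<longlongrightarrow> coeff p i) F" "\<And>i. ((\<lambda>e. coeff (Q e) i) \<longlongrightarrow> coeff q i) F"
  shows "((\<lambda>e. coeff (P e * Q e) i) \<longlongrightarrow> coeff (p * q) i) F"
  unfolding coeff_mult by (intro tendsto_intros assms)

lemma real_poly_linear_root:
  assumes "degree (R :: real poly) < 2" "Im z \<noteq> 0" "poly (map_poly of_real R) z = 0"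
  shows "R = 0"
proof -
  define a b where "a = coeff R 0" and "b = coeff R 1"
  have R: "R = [:a, b:]"
    using assms(1) by (intro poly_eqI) (auto simp: a_def b_def coeff_pCons coeff_eq_0 split: nat.split)
  from R have "of_real a + z * of_real b = 0" using assms(3) by (simp add: map_poly_pCons)
  then have "Im (of_real a + z * of_real b) = 0" "Re (of_real a + z * of_real b) = 0" by simp_all
  then show ?thesis using assms(2) by (simp add: R)
qed

text \<open>The remainder modulo \<open>r\<close> is real, of degree below 2, and has the nonreal
  root \<open>z\<close>; hence it is zero. One nonreal root stands for a conjugate pair.\<close>

lemma real_quadratic_dvd:
  fixes r P :: "real poly"
  assumes "degree r = 2" "Im z \<noteq> 0" "poly (map_poly of_real r) z = 0" "poly (map_poly of_real P) z = 0"
  shows "r dvd P"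
proof -
  have "r \<noteq> 0" using assms(1) by auto
  have "P = r * (P div r) + P mod r" by simp
  then have "map_poly of_real P = map_poly complex_of_real r * map_poly of_real (P div r) + map_poly of_real (P mod r)"
    by (metis map_poly_of_real_add map_poly_of_real_mult)
  then have "poly (map_poly of_real (P mod r)) z = 0" using assms(3,4) by simp
  moreover have "degree (P mod r) < 2"
    using degree_mod_less'[of r P] \<open>r \<noteq> 0\<close> assms(1) by (cases "P mod r = 0") auto
  ultimately have "P mod r = 0" using real_poly_linear_root assms(2) by blast
  then show ?thesis by (simp add: dvd_eq_mod_eq_0)
qed

text \<open>If the degree of \<open>q\<close> is at most \<open>d\<close>, the factor \<open>r = 1\<close> stands for a double root at infinity.
  Otherwise the degree is at least 3, and a nonreal or a multiple root exists.\<close>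

lemma nonneg_quadratic_factor:
  fixes q :: "real poly"
  assumes "q \<noteq> 0" "card {x. poly q x = 0} \<le> 2" "degree q \<le> d + 2" "d \<ge> 2"
  obtains r q' where "q = r * q'" "degree r \<le> 2" "degree q' \<le> d" "\<And>x. poly r x \<ge> 0"
proof (cases "degree q \<le> d")
  case True
  then show ?thesis using that[of 1 q] by simp
next
  case False
  note T = that
  from False have dq: "degree q \<ge> 3" using assms(4) by simp
  have fin: "finite {x. poly q x = 0}" using assms(1) poly_roots_finite by blast
  have *: thesis if "q = r * q'" "degree r = 2" "\<And>x. poly r x \<ge> 0" for r q'
  proof -
    have "degree q = 2 + degree q'"
      using that(1,2) assms(1) degree_mult_eq[of r q'] by auto
    then show thesis using that assms(3) by (intro T[of r q']) auto
  qed
  show ?thesis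
  proof (cases "\<exists>z. Im z \<noteq> 0 \<and> poly (map_poly of_real q) z = 0")
    case True
    then obtain z where z: "Im z \<noteq> 0" "poly (map_poly of_real q) z = 0" by blast
    define r where "r = [:(Re z)\<^sup>2 + (Im z)\<^sup>2, - 2 * Re z, 1:]"
    have dr: "degree r = 2" by (simp add: r_def)
    have "poly (map_poly of_real r) z = 0"
      by (simp add: r_def map_poly_pCons complex_eq_iff power2_eq_square algebra_simps)
    then have "r dvd q" using real_quadratic_dvd dr z by blast
    then obtain q' where "q = r * q'" by (elim dvdE)
    moreover have "poly r x \<ge> 0" for x
    proof -
      have "poly r x = (x - Re z)\<^sup>2 + (Im z)\<^sup>2" by (simp add: r_def power2_eq_square algebra_simps)
      then show ?thesis by simp
    qed
    ultimately show ?thesis using * dr by blast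
  next
    case False
    \<comment> \<open>All roots are real now. Degree at least 3 yields three linear factors, and two
      of them coincide because there are at most two distinct real roots; their product is the
      square to be split off.\<close>
    have realroot: "\<exists>a. poly f a = 0" if "f dvd q" "degree f > 0" for f
    proof -
      obtain z where z: "poly (map_poly complex_of_real f) z = 0" using cpoly_root \<open>degree f > 0\<close> by blast
      then have "poly (map_poly complex_of_real q) z = 0"
        using \<open>f dvd q\<close> by (auto simp: map_poly_of_real_mult elim!: dvdE)
      then have "z = of_real (Re z)" using False by (auto simp: complex_eq_iff)
      then have "poly f (Re z) = 0" using z cpoly_of_real[of f "Re z"] by simp
      then show ?thesis by blast
    qed
    have df: "degree ([:- t, 1:] * s) = 1 + degree s" if "s \<noteq> 0" for t :: real and s
      using that by (subst degree_mult_eq) auto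
    obtain a where a: "poly q a = 0" using realroot[of q] dq by auto
    then obtain q1 where q1: "q = [:- a, 1:] * q1" using poly_eq_0_iff_dvd by (metis dvdE)
    have "degree q = 1 + degree q1" unfolding q1 using q1 assms(1) by (intro df) auto
    with dq have d1: "degree q1 \<ge> 2" by simp
    obtain b where b: "poly q1 b = 0" using realroot[of q1] d1 dvd_triv_right[of q1 "[:- a, 1:]"] unfolding q1[symmetric] by auto
    then obtain q2 where q2: "q1 = [:- b, 1:] * q2" using poly_eq_0_iff_dvd by (metis dvdE)
    have "degree q1 = 1 + degree q2" unfolding q2 using d1 q2 by (intro df) auto
    with d1 have d2: "degree q2 \<ge> 1" by simp
    obtain e where e: "poly q2 e = 0" using realroot[of q2] d2 dvd_trans[OF dvd_triv_right[of q2 "[:- b, 1:]"], of q]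
        dvd_triv_right[of q1 "[:- a, 1:]"] unfolding q2[symmetric] q1[symmetric] by auto
    then obtain q3 where q3: "q2 = [:- e, 1:] * q3" using poly_eq_0_iff_dvd by (metis dvdE)
    have sq: ?thesis if "q = [:- t, 1:]\<^sup>2 * s" for t s
    proof (rule *[OF that])
      show "degree ([:- t, 1:]\<^sup>2 :: real poly) = 2" by (simp add: degree_power_eq)
      show "poly ([:- t, 1:]\<^sup>2) x \<ge> 0" for x by (simp add: poly_power)
    qed
    have "a = b \<or> a = e \<or> b = e"
    proof (rule ccontr)
      assume "\<not> ?thesis"
      then have "card {a, b, e} = 3" by simp
      moreover have "{a, b, e} \<subseteq> {x. poly q x = 0}" using a b e by (auto simp: q1 q2)
      ultimately show False using card_mono[OF fin, of "{a, b, e}"] assms(2) by simp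
    qed
    then show ?thesis
    proof (elim disjE)
      assume "a = b"
      then show ?thesis using q1 q2 by (intro sq[of a q2]) (simp only: power2_eq_square mult_ac)
    next
      assume "a = e"
      then show ?thesis using q1 q2 q3
        by (intro sq[of a "[:- b, 1:] * q3"]) (simp only: power2_eq_square mult_ac)
    next
      assume "b = e"
      then show ?thesis using q1 q2 q3
        by (intro sq[of b "[:- a, 1:] * q3"]) (simp only: power2_eq_square mult_ac)
    qed
  qed
qed

text \<open>Eliminating the square leaves a real polynomial of degree below 2 with a nonreal root.
  Conversely, one nonzero minor certifies that two quadratics share no nonreal root, and a minor is
  easier to perturb than the resultant.\<close>

lemma common_root_minor:
  fixes A B C A' B' C' :: real
  assumes "Im z \<noteq> 0" "poly (map_poly of_real [:C, B, A:]) z = 0" "poly (map_poly of_real [:C', B', A':]) z = 0"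
  shows "A * C' = A' * C"
proof -
  define R where "R = [:A * C' - A' * C, A * B' - A' * B:]"
  have "poly (map_poly of_real R) z =
      of_real A * poly (map_poly of_real [:C', B', A':]) z - of_real A' * poly (map_poly of_real [:C, B, A:]) z"
    by (simp add: R_def map_poly_pCons algebra_simps)
  then have "poly (map_poly of_real R) z = 0" using assms by simp
  moreover have "degree R < 2" by (simp add: R_def)
  ultimately have "R = 0" using real_poly_linear_root assms(1) by blast
  then show ?thesis by (simp add: R_def)
qed

lemma quadratic_form_split:
  fixes A B C :: real
  assumes "A \<noteq> 0" "B\<^sup>2 \<noteq> 4 * A * C"
  obtains \<gamma> \<gamma>' :: complex where "\<gamma> \<noteq> \<gamma>'"
    "\<And>x :: complex ^ 2. bform 2 [:C, B, A:] x = of_real A * (x $ 1 - \<gamma> * x $ 2) * (x $ 1 - \<gamma>' * x $ 2)"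
proof -
  define D where "D = csqrt (of_real (B\<^sup>2 - 4 * A * C))"
  have D2: "D * D = of_real B * of_real B - 4 * of_real A * of_real C"
    using power2_csqrt[of "of_real (B\<^sup>2 - 4 * A * C)"] by (simp add: D_def power2_eq_square)
  have D0: "D \<noteq> 0" using assms(2) by (simp add: D_def flip: of_real_mult of_real_diff of_real_power)
  show ?thesis
  proof (rule that)
    let ?g = "(- of_real B + D) / (2 * of_real A)" and ?g' = "(- of_real B - D) / (2 * of_real A)"
    show "?g \<noteq> ?g'" using D0 assms(1) by (simp add: field_simps)
    fix x :: "complex ^ 2"
    have s: "?g + ?g' = - of_real B / of_real A" using assms(1) by (simp add: field_simps)
    have "?g * ?g' = (of_real B * of_real B - D * D) / (4 * of_real A * of_real A)"
      using assms(1) by (simp add: field_simps)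
    then have p: "?g * ?g' = of_real C / of_real A" using assms(1) unfolding D2 by (simp add: field_simps)
    have "of_real A * (x $ 1 - ?g * x $ 2) * (x $ 1 - ?g' * x $ 2)
        = of_real A * (x $ 1 * x $ 1 - (?g + ?g') * (x $ 1 * x $ 2) + (?g * ?g') * (x $ 2 * x $ 2))"
      by algebra
    also have "\<dots> = of_real A * (x $ 1 * x $ 1) + of_real B * (x $ 1 * x $ 2) + of_real C * (x $ 2 * x $ 2)"
      unfolding s p using assms(1) by (simp add: field_simps)
    also have "\<dots> = bform 2 [:C, B, A:] x"
      by (simp add: bform_def numeral_2_eq_2 power2_eq_square)
    finally show "bform 2 [:C, B, A:] x = of_real A * (x $ 1 - ?g * x $ 2) * (x $ 1 - ?g' * x $ 2)" ..
  qed
qed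

lemma eventually_quadratic_neq_0:
  fixes a b c :: "'a::real_normed_field"
  assumes "c \<noteq> 0"
  shows "\<forall>\<^sub>F e in at_right (0::real). a + of_real e * b + of_real e * of_real e * c \<noteq> 0"
proof -
  have "[:a, b, c:] \<noteq> 0" using assms by simp
  from eventually_at_right_poly_neq_0[OF this] show ?thesis by (simp add: algebra_simps)
qed

lemma positive_quadratic_roots_nonreal:
  fixes r :: "real poly"
  assumes "\<And>x. poly r x > 0" "poly (map_poly complex_of_real r) z = 0"
  shows "Im z \<noteq> 0"
proof
  assume "Im z = 0"
  then have z: "z = of_real (Re z)" by (simp add: complex_eq_iff)
  have "poly r (Re z) = 0" using assms(2) z cpoly_of_real by (metis of_real_eq_0_iff)
  then show False using assms(1)[of "Re z"] by simp
qed

text \<open>\<open>r1\<close> and \<open>r2\<close> carry the conjugate pairs that are to lie on the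
  conic, \<open>r3\<close> the two parameters of the future double point. Coprimality with
  \<open>r3\<close> lets a perturbation by a multiple of \<open>r1 * r2\<close> act at the roots of
  \<open>r3\<close>.\<close>

definition generic_quadratics :: "real poly \<Rightarrow> real poly \<Rightarrow> real poly \<Rightarrow> bool" where
  "generic_quadratics r1 r2 r3 \<longleftrightarrow> degree r1 = 2 \<and> degree r2 = 2 \<and> degree r3 = 2 \<and>
     (\<forall>x. poly r1 x > 0) \<and> (\<forall>x. poly r2 x > 0) \<and>
     (\<exists>\<gamma> \<gamma>' c. \<gamma> \<noteq> \<gamma>' \<and> c \<noteq> 0 \<and>
       (\<forall>x :: complex ^ 2. bform 2 r3 x = c * (x $ 1 - \<gamma> * x $ 2) * (x $ 1 - \<gamma>' * x $ 2))) \<and>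
     (\<forall>z. \<not> (cpoly r1 z = 0 \<and> cpoly r2 z = 0)) \<and>
     (\<forall>z. \<not> (cpoly r1 z = 0 \<and> cpoly r3 z = 0)) \<and>
     (\<forall>z. \<not> (cpoly r2 z = 0 \<and> cpoly r3 z = 0))"

text \<open>Two nonnegative quadratics are split off. They may still have real double roots, lower
  degree or common roots, and the last factor may have a double root. A small multiple of
  \<open>x^2 + m\<close> added to each factor cures all of this.\<close>

lemma sextic_perturbation:
  fixes q :: "real poly"
  assumes "q \<noteq> 0" "card {x. poly q x = 0} \<le> 2" "degree q \<le> 6"
  obtains P1 P2 P3 :: "real \<Rightarrow> real poly" where
    "\<And>i. ((\<lambda>e. coeff (P1 e * P2 e * P3 e) i) \<longlongrightarrow> coeff q i) (at_right 0)"
    "\<forall>\<^sub>F e in at_right 0. generic_quadratics (P1 e) (P2 e) (P3 e)"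
proof -
  obtain r1 q1 where 1: "q = r1 * q1" "degree r1 \<le> 2" "degree q1 \<le> 4" "\<And>x. poly r1 x \<ge> 0"
    using nonneg_quadratic_factor[of q 4] assms by auto
  have "finite {x. poly q x = 0}" using assms(1) by (rule poly_roots_finite)
  then have "card {x. poly q1 x = 0} \<le> card {x. poly q x = 0}"
    by (rule card_mono) (auto simp: 1(1))
  then have "card {x. poly q1 x = 0} \<le> 2" using assms(2) by simp
  moreover have "q1 \<noteq> 0" using 1(1) assms(1) by auto
  ultimately obtain r2 r3 where 2: "q1 = r2 * r3" "degree r2 \<le> 2" "degree r3 \<le> 2" "\<And>x. poly r2 x \<ge> 0"
    using nonneg_quadratic_factor[of q1 2] 1(3) by auto
  have quad: "r = [:coeff r 0, coeff r 1, coeff r 2:]" if "degree r \<le> 2" for r :: "real poly"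
    using that by (intro poly_eqI) (auto simp: coeff_pCons coeff_eq_0 numeral_2_eq_2 split: nat.split)
  \<comment> \<open>The added term is \<open>e * (x^2 + m)\<close>. The three factors get
    \<open>m = 1, 2, 3\<close>: positive values make the nonnegative factors positive, and distinct
    ones give the minor of two factors the nonzero coefficient \<open>m' - m\<close> at
    \<open>e^2\<close>.\<close>
  define P where "P = (\<lambda>(r :: real poly) m e. [:coeff r 0 + m * e, coeff r 1, coeff r 2 + e:])"
  have Pr: "P r m e = r + smult e [:m, 0, 1:]" if "degree r \<le> 2" for r m e
  proof -
    have "P r m e = [:coeff r 0, coeff r 1, coeff r 2:] + smult e [:m, 0, 1:]"
      by (simp add: P_def mult.commute)
    then show ?thesis unfolding quad[OF that, symmetric] .
  qed
  show ?thesis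
  proof (rule that)
    fix i
    have "((\<lambda>e. coeff (P r m e) i) \<longlongrightarrow> coeff (P r m 0) i) (at_right 0)" for r m i
      unfolding P_def by (auto simp: coeff_pCons split: nat.split intro!: tendsto_eq_intros)
    moreover have "P r m 0 = r" if "degree r \<le> 2" for r m using Pr[OF that] by simp
    ultimately have "((\<lambda>e. coeff (P r m e) i) \<longlongrightarrow> coeff r i) (at_right 0)" if "degree r \<le> 2" for r m i
      using that by metis
    then show "((\<lambda>e. coeff (P r1 1 e * P r2 2 e * P r3 3 e) i) \<longlongrightarrow> coeff q i) (at_right 0)"
      unfolding 1(1) 2(1) mult.assoc[symmetric] using 1(2) 2(2,3) by (intro tendsto_coeff_mult)
  next
    have lead: "\<forall>\<^sub>F e in at_right 0. coeff r 2 + e \<noteq> 0" for r :: "real poly"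
      using eventually_at_right_poly_neq_0[of "[:coeff r 2, 1:]"] by simp
    have minor: "\<forall>\<^sub>F e in at_right 0. (coeff r 2 + e) * (coeff s 0 + m' * e) \<noteq> (coeff s 2 + e) * (coeff r 0 + m * e)"
      if "m \<noteq> m'" for r s :: "real poly" and m m'
    proof -
      have "\<forall>\<^sub>F e in at_right 0. (coeff r 2 * coeff s 0 - coeff s 2 * coeff r 0)
          + of_real e * (coeff r 2 * m' + coeff s 0 - coeff s 2 * m - coeff r 0) + of_real e * of_real e * (m' - m) \<noteq> 0"
        using that by (intro eventually_quadratic_neq_0) simp
      then show ?thesis by eventually_elim (auto simp: algebra_simps)
    qed
    \<comment> \<open>Whatever \<open>r3\<close> is, the coefficient of \<open>e^2\<close> in the
      difference is \<open>4 * 3\<close>.\<close>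
    have disc: "\<forall>\<^sub>F e in at_right 0. (coeff r3 1)\<^sup>2 \<noteq> 4 * (coeff r3 2 + e) * (coeff r3 0 + 3 * e)"
    proof -
      have "\<forall>\<^sub>F e in at_right 0. (4 * coeff r3 2 * coeff r3 0 - (coeff r3 1)\<^sup>2)
          + of_real e * (4 * (3 * coeff r3 2 + coeff r3 0)) + of_real e * of_real e * 12 \<noteq> 0"
        by (intro eventually_quadratic_neq_0) simp
      then show ?thesis by eventually_elim (auto simp: algebra_simps)
    qed
    have pos: "poly (P r m e) x > 0" if "degree r \<le> 2" "\<And>x. poly r x \<ge> 0" "m > 0" "e > 0" for r m e x
    proof -
      have "e * (m + x * x) > 0" using that by (intro mult_pos_pos add_pos_nonneg) auto
      then show ?thesis using that(2)[of x] unfolding Pr[OF that(1)] by (simp add: algebra_simps)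
    qed
    have coprime: "\<not> (cpoly (P r m e) z = 0 \<and> cpoly (P s m' e) z = 0)"
      if "degree r \<le> 2" "\<And>x. poly r x \<ge> 0" "m > 0" "e > 0"
        "(coeff r 2 + e) * (coeff s 0 + m' * e) \<noteq> (coeff s 2 + e) * (coeff r 0 + m * e)" for r s m m' e z
    proof
      assume z: "cpoly (P r m e) z = 0 \<and> cpoly (P s m' e) z = 0"
      then have "Im z \<noteq> 0" using positive_quadratic_roots_nonreal pos[OF that(1-4)] by blast
      with z that(5) show False unfolding P_def using common_root_minor by blast
    qed
    have minor12: "\<forall>\<^sub>F e in at_right 0. (coeff r1 2 + e) * (coeff r2 0 + 2 * e) \<noteq> (coeff r2 2 + e) * (coeff r1 0 + 1 * e)"
      by (rule minor) simp
    have minor13: "\<forall>\<^sub>F e in at_right 0. (coeff r1 2 + e) * (coeff r3 0 + 3 * e) \<noteq> (coeff r3 2 + e) * (coeff r1 0 + 1 * e)"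
      by (rule minor) simp
    have minor23: "\<forall>\<^sub>F e in at_right 0. (coeff r2 2 + e) * (coeff r3 0 + 3 * e) \<noteq> (coeff r3 2 + e) * (coeff r2 0 + 2 * e)"
      by (rule minor) simp
    have "\<forall>\<^sub>F e in at_right 0. (0::real) < e" by (simp add: eventually_at_right_less)
    with lead[of r1] lead[of r2] lead[of r3] disc minor12 minor13 minor23
    show "\<forall>\<^sub>F e in at_right 0. generic_quadratics (P r1 1 e) (P r2 2 e) (P r3 3 e)"
    proof eventually_elim
      case (elim e)
      obtain \<gamma> \<gamma>' where "\<gamma> \<noteq> \<gamma>'" "\<And>x :: complex ^ 2. bform 2 (P r3 3 e) x =
          of_real (coeff r3 2 + e) * (x $ 1 - \<gamma> * x $ 2) * (x $ 1 - \<gamma>' * x $ 2)"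
        using quadratic_form_split[OF elim(3), of "coeff r3 1" "coeff r3 0 + 3 * e"] elim(4)
        unfolding P_def by metis
      moreover have "complex_of_real (coeff r3 2 + e) \<noteq> 0" using elim(3) by (simp only: of_real_eq_0_iff not_False_eq_True)
      ultimately have ex: "\<exists>\<gamma> \<gamma>' c. \<gamma> \<noteq> \<gamma>' \<and> c \<noteq> 0 \<and>
         (\<forall>x :: complex ^ 2. bform 2 (P r3 3 e) x = c * (x $ 1 - \<gamma> * x $ 2) * (x $ 1 - \<gamma>' * x $ 2))"
        by blast
      have deg: "degree (P r m e) = 2" if "coeff r 2 + e \<noteq> 0" for r m
        using that by (simp add: P_def)
      show ?case unfolding generic_quadratics_def
        by (intro conjI allI ex deg elim(1-3) pos[OF 1(2,4) _ elim(8)] pos[OF 2(2,4) _ elim(8)]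
            coprime[OF 1(2,4) _ elim(8,5)] coprime[OF 1(2,4) _ elim(8,6)]
            coprime[OF 2(2,4) _ elim(8,7)]) simp_all
    qed
  qed
qed

section \<open>Perturbing the knot\<close>


definition affine_point :: "'a::zero_neq_one \<Rightarrow> 'a ^ 2" where
  "affine_point z = vector [z, 1]"

lemma affine_point_nth [simp]: "affine_point z $ 1 = z" "affine_point z $ 2 = 1"
  by (simp_all add: affine_point_def)

lemma affine_point_neq_0 [simp]: "affine_point z \<noteq> 0"
  by (metis affine_point_nth(2) zero_index zero_neq_one)

lemma bform_affine_point: "degree p \<le> d \<Longrightarrow> bform d p (affine_point z) = cpoly p z"
  by (simp add: bform_affine)

lemma bform_real_affine_point: "degree p \<le> d \<Longrightarrow> bform d p (affine_point x) = poly p (x :: real)"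
proof -
  have "map_poly of_real p = p" by (simp add: poly_eq_iff coeff_map_poly)
  then show "degree p \<le> d \<Longrightarrow> ?thesis" by (simp add: bform_affine)
qed

lemma proj_affine_point_eq_iff [simp]:
  "proj (affine_point z) = proj (affine_point z') \<longleftrightarrow> z = (z' :: complex)"
  using wedge_neq_0D[of "affine_point z" "affine_point z'"] by (auto simp: wedge_def)

section \<open>Plane sections as polynomials\<close>

definition pairing :: "real ^ 'n \<Rightarrow> real poly ^ 'n \<Rightarrow> real poly" where
  "pairing h k = (\<Sum>j\<in>UNIV. smult (h $ j) (k $ j))"

definition cdot :: "real ^ 'n \<Rightarrow> complex ^ 'n \<Rightarrow> complex" where
  "cdot h v = (\<Sum>j\<in>UNIV. of_real (h $ j) * v $ j)"

lemma Re_cdot: "Re (cdot h v) = h \<bullet> re_vec v"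
  by (simp add: cdot_def inner_vec_def re_vec_def)

lemma Im_cdot: "Im (cdot h v) = h \<bullet> im_vec v"
  by (simp add: cdot_def inner_vec_def im_vec_def)

lemma cdot_cvec: "cdot h (cvec v) = of_real (h \<bullet> v)"
  by (simp add: cdot_def inner_vec_def)

lemma cdot_add: "cdot h (v + w) = cdot h v + cdot h w"
  by (simp add: cdot_def algebra_simps sum.distrib)

lemma cdot_scale: "cdot h (c *s v) = c * cdot h v"
  by (simp add: cdot_def algebra_simps sum_distrib_left)

lemma bform_pairing: "bform d (pairing h k) x = cdot h (form_eval d k x)"
  by (simp add: pairing_def cdot_def bform_sum bform_smult)

lemma bform_pairing_real: "bform d (pairing h k) x = h \<bullet> form_eval d k (x :: real ^ 2)"
  by (simp add: pairing_def inner_vec_def bform_sum bform_smult)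

lemma degree_pairing: "(\<And>j. degree (k $ j) \<le> d) \<Longrightarrow> degree (pairing h k) \<le> d"
  unfolding pairing_def by (intro degree_sum_le) (auto intro: order.trans[OF degree_smult_le])

text \<open>Values at the roots of \<open>p\<close> are kept, and the section by the plane
  \<open>h\<close> changes by \<open>(h \<bullet> a) p\<close>. A vector \<open>a\<close> in the
  plane therefore moves selected points without changing the section polynomial.\<close>

definition perturb :: "real poly ^ 'n \<Rightarrow> real ^ 'n \<Rightarrow> real poly \<Rightarrow> real poly ^ 'n" where
  "perturb k a p = (\<chi> j. k $ j + smult (a $ j) p)"

lemma form_eval_perturb: "form_eval d (perturb k a p) x = form_eval d k x + bform d p x *s cvec a"
  by (simp add: vec_eq_iff perturb_def bform_add bform_smult)

lemma pairing_perturb: "pairing h (perturb k a p) = pairing h k + smult (h \<bullet> a) p"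
  by (simp add: poly_eq_iff pairing_def perturb_def inner_vec_def coeff_sum sum.distrib
      sum_distrib_left algebra_simps)

text \<open>A coefficient ball as provided by \<open>real_rational_knot_open\<close>. It is convex
  in \<open>k'\<close>, which later gives the isotopy.\<close>

definition coeff_near :: "real \<Rightarrow> nat \<Rightarrow> real poly ^ 'n \<Rightarrow> real poly ^ 'n \<Rightarrow> bool" where
  "coeff_near \<delta> d k k' \<longleftrightarrow>
     (\<forall>j. degree (k' $ j) \<le> d \<and> (\<forall>i\<le>d. \<bar>coeff (k' $ j) i - coeff (k $ j) i\<bar> < \<delta>))"

text \<open>The ball is open, so convergence to any of its elements \<open>k1\<close>, not only to
  the centre, ends inside it. This allows perturbations to be iterated in one ball.\<close>

lemma eventually_coeff_near:
  fixes P :: "real \<Rightarrow> real poly ^ 'n"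
  assumes "coeff_near \<delta> d k k1" "\<And>j i. ((\<lambda>e. coeff (P e $ j) i) \<longlongrightarrow> coeff (k1 $ j) i) F"
    "\<forall>\<^sub>F e in F. \<forall>j. degree (P e $ j) \<le> d"
  shows "\<forall>\<^sub>F e in F. coeff_near \<delta> d k (P e)"
proof -
  have "\<forall>\<^sub>F e in F. \<bar>coeff (P e $ j) i - coeff (k $ j) i\<bar> < \<delta>" if "i \<le> d" for i j
  proof (rule order_tendstoD)
    show "((\<lambda>e. \<bar>coeff (P e $ j) i - coeff (k $ j) i\<bar>) \<longlongrightarrow> \<bar>coeff (k1 $ j) i - coeff (k $ j) i\<bar>) F"
      by (intro tendsto_intros assms(2))
  qed (use assms(1) that in \<open>simp add: coeff_near_def\<close>)
  then have "\<forall>\<^sub>F e in F. \<forall>i\<in>{..d}. \<bar>coeff (P e $ j) i - coeff (k $ j) i\<bar> < \<delta>" for j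
    by (intro eventually_ball_finite) auto
  then have "\<forall>\<^sub>F e in F. \<forall>j. \<forall>i\<in>{..d}. \<bar>coeff (P e $ j) i - coeff (k $ j) i\<bar> < \<delta>"
    by (intro eventually_all_finite)
  with assms(3) show ?thesis
    by eventually_elim (auto simp: coeff_near_def)
qed

lemma eventually_coeff_near_perturb:
  assumes "coeff_near \<delta> d k k1" "degree p \<le> d"
  shows "\<forall>\<^sub>F e in at_right 0. coeff_near \<delta> d k (perturb k1 (e *\<^sub>R a) p)"
proof (rule eventually_coeff_near[OF assms(1)])
  show "((\<lambda>e. coeff (perturb k1 (e *\<^sub>R a) p $ j) i) \<longlongrightarrow> coeff (k1 $ j) i) (at_right 0)" for i j
    by (auto simp: perturb_def intro!: tendsto_eq_intros)
  show "\<forall>\<^sub>F e in at_right 0. \<forall>j. degree (perturb k1 (e *\<^sub>R a) p $ j) \<le> d"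
    using assms unfolding coeff_near_def perturb_def
    by (intro always_eventually allI) (auto intro!: degree_add_le order.trans[OF degree_smult_le])
qed

lemma bform_cnj:
  fixes x :: "complex ^ 2"
  shows "bform d p (\<chi> i. cnj (x $ i)) = cnj (bform d p x)"
  by (simp add: bform_def)

text \<open>Conjugation would give \<open>cnj z\<close> the same real image point, against
  injectivity. Hence the point over a nonreal parameter spans a real line with its
  conjugate.\<close>

lemma nonreal_point:
  assumes "real_rational_knot d (k :: real poly ^ 'n)" "Im z \<noteq> 0"
  shows "form_eval d k (affine_point z) \<noteq> c *s cvec w"
proof
  assume eq: "form_eval d k (affine_point z) = c *s cvec w"
  have cnj: "affine_point (cnj z) = (\<chi> i. cnj (affine_point z $ i))"
    by (simp add: vec_eq_iff forall_2)
  have "form_eval d k (affine_point (cnj z)) $ j = cnj (form_eval d k (affine_point z) $ j)" for j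
    unfolding form_eval_nth cnj by (rule bform_cnj)
  then have eq': "form_eval d k (affine_point (cnj z)) = cnj c *s cvec w"
    unfolding eq by (simp add: vec_eq_iff)
  have "form_eval d k (affine_point z) \<noteq> 0"
    using assms(1) by (simp add: real_rational_knot_def real_rational_curve_def)
  then have "c \<noteq> 0" using eq by auto
  then have "proj (form_eval d k (affine_point z)) = proj (form_eval d k (affine_point (cnj z)))"
    unfolding eq eq' by simp
  then have "proj (affine_point z) = proj (affine_point (cnj z))"
    using assms(1) affine_point_neq_0 unfolding real_rational_knot_def complex_injective_def by blast
  then have "z = cnj z" by simp
  then show False using assms(2) by (simp add: complex_eq_iff)
qed

text \<open>The hyperplane misses the sphere, so it has no isotropic vector and, by the intermediate
  value theorem, the form has constant sign on it. The sign is negative because some nonzero vector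
  of the hyperplane has zeroth coordinate 0.\<close>

lemma lor_neg_definite:
  assumes A: "disjoint_hyperplane A" and y: "y \<noteq> 0"
  shows "lor (A *v y) (A *v y) < 0"
proof (rule ccontr)
  have nz: "lor (A *v x) (A *v x) \<noteq> 0" if "x \<noteq> 0" for x
  proof
    assume 0: "lor (A *v x) (A *v x) = 0"
    have "A *v x \<noteq> 0"
      using A that inj_eq[of "(*v) A" x 0] by (simp add: disjoint_hyperplane_def)
    then have "proj (A *v x) \<in> S3"
      using 0 unfolding S3_def lor_eq_0_iff power2_eq_square by blast
    then show False using A that unfolding disjoint_hyperplane_def by blast
  qed
  assume "\<not> ?thesis"
  then have pos: "lor (A *v y) (A *v y) > 0" using nz[OF y] by simp
  obtain x where x: "x \<noteq> 0" "orthogonal (A $ 0) x"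
    using orthogonal_to_vector_exists[of "A $ 0"] by auto
  then have x0: "(A *v x) $ 0 = 0" by (simp add: matrix_vector_mul_component orthogonal_def)
  have "lor (A *v x) (A *v x) \<le> 0"
    using zero_le_square[of "(A *v x) $ 1"] zero_le_square[of "(A *v x) $ 2"]
      zero_le_square[of "(A *v x) $ 3"] zero_le_square[of "(A *v x) $ 4"]
    unfolding lor_def x0 by linarith
  then have neg: "lor (A *v x) (A *v x) < 0" using nz[OF x(1)] by simp
  define \<psi> where "\<psi> = (\<lambda>t. lor (A *v ((1 - t) *\<^sub>R y + t *\<^sub>R x)) (A *v ((1 - t) *\<^sub>R y + t *\<^sub>R x)))"
  have \<psi>: "\<psi> t = (1 - t) * (1 - t) * lor (A *v y) (A *v y) + 2 * (t * (1 - t)) * lor (A *v y) (A *v x)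
      + t * t * lor (A *v x) (A *v x)" for t
  proof -
    have "A *v ((1 - t) *\<^sub>R y + t *\<^sub>R x) = (1 - t) *s (A *v y) + t *s (A *v x)"
      by (simp add: matrix_vector_right_distrib matrix_vector_mult_scaleR scalar_mult_eq_scaleR)
    then show ?thesis unfolding \<psi>_def
      by (simp only: lor_bilinear lor_sym[of "A *v x" "A *v y"]) (simp add: algebra_simps)
  qed
  have "\<exists>t. 0 \<le> t \<and> t \<le> 1 \<and> \<psi> t = 0"
    unfolding \<psi> using pos neg by (intro IVT2') (auto intro!: continuous_intros)
  then obtain t where "\<psi> t = 0" by blast
  \<comment> \<open>The segment can only meet a zero of the form at the origin. Then
    \<open>y\<close> is a multiple of \<open>x\<close>, and the form is not positive there.\<close>
  then have t: "(1 - t) *\<^sub>R y + t *\<^sub>R x = 0" using nz unfolding \<psi>_def by blast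
  show False
  proof (cases "t = 1")
    case True
    then show False using t x(1) by simp
  next
    case False
    have "(1 - t) *\<^sub>R y = (- t) *\<^sub>R x" using t by (simp add: eq_neg_iff_add_eq_0)
    then have "y = (- t / (1 - t)) *\<^sub>R x" using False
      by (metis (no_types) divide_inverse mult.commute right_minus_eq scaleR_scaleR scaleR_one left_inverse)
    then have "A *v y = (- t / (1 - t)) *s (A *v x)"
      by (simp only: matrix_vector_mult_scaleR scalar_mult_eq_scaleR)
    then have "lor (A *v y) (A *v y) = (- t / (1 - t)) * (- t / (1 - t)) * lor (A *v x) (A *v x)"
      by (simp only: lor_bilinear mult.assoc)
    also have "\<dots> \<le> 0" using neg by (intro mult_nonneg_nonpos) auto
    finally show False using pos by simp
  qed
qed

lemma span_inner_0:
  assumes "\<And>x. x \<in> X \<Longrightarrow> h \<bullet> x = 0" "y \<in> span X"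
  shows "h \<bullet> y = 0"
  using assms(2) by (induction rule: span_induct_alt) (auto simp: inner_add_right assms(1))

text \<open>With \<open>h \<bullet> z = 1\<close>, a change of \<open>K\<close> in the direction
  \<open>z\<close> alone replaces the section polynomial \<open>q\<close> by any nearby sextic. The
  real roots of \<open>q\<close> inject into the real points on the plane; a root at infinity may be
  missed, as their number is only bounded from above.\<close>

lemma plane_section_perturbation:
  fixes K :: "real poly ^ 4" and h :: "real ^ 4"
  assumes K: "real_rational_knot 6 K" and h: "h \<noteq> 0" and \<delta>: "\<delta> > 0"
    and fin: "finite (real_points 6 K \<inter> {proj v | v. v \<noteq> 0 \<and> h \<bullet> v = 0})"
    and card: "card (real_points 6 K \<inter> {proj v | v. v \<noteq> 0 \<and> h \<bullet> v = 0}) \<le> 2"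
  obtains K1 :: "real poly ^ 4" and r1 r2 r3 where
    "coeff_near \<delta> 6 K K1" "pairing h K1 = r1 * r2 * r3" "generic_quadratics r1 r2 r3"
proof -
  define q where "q = pairing h K"
  have dK: "degree (K $ j) \<le> 6" for j
    using K by (simp add: real_rational_knot_def real_rational_curve_def)
  then have dq: "degree q \<le> 6" unfolding q_def by (rule degree_pairing)
  let ?I = "real_points 6 K \<inter> {proj v | v. v \<noteq> 0 \<and> h \<bullet> v = 0}"
  let ?F = "\<lambda>x :: real. proj (form_eval 6 K (affine_point x))"
  have caff: "affine_point (complex_of_real x) = cvec (affine_point x)" for x
    by (simp add: vec_eq_iff forall_2)
  have Fc: "form_eval 6 K (affine_point (complex_of_real x)) = cvec (form_eval 6 K (affine_point x))" for x
    unfolding caff by (rule form_eval_cvec)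
  have injF: "inj ?F"
  proof (rule injI)
    fix x y assume "?F x = ?F y"
    then obtain c where "c \<noteq> 0" "form_eval 6 K (affine_point y) = c *s form_eval 6 K (affine_point x)"
      unfolding proj_eq_iff by blast
    moreover then have "cvec (form_eval 6 K (affine_point y)) = of_real c *s cvec (form_eval 6 K (affine_point x))"
      by (metis (no_types) cvec_nth of_real_mult vec_eq_iff vector_smult_component)
    ultimately have "proj (form_eval 6 K (affine_point (complex_of_real x)))
        = proj (form_eval 6 K (affine_point (complex_of_real y)))"
      unfolding Fc proj_eq_iff by (metis of_real_eq_0_iff)
    then have "proj (affine_point (complex_of_real x)) = proj (affine_point (complex_of_real y))"
      using K affine_point_neq_0 unfolding real_rational_knot_def complex_injective_def by blast
    then show "x = y" by simp
  qed
  have sub: "?F ` {x. poly q x = 0} \<subseteq> ?I"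
  proof (intro image_subsetI IntI)
    fix x assume "x \<in> {x. poly q x = 0}"
    then have "h \<bullet> form_eval 6 K (affine_point x) = 0"
      using bform_real_affine_point[OF dq, of x] by (simp add: q_def bform_pairing_real)
    moreover have "form_eval 6 K (affine_point (complex_of_real x)) \<noteq> 0"
      using K by (simp add: real_rational_knot_def real_rational_curve_def)
    then have "form_eval 6 K (affine_point x) \<noteq> 0" unfolding Fc by simp
    ultimately show "?F x \<in> {proj v | v. v \<noteq> 0 \<and> h \<bullet> v = 0}" by blast
    show "?F x \<in> real_points 6 K"
      unfolding real_points_def using affine_point_neq_0 by blast
  qed
  have inj: "inj_on ?F {x. poly q x = 0}" using injF subset_UNIV by (rule inj_on_subset)
  have cq: "card {x. poly q x = 0} \<le> 2"
    using card_inj_on_le[OF inj sub fin] card by (rule order.trans)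
  \<comment> \<open>For \<open>q = 0\<close> the injection would embed the whole real line into a
    finite set.\<close>
  have q0: "q \<noteq> 0"
    using inj_on_finite[OF inj sub fin] infinite_UNIV_char_0[where 'a = real] by auto
  obtain P1 P2 P3 :: "real \<Rightarrow> real poly" where
    lim: "\<And>i. ((\<lambda>e. coeff (P1 e * P2 e * P3 e) i) \<longlongrightarrow> coeff q i) (at_right 0)" and
    ev: "\<forall>\<^sub>F e in at_right 0. generic_quadratics (P1 e) (P2 e) (P3 e)"
    by (rule sextic_perturbation[OF q0 cq dq], rule that)
  define z where "z = (1 / (h \<bullet> h)) *\<^sub>R h"
  have hz: "h \<bullet> z = 1" using h by (simp add: z_def)
  define P where "P = (\<lambda>e. perturb K z (P1 e * P2 e * P3 e - q))"
  have pP: "pairing h (P e) = P1 e * P2 e * P3 e" for e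
    by (simp add: P_def pairing_perturb hz q_def)
  have "\<forall>\<^sub>F e in at_right 0. coeff_near \<delta> 6 K (P e)"
  proof (rule eventually_coeff_near)
    show "coeff_near \<delta> 6 K K" using \<delta> dK by (simp add: coeff_near_def)
    show "((\<lambda>e. coeff (P e $ j) i) \<longlongrightarrow> coeff (K $ j) i) (at_right 0)" for i j
      unfolding P_def perturb_def by (auto intro!: tendsto_eq_intros lim)
    show "\<forall>\<^sub>F e in at_right 0. \<forall>j. degree (P e $ j) \<le> 6"
      using ev
    proof eventually_elim
      case (elim e)
      then have "degree (P1 e * P2 e * P3 e) \<le> 6"
        using degree_mult_le[of "P1 e * P2 e" "P3 e"] degree_mult_le[of "P1 e" "P2 e"]
        by (simp add: generic_quadratics_def)
      then show ?case unfolding P_def perturb_def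
        by (auto intro!: degree_add_le degree_diff_le dK dq order.trans[OF degree_smult_le])
    qed
  qed
  from eventually_happens'[OF trivial_limit_at_right_real eventually_conj[OF ev this]]
  show ?thesis using that[OF _ pP] by blast
qed

lemma lessThan_small:
  "{..<0::nat} = {}" "{..<1::nat} = {0}" "{..<2::nat} = {1, 0}" "{..<3::nat} = {2, 1, 0}" "{..<4::nat} = {3, 2, 1, 0}"
  by auto

text \<open>The two conjugate pairs could lie on one real line. A perturbation by a multiple of
  \<open>r1\<close> along the normal \<open>l\<close> of the first line fixes the first pair and the
  section, and moves the second pair off that line. Then the real lines of the pairs meet in a
  single point, which becomes \<open>n 0\<close>.\<close>

lemma adapted_frame:
  fixes K K1 :: "real poly ^ 4" and h :: "real ^ 4"
  assumes open_nbhd: "\<And>K'. coeff_near \<delta> 6 K K' \<Longrightarrow> real_rational_knot 6 K'"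
    and h: "h \<noteq> 0" and near: "coeff_near \<delta> 6 K K1"
    and pair: "pairing h K1 = r1 * r2 * r3" and deg: "degree r1 = 2" "degree r2 = 2" "degree r3 = 2"
    and \<alpha>: "Im \<alpha> \<noteq> 0" "cpoly r1 \<alpha> = 0" and \<beta>: "Im \<beta> \<noteq> 0" "cpoly r2 \<beta> = 0" "cpoly r1 \<beta> \<noteq> 0"
  obtains K2 :: "real poly ^ 4" and n \<mu> \<nu> where
    "coeff_near \<delta> 6 K K2" "pairing h K2 = r1 * r2 * r3"
    "\<forall>i<4. n i \<notin> span (n ` {..<i})"
    "h \<bullet> n 0 = 0" "h \<bullet> n 1 = 0" "h \<bullet> n 2 = 0" "h \<bullet> n (3::nat) = 1"
    "form_eval 6 K2 (affine_point \<alpha>) = \<mu> *s (cvec (n 0) + \<i> *s cvec (n 1))"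
    "form_eval 6 K2 (affine_point \<beta>) = \<nu> *s (cvec (n 0) + \<i> *s cvec (n 2))"
proof -
  define a where "a = form_eval 6 K1 (affine_point \<alpha>)"
  have dr: "degree (r1 * r2 * r3) \<le> 6"
    using degree_mult_le[of "r1 * r2" r3] degree_mult_le[of r1 r2] deg by simp
  have cd: "cdot h (form_eval 6 K' (affine_point z)) = cpoly r1 z * cpoly r2 z * cpoly r3 z"
    if "pairing h K' = r1 * r2 * r3" for K' z
    using bform_pairing[of 6 h K' "affine_point z"] bform_affine_point[OF dr, of z] that
    by (simp add: map_poly_of_real_mult)
  have ha: "cdot h a = 0" using cd[OF pair] \<alpha>(2) by (simp add: a_def)
  have a_nonreal: "a \<noteq> c *s cvec w" for c w
    unfolding a_def by (rule nonreal_point[OF open_nbhd[OF near] \<alpha>(1)])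
  have "dim {re_vec a, im_vec a, h} \<le> card {re_vec a, im_vec a, h}" by (intro dim_le_card') simp
  also have "\<dots> < DIM(real ^ 4)"
    using card_insert_le_m1[of 3 "{im_vec a, h}" "re_vec a"] card_insert_le_m1[of 2 "{h}" "im_vec a"] by simp
  \<comment> \<open>Together with \<open>h\<close>, the covector \<open>l\<close> cuts out the real
    line through the first conjugate pair.\<close>
  finally obtain l where l: "l \<noteq> 0" "\<And>y. y \<in> span {re_vec a, im_vec a, h} \<Longrightarrow> orthogonal l y"
    using orthogonal_to_subspace_exists by blast
  have "l \<bullet> y = 0" if "y \<in> {re_vec a, im_vec a, h}" for y
    using l(2)[OF span_base[OF that]] by (simp add: orthogonal_def)
  then have l': "l \<bullet> re_vec a = 0" "l \<bullet> im_vec a = 0" "h \<bullet> l = 0"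
    by (simp_all add: inner_commute[of h l])
  have la: "cdot l a = 0" by (simp add: complex_eq_iff Re_cdot Im_cdot l')
  define P where "P = (\<lambda>e. perturb K1 (e *\<^sub>R l) r1)"
  have "cdot l (form_eval 6 (P e) (affine_point \<beta>)) =
      cdot l (form_eval 6 K1 (affine_point \<beta>)) + of_real e * (cpoly r1 \<beta> * of_real (l \<bullet> l))" for e
    unfolding P_def form_eval_perturb cdot_add cdot_scale cdot_cvec using deg(1)
    by (simp add: bform_affine_point)
  moreover have "[:cdot l (form_eval 6 K1 (affine_point \<beta>)), cpoly r1 \<beta> * of_real (l \<bullet> l):] \<noteq> 0"
    using \<beta>(3) l(1) by simp
  from eventually_at_right_poly_neq_0[OF this]
  have "\<forall>\<^sub>F e in at_right (0::real). cdot l (form_eval 6 K1 (affine_point \<beta>))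
      + of_real e * (cpoly r1 \<beta> * of_real (l \<bullet> l)) \<noteq> 0" by simp
  ultimately have "\<forall>\<^sub>F e in at_right 0. cdot l (form_eval 6 (P e) (affine_point \<beta>)) \<noteq> 0" by simp
  moreover have "\<forall>\<^sub>F e in at_right 0. coeff_near \<delta> 6 K (P e)"
    unfolding P_def using deg(1) by (intro eventually_coeff_near_perturb near) simp
  ultimately have "\<forall>\<^sub>F e in at_right 0. cdot l (form_eval 6 (P e) (affine_point \<beta>)) \<noteq> 0 \<and> coeff_near \<delta> 6 K (P e)"
    by (rule eventually_conj)
  from eventually_happens'[OF trivial_limit_at_right_real this] obtain e where
    e: "cdot l (form_eval 6 (P e) (affine_point \<beta>)) \<noteq> 0" "coeff_near \<delta> 6 K (P e)"
    by blast
  define K2 where "K2 = P e"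
  define b where "b = form_eval 6 K2 (affine_point \<beta>)"
  have K2a: "form_eval 6 K2 (affine_point \<alpha>) = a"
    unfolding K2_def P_def form_eval_perturb a_def using \<alpha>(2) deg(1) by (simp add: bform_affine_point)
  have pair2: "pairing h K2 = r1 * r2 * r3"
    by (simp add: K2_def P_def pairing_perturb l' pair)
  have hb: "cdot h b = 0" using cd[OF pair2] \<beta>(2) by (simp add: b_def)
  have b_nonreal: "b \<noteq> c *s cvec w" for c w
    unfolding b_def K2_def by (rule nonreal_point[OF open_nbhd[OF e(2)] \<beta>(1)])
  have lb: "cdot l b \<noteq> 0" using e(1) by (simp add: b_def K2_def)
  \<comment> \<open>The scaling makes the value of \<open>l\<close> on \<open>b'\<close> purely
    imaginary, so the real part \<open>w\<close> of \<open>b'\<close> lies on the line of the first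
    pair: it is the intersection point of the two real lines.\<close>
  define b' where "b' = (\<i> / cdot l b) *s b"
  have bb': "b = (cdot l b / \<i>) *s b'" using lb by (simp add: b'_def vector_smult_assoc)
  have lb': "cdot l b' = \<i>" using lb by (simp add: b'_def cdot_scale)
  have hb': "cdot h b' = 0" by (simp add: b'_def cdot_scale hb)
  define w where "w = re_vec b'"
  define v' where "v' = im_vec b'"
  have b'_eq: "b' = cvec w + \<i> *s cvec v'" unfolding w_def v'_def by (rule re_im_vec)
  have lw: "l \<bullet> w = 0" "l \<bullet> v' = 1" "h \<bullet> w = 0" "h \<bullet> v' = 0"
    using lb' hb' by (simp_all add: w_def v'_def complex_eq_iff flip: Re_cdot Im_cdot)
  have w0: "w \<noteq> 0"
  proof
    assume "w = 0"
    then have "b = (cdot l b / \<i> * \<i>) *s cvec v'" by (subst bb') (simp add: b'_eq vector_smult_assoc)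
    then show False using b_nonreal by blast
  qed
  have hre: "h \<bullet> re_vec a = 0" "h \<bullet> im_vec a = 0"
    using ha by (simp_all add: complex_eq_iff flip: Re_cdot Im_cdot)
  have a_eq: "a = cvec (re_vec a) + \<i> *s cvec (im_vec a)" by (rule re_im_vec)
  have re0: "re_vec a \<noteq> 0"
  proof
    assume "re_vec a = 0"
    then have "a = \<i> *s cvec (im_vec a)" using a_eq by simp
    then show False using a_nonreal by blast
  qed
  \<comment> \<open>\<open>w\<close> is orthogonal to \<open>h\<close> and \<open>l\<close>, which
    complete the real and imaginary parts of \<open>a\<close> to a basis and are orthogonal to
    them.\<close>
  have "\<exists>s t. w = s *\<^sub>R re_vec a + t *\<^sub>R im_vec a"
  proof -
    define m where "m = (\<lambda>i::nat. [h, l, re_vec a, im_vec a] ! i)"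
    have m: "m 0 = h" "m 1 = l" "m 2 = re_vec a" "m 3 = im_vec a" by (simp_all add: m_def)
    have "m i \<notin> span (m ` {..<i})" if i: "i < 4" for i
    proof -
      have "l \<notin> span {h}"
        using span_inner_0[of "{h}" l l] l(1) l'(3) by (auto simp: inner_commute)
      moreover have "re_vec a \<notin> span {l, h}"
        using span_inner_0[of "{l, h}" "re_vec a" "re_vec a"] re0 l' hre by (auto simp: inner_commute)
      moreover have "im_vec a \<notin> span {re_vec a, l, h}"
      proof
        assume "im_vec a \<in> span {re_vec a, l, h}"
        then obtain s where s: "im_vec a - s *\<^sub>R re_vec a \<in> span {l, h}"
          unfolding span_insert[of "re_vec a"] by blast
        then have "(im_vec a - s *\<^sub>R re_vec a) \<bullet> (im_vec a - s *\<^sub>R re_vec a) = 0"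
          using l' hre by (intro span_inner_0[OF _ s]) (auto simp: inner_diff_left inner_diff_right inner_commute)
        then have "im_vec a = s *\<^sub>R re_vec a" by simp
        then have "a = (1 + \<i> * of_real s) *s cvec (re_vec a)"
          by (subst a_eq) (simp add: vec_eq_iff algebra_simps)
        then show False using a_nonreal by blast
      qed
      moreover have "i = 0 \<or> i = 1 \<or> i = 2 \<or> i = 3" using i by linarith
      ultimately show ?thesis using h
        by (elim disjE) (simp_all only: lessThan_small image_insert image_empty m span_empty singleton_iff simp_thms)
    qed
    then have "span (m ` {..<CARD(4)}) = UNIV" by (intro span_lessThan_CARD) simp
    moreover have "m ` {..<CARD(4)} = {re_vec a, im_vec a, l, h}"
      by (auto simp: m_def lessThan_Suc eval_nat_numeral)
    ultimately have "w \<in> span {re_vec a, im_vec a, l, h}" by simp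
    then have "\<exists>s. w - s *\<^sub>R re_vec a \<in> span {im_vec a, l, h}"
      by (simp only: span_breakdown_eq)
    then obtain s where s: "w - s *\<^sub>R re_vec a \<in> span {im_vec a, l, h}" ..
    then have "\<exists>t. w - s *\<^sub>R re_vec a - t *\<^sub>R im_vec a \<in> span {l, h}"
      by (simp only: span_breakdown_eq)
    then obtain t where "w - s *\<^sub>R re_vec a - t *\<^sub>R im_vec a \<in> span {l, h}" ..
    then have "(w - s *\<^sub>R re_vec a - t *\<^sub>R im_vec a) \<bullet> (w - s *\<^sub>R re_vec a - t *\<^sub>R im_vec a) = 0"
    proof (rule span_inner_0[rotated])
      have "re_vec a \<bullet> l = 0" "im_vec a \<bullet> l = 0" "re_vec a \<bullet> h = 0" "im_vec a \<bullet> h = 0" "w \<bullet> l = 0" "w \<bullet> h = 0"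
        by (subst inner_commute, simp add: l' hre lw)+
      then show "(w - s *\<^sub>R re_vec a - t *\<^sub>R im_vec a) \<bullet> x = 0" if "x \<in> {l, h}" for x
        using that by (auto simp: inner_diff_left)
    qed
    then have "w - s *\<^sub>R re_vec a - t *\<^sub>R im_vec a = 0" by (simp only: inner_eq_zero_iff)
    then have "w = s *\<^sub>R re_vec a + t *\<^sub>R im_vec a" by (simp add: algebra_simps)
    then show ?thesis by blast
  qed
  then obtain s t where st: "w = s *\<^sub>R re_vec a + t *\<^sub>R im_vec a" by blast
  \<comment> \<open>Multiplying \<open>a\<close> by \<open>s - \<i> t\<close> produces the real part
    \<open>s Re a + t Im a\<close>, that is, \<open>w\<close>.\<close>
  define \<rho> where "\<rho> = Complex s (- t)"
  have \<rho>0: "\<rho> \<noteq> 0" using st w0 by (auto simp: \<rho>_def complex_eq_iff)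
  define v where "v = im_vec (\<rho> *s a)"
  have "re_vec (\<rho> *s a) = w" by (simp add: st \<rho>_def re_vec_def im_vec_def vec_eq_iff)
  then have \<rho>a: "\<rho> *s a = cvec w + \<i> *s cvec v" unfolding v_def using re_im_vec by metis
  then have a_wv: "a = (1 / \<rho>) *s (cvec w + \<i> *s cvec v)"
    using \<rho>0 by (simp add: vector_smult_assoc flip: \<rho>a)
  have lv: "l \<bullet> v = 0" "h \<bullet> v = 0"
    by (simp_all add: v_def la ha cdot_scale flip: Im_cdot)
  define z where "z = (1 / (h \<bullet> h)) *\<^sub>R h"
  have hz: "h \<bullet> z = 1" using h by (simp add: z_def)
  define n where "n = (\<lambda>i::nat. [w, v, v', z] ! i)"
  have n: "n 0 = w" "n 1 = v" "n 2 = v'" "n 3 = z" by (simp_all add: n_def)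
  have "n i \<notin> span (n ` {..<i})" if i: "i < 4" for i
  proof -
    have "v \<notin> span {w}"
    proof
      assume "v \<in> span {w}"
      then obtain x where "v = x *\<^sub>R w" by (auto simp: span_singleton)
      then have "a = (1 / \<rho> * (1 + \<i> * of_real x)) *s cvec w"
        by (subst a_wv) (simp add: vec_eq_iff algebra_simps)
      then show False using a_nonreal by blast
    qed
    moreover have "v' \<notin> span {v, w}" using span_inner_0[of "{v, w}" l v'] lw lv by auto
    moreover have "z \<notin> span {v', v, w}" using span_inner_0[of "{v', v, w}" h z] lw lv hz by auto
    moreover have "i = 0 \<or> i = 1 \<or> i = 2 \<or> i = 3" using i by linarith
    ultimately show ?thesis using w0
      by (elim disjE) (simp_all only: lessThan_small image_insert image_empty n span_empty singleton_iff simp_thms)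
  qed
  then have "\<forall>i<4. n i \<notin> span (n ` {..<i})" by blast
  then show ?thesis
    using that[of K2 n "1 / \<rho>" "cdot l b / \<i>"] e(2) pair2 lw lv hz a_wv bb' b'_eq
    unfolding n K2a b_def[symmetric] K2_def[symmetric] by metis
qed

section \<open>The isotopy\<close>


lemma matrix_scale_lor: "A *v (c *\<^sub>R x) = c *s (A *v (x :: real ^ 'n))"
  by (simp add: matrix_vector_mult_scaleR scalar_mult_eq_scaleR)

text \<open>Projecting the vector \<open>e\<close> of square 1 off the hyperplane: the components
  are added, not subtracted, because the frame vectors have square -1. The square of the result is 1
  plus a sum of squares, hence positive, and can be normalized.\<close>

lemma lor_normal_vector_exists:
  fixes A :: "real ^ 4 ^ 5" and f :: "nat \<Rightarrow> real ^ 4"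
  assumes orth: "\<And>i j. i < 4 \<Longrightarrow> j < 4 \<Longrightarrow> lor (A *v f i) (A *v f j) = (if i = j then -1 else 0)"
    and span: "span (f ` {..<4}) = UNIV"
  obtains n where "\<And>y. lor n (A *v y) = 0" "lor n n = 1"
proof -
  define e :: "real ^ 5" where "e = axis 0 1"
  have sum_left: "lor (\<Sum>i\<in>I. g i) y = (\<Sum>i\<in>I. lor (g i) y)" for I and g :: "nat \<Rightarrow> real ^ 5" and y
    by (induction I rule: infinite_finite_induct) (simp_all add: lor_add_left, simp_all add: lor_def)
  define m where "m = e + (\<Sum>i<4. lor e (A *v f i) *s (A *v f i))"
  have mf: "lor m (A *v f j) = 0" if j: "j < 4" for j
  proof -
    have "(\<Sum>i<4. lor e (A *v f i) * lor (A *v f i) (A *v f j)) = (\<Sum>i<4. if i = j then - lor e (A *v f j) else 0)"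
      using orth j by (intro sum.cong) auto
    then show ?thesis using j by (simp add: m_def lor_add_left sum_left lor_scale_left)
  qed
  have m0: "lor m (A *v y) = 0" for y
  proof -
    have "y \<in> span (f ` {..<4})" using span by simp
    then show ?thesis
    proof (induction rule: span_induct_alt)
      case base
      then show ?case by (simp add: lor_def)
    next
      case (step c x y)
      then show ?case
        using mf by (auto simp: matrix_vector_right_distrib matrix_scale_lor lor_bilinear)
    qed
  qed
  have ee: "lor e e = 1" by (simp add: e_def lor_def axis_def)
  have "lor m m = lor m e + (\<Sum>i<4. lor e (A *v f i) * lor (A *v f i) m)"
    by (subst (2) m_def) (simp add: lor_add_right lor_sym[of m "sum _ _"] sum_left lor_scale_left)
  also have "\<dots> = lor m e" by (simp add: lor_sym[of _ m] m0)
  also have "\<dots> = lor e e + (\<Sum>i<4. lor e (A *v f i) * lor e (A *v f i))"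
    by (simp add: m_def lor_add_left sum_left lor_scale_left lor_sym[of "A *v _" e])
  also have "\<dots> > 0" unfolding ee by (intro add_pos_nonneg sum_nonneg) auto
  finally have pos: "lor m m > 0" .
  show ?thesis
  proof (rule that)
    show "lor ((1 / sqrt (lor m m)) *s m) (A *v y) = 0" for y by (simp add: lor_scale_left m0)
    show "lor ((1 / sqrt (lor m m)) *s m) ((1 / sqrt (lor m m)) *s m) = 1"
      using pos by (simp add: lor_scale_left lor_scale_right field_simps)
  qed
qed

text \<open>The square of \<open>x + \<i> y\<close> has the difference of the two squares as real
  part and twice the mixed product as imaginary part. Two orthogonal frame vectors of equal square
  thus give a point of the conic.\<close>

lemma lor_complex_isotropic:
  fixes R :: "real ^ 4 ^ 5"
  assumes "lor (R *v x) (R *v x) = lor (R *v y) (R *v y)" "lor (R *v x) (R *v y) = 0"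
  shows "lor (cmat R *v (\<mu> *s (cvec x + \<i> *s cvec y))) (cmat R *v (\<mu> *s (cvec x + \<i> *s cvec y))) = 0"
proof -
  have lc: "lor (cvec v) (cvec w) = of_real (lor v w)" for v w by (simp add: lor_def)
  have "cmat R *v (\<mu> *s (cvec x + \<i> *s cvec y)) = \<mu> *s (cvec (R *v x) + \<i> *s cvec (R *v y))"
    by (simp add: vec_eq_iff matrix_vector_mult_def cmat_def sum_distrib_left sum.distrib algebra_simps)
  then show ?thesis
    using assms by (simp add: lor_bilinear lc lor_sym[of "R *v y" "R *v x"] algebra_simps)
qed

text \<open>Values on the standard basis turn an identity of linear functionals into one of
  polynomials.\<close>

lemma lor_const_lin_image:
  fixes R :: "real ^ 'n ^ 5"
  assumes "\<And>x. lor p (R *v x) = - (h \<bullet> x)"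
  shows "lor (const_vec p) (lin_image R k) = - pairing h k"
proof -
  have "lor p (R *v axis j 1) = - (h $ j)" for j
    by (simp add: assms inner_axis)
  then have "lor p (column j R) = - (h $ j)" for j by (simp add: matrix_vector_mult_basis)
  then have h: "h $ j = - (p $ 0 * R $ 0 $ j - p $ 1 * R $ 1 $ j - p $ 2 * R $ 2 $ j - p $ 3 * R $ 3 $ j - p $ 4 * R $ 4 $ j)" for j
    by (simp add: lor_def column_def)
  show ?thesis
    by (simp add: poly_eq_iff lor_def const_vec_def lin_image_nth pairing_def h coeff_sum
        sum_distrib_left sum_subtractf sum_negf sum.distrib algebra_simps)
qed

lemma degree_lor:
  assumes "\<And>i. degree (k $ i) \<le> d" "\<And>i. degree (l $ i) \<le> e"
  shows "degree (lor k l) \<le> d + e"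
  unfolding lor_def
  by (intro degree_diff_le order.trans[OF degree_mult_le] add_mono assms)

lemma cpoly_mult: "cpoly (p * q) z = cpoly p z * cpoly q z"
  by (simp add: map_poly_of_real_mult)

lemma cpoly_uminus: "cpoly (- p) z = - cpoly p z"
  by (induction p) (auto simp: map_poly_pCons)

theorem corollary38:
  fixes K :: "real poly ^ 4" and A :: "real ^ 4 ^ 5"
  assumes "disjoint_hyperplane A"
    and "real_rational_knot 6 K"
    and "\<exists>h :: real ^ 4. h \<noteq> 0 \<and>
           finite (real_points 6 K \<inter> {proj v | v. v \<noteq> 0 \<and> h \<bullet> v = 0}) \<and>
           card (real_points 6 K \<inter> {proj v | v. v \<noteq> 0 \<and> h \<bullet> v = 0}) \<le> 2"
  shows "\<exists>(K' :: real poly ^ 4) (C :: real poly ^ 5) (p :: real ^ 5).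
           real_rational_curve 8 C \<and> real_points 8 C \<subseteq> S3 \<and>
           p \<noteq> 0 \<and> proj p \<in> S3 \<and> one_double_point 8 C (proj (cvec p)) \<and>
           real_rational_knot 6 K' \<and> complex_points 6 K' = stereographic_curve A p 8 C \<and>
           rigidly_isotopic 6 K K'"
proof -
  obtain h :: "real ^ 4" where h: "h \<noteq> 0"
      "finite (real_points 6 K \<inter> {proj v | v. v \<noteq> 0 \<and> h \<bullet> v = 0})"
      "card (real_points 6 K \<inter> {proj v | v. v \<noteq> 0 \<and> h \<bullet> v = 0}) \<le> 2"
    using assms(3) by blast
  obtain \<delta> where \<delta>: "\<delta> > 0" "\<And>K'. coeff_near \<delta> 6 K K' \<Longrightarrow> real_rational_knot 6 K'"
    using real_rational_knot_open[OF assms(2)] unfolding coeff_near_def by blast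
  obtain K1 r1 r2 r3 where K1: "coeff_near \<delta> 6 K K1" "pairing h K1 = r1 * r2 * r3"
      and gen: "generic_quadratics r1 r2 r3"
    by (rule plane_section_perturbation[OF assms(2) h(1) \<delta>(1) h(2,3)])
  note gen' = gen[unfolded generic_quadratics_def]
  have deg: "degree r1 = 2" "degree r2 = 2" "degree r3 = 2" using gen' by blast+
  then have r0: "r1 \<noteq> 0" "r2 \<noteq> 0" by auto
  obtain \<alpha> where \<alpha>: "cpoly r1 \<alpha> = 0" using cpoly_root[of r1] deg by auto
  obtain \<beta> where \<beta>: "cpoly r2 \<beta> = 0" using cpoly_root[of r2] deg by auto
  have im: "Im \<alpha> \<noteq> 0" "Im \<beta> \<noteq> 0"
    using positive_quadratic_roots_nonreal gen' \<alpha> \<beta> by blast+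
  have r1\<beta>: "cpoly r1 \<beta> \<noteq> 0" using gen' \<beta> by blast
  obtain \<gamma> \<gamma>' c where \<gamma>: "\<gamma> \<noteq> \<gamma>'" "c \<noteq> 0"
      "\<And>x :: complex ^ 2. bform 2 r3 x = c * (x $ 1 - \<gamma> * x $ 2) * (x $ 1 - \<gamma>' * x $ 2)"
    using gen' by blast
  obtain K2 n \<mu> \<nu> where K2: "coeff_near \<delta> 6 K K2" "pairing h K2 = r1 * r2 * r3"
    and n: "\<forall>i<4. n i \<notin> span (n ` {..<i})"
    and hn: "h \<bullet> n 0 = 0" "h \<bullet> n 1 = 0" "h \<bullet> n 2 = 0" "h \<bullet> n (3::nat) = 1"
    and K2\<alpha>: "form_eval 6 K2 (affine_point \<alpha>) = \<mu> *s (cvec (n 0) + \<i> *s cvec (n 1))"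
    and K2\<beta>: "form_eval 6 K2 (affine_point \<beta>) = \<nu> *s (cvec (n 0) + \<i> *s cvec (n 2))"
    by (rule adapted_frame[OF \<delta>(2) h(1) K1 deg im(1) \<alpha> im(2) \<beta> r1\<beta>])
  define B where "B = (\<lambda>x y. - lor (A *v x) (A *v y))"
  have Blin: "linear (\<lambda>x. B x y)" for y
    by (rule linearI) (simp_all add: B_def matrix_vector_right_distrib matrix_scale_lor lor_bilinear)
  have Bsym: "B x y = B y x" for x y by (simp add: B_def lor_sym[of "A *v x"])
  have Bpos: "B x x > 0" if "x \<noteq> 0" for x
    using lor_neg_definite[OF assms(1) that] by (simp add: B_def)
  have n': "n i \<notin> span (n ` {..<i})" if "i < CARD(4)" for i using n that by simp
  obtain M where M: "\<And>i j. i < CARD(4) \<Longrightarrow> j < CARD(4) \<Longrightarrow> B (M *v n i) (M *v n j) = (if i = j then 1 else 0)"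
    "\<And>t. 0 \<le> t \<Longrightarrow> t \<le> 1 \<Longrightarrow> invertible ((1 - t) *\<^sub>R mat 1 + t *\<^sub>R M)"
    "span (n ` {..<CARD(4)}) = UNIV"
    using orthonormalization_path[of B n, OF Blin Bsym Bpos n'] by metis
  have Minv: "invertible M" using M(2)[of 1] by simp
  have orth: "lor (A *v (M *v n i)) (A *v (M *v n j)) = (if i = j then -1 else 0)" if "i < 4" "j < 4" for i j
    using M(1)[of i j] that by (simp add: B_def split: if_splits)
  have "span ((\<lambda>i. M *v n i) ` {..<4}) = range ((*v) M)"
    using linear_span_image[OF matrix_vector_mul_linear, of M "n ` {..<4}"] M(3) by (simp add: image_image)
  also have "\<dots> = UNIV"
    using Minv by (metis invertible_right_inverse matrix_right_invertible_surjective)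
  \<comment> \<open>Here \<open>m\<close> is the unit normal of the hyperplane, unlike in the
    overview; the projection of \<open>p\<close> to the hyperplane will be
    \<open>A *v (M *v n 3)\<close>.\<close>
  finally obtain m where m: "\<And>y. lor m (A *v y) = 0" "lor m m = 1"
    using lor_normal_vector_exists[of A "\<lambda>i. M *v n i"] orth by metis
  define R where "R = A ** M"
  have Rv: "R *v x = A *v (M *v x)" for x by (simp add: R_def matrix_vector_mul_assoc)
  have Rorth: "lor (R *v n i) (R *v n j) = (if i = j then -1 else 0)" if "i < 4" "j < 4" for i j
    using orth that by (simp add: Rv)
  \<comment> \<open>The quadric of the sphere pulled back by \<open>R\<close>. The images of
    \<open>n 0\<close>, \<open>n 1\<close>, \<open>n 2\<close> are orthogonal of equal square, which
    puts both nonreal points on it.\<close>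
  define Q where "Q = (\<lambda>v. lor (cmat R *v v) (cmat R *v v))"
  have Q\<alpha>: "Q (form_eval 6 K2 (affine_point \<alpha>)) = 0"
    unfolding Q_def K2\<alpha> by (rule lor_complex_isotropic) (simp_all add: Rorth)
  have Q\<beta>: "Q (form_eval 6 K2 (affine_point \<beta>)) = 0"
    unfolding Q_def K2\<beta> by (rule lor_complex_isotropic) (simp_all add: Rorth)
  define r where "r = r1 * r2"
  have dr: "degree r = 4" unfolding r_def using deg r0 by (simp add: degree_mult_eq)
  have r\<alpha>: "cpoly r \<alpha> = 0" "cpoly r \<beta> = 0" by (simp_all add: r_def cpoly_mult \<alpha> \<beta>)
  have r3\<gamma>: "cpoly r3 z = 0" if "z \<in> {\<gamma>, \<gamma>'}" for z
    using \<gamma>(3)[of "affine_point z"] that bform_affine_point[of r3 2 z] deg by auto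
  have r\<gamma>: "cpoly r z \<noteq> 0" if "z \<in> {\<gamma>, \<gamma>'}" for z
    using r3\<gamma>[OF that] gen' by (auto simp: r_def cpoly_mult)
  \<comment> \<open>Base points are excluded if \<open>Q\<close> is nonzero over \<gamma> and
    \<gamma>'. A multiple of \<open>r\<close> in direction \<open>n 0\<close> keeps the section, as
    \<open>h \<bullet> n 0 = 0\<close>, and the points over \<alpha> and \<beta>, as
    \<open>r\<close> vanishes there. At \<open>z\<close> it makes \<open>Q\<close> quadratic in
    \<open>e\<close> with top coefficient minus the square of \<open>cpoly r z\<close>.\<close>
  have ev: "\<forall>\<^sub>F e in at_right 0. Q (form_eval 6 (perturb K2 (e *\<^sub>R n 0) r) (affine_point z)) \<noteq> 0"
    if z: "z \<in> {\<gamma>, \<gamma>'}" for z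
  proof -
    define v where "v = cmat R *v form_eval 6 K2 (affine_point z)"
    define u where "u = cvec (R *v n 0)"
    have uu: "lor u u = -1"
      using Rorth[of 0 0] by (simp add: u_def lor_def flip: of_real_mult of_real_diff)
    have "cmat R *v form_eval 6 (perturb K2 (e *\<^sub>R n 0) r) (affine_point z) = v + (of_real e * cpoly r z) *s u" for e
    proof -
      have "bform 6 r (affine_point z) = cpoly r z" using dr by (simp add: bform_affine_point)
      moreover have "cmat R *v (d *s cvec (e *\<^sub>R n 0)) = (of_real e * d) *s u" for d
        by (simp add: u_def vec_eq_iff matrix_vector_mult_def cmat_def sum_distrib_left algebra_simps)
      ultimately show ?thesis
        by (simp add: form_eval_perturb matrix_vector_right_distrib v_def)
    qed
    then have Qe: "Q (form_eval 6 (perturb K2 (e *\<^sub>R n 0) r) (affine_point z)) =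
      lor v v + of_real e * (2 * cpoly r z * lor v u) + of_real e * of_real e * (- (cpoly r z * cpoly r z))" for e
      by (simp add: Q_def lor_bilinear uu lor_sym[of u v] algebra_simps)
    show ?thesis unfolding Qe
      by (rule eventually_quadratic_neq_0) (use r\<gamma>[OF z] in simp)
  qed
  have "\<forall>\<^sub>F e in at_right 0. coeff_near \<delta> 6 K (perturb K2 (e *\<^sub>R n 0) r)"
    using dr by (intro eventually_coeff_near_perturb K2(1)) simp
  with ev[of \<gamma>] ev[of \<gamma>'] have "\<forall>\<^sub>F e in at_right 0. coeff_near \<delta> 6 K (perturb K2 (e *\<^sub>R n 0) r) \<and>
      Q (form_eval 6 (perturb K2 (e *\<^sub>R n 0) r) (affine_point \<gamma>)) \<noteq> 0 \<and>
      Q (form_eval 6 (perturb K2 (e *\<^sub>R n 0) r) (affine_point \<gamma>')) \<noteq> 0"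
    by (simp add: eventually_conj_iff)
  from eventually_happens'[OF trivial_limit_at_right_real this]
  obtain e where e: "coeff_near \<delta> 6 K (perturb K2 (e *\<^sub>R n 0) r)"
      "Q (form_eval 6 (perturb K2 (e *\<^sub>R n 0) r) (affine_point \<gamma>)) \<noteq> 0"
      "Q (form_eval 6 (perturb K2 (e *\<^sub>R n 0) r) (affine_point \<gamma>')) \<noteq> 0"
    by blast
  define K3 where "K3 = perturb K2 (e *\<^sub>R n 0) r"
  have near3: "coeff_near \<delta> 6 K K3" using e(1) by (simp add: K3_def)
  have pair3: "pairing h K3 = r * r3" by (simp add: K3_def pairing_perturb hn K2(2) r_def)
  have K3r: "form_eval 6 K3 (affine_point z) = form_eval 6 K2 (affine_point z)" if "cpoly r z = 0" for z
    using that dr by (simp add: K3_def form_eval_perturb bform_affine_point)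
  define K' where "K' = lin_image M K3"
  have knot': "real_rational_knot 6 K'"
    unfolding K'_def by (intro real_rational_knot_lin_image \<delta>(2) near3 Minv)
  define L where "L = lin_image A K'"
  have L: "L = lin_image R K3" by (simp add: L_def K'_def R_def lin_image_mult)
  have dL: "degree (L $ i) \<le> 6" for i
    unfolding L by (intro degree_lin_image) (use near3 in \<open>simp add: coeff_near_def\<close>)
  define F where "F = lor L L"
  have dF: "degree F \<le> 12" unfolding F_def using degree_lor[OF dL dL] by simp
  have FQ: "cpoly F z = Q (form_eval 6 K3 (affine_point z))" for z
    using bform_lor[OF dL dL, of "affine_point z"] bform_affine_point[OF dF, of z]
    by (simp add: F_def Q_def L form_eval_lin_image)
  \<comment> \<open>The quadratics are divided out successively: \<open>r1\<close> is nonzero at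
    \<beta>, so the zero of \<open>F\<close> there passes to the quotient \<open>F1\<close>.\<close>
  have "r1 dvd F"
    by (rule real_quadratic_dvd[OF deg(1) im(1) \<alpha>]) (simp add: FQ K3r r\<alpha> Q\<alpha>)
  then obtain F1 where F1: "F = r1 * F1" by (elim dvdE)
  have "cpoly r1 \<beta> * cpoly F1 \<beta> = 0"
    unfolding cpoly_mult[symmetric] F1[symmetric] by (simp add: FQ K3r r\<alpha> Q\<beta>)
  then have "cpoly F1 \<beta> = 0" using r1\<beta> by simp
  then have "r2 dvd F1" by (rule real_quadratic_dvd[OF deg(2) im(2) \<beta>])
  then obtain F2 where F2: "F1 = r2 * F2" by (elim dvdE)
  define G where "G = - F2"
  have F: "F = - (r * G)" by (simp add: F1 F2 r_def G_def mult.assoc)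
  have dG: "degree G \<le> 8"
  proof (cases "G = 0")
    case False
    then have "degree F = degree r + degree G"
      unfolding F using dr by (subst degree_minus, subst degree_mult_eq) auto
    then show ?thesis using dF dr by simp
  qed simp
  \<comment> \<open>The summands are orthogonal with squares 1 and -1, so \<open>p\<close> is
    isotropic. Since \<open>h\<close> is 1 on \<open>n 3\<close> and 0 on the other frame vectors,
    the tangent hyperplane at \<open>p\<close>, pulled back by \<open>R\<close>, is the given plane,
    which is \<open>pR\<close>.\<close>
  define p where "p = m + A *v (M *v n 3)"
  have pp: "lor p p = 0"
    using orth[of 3 3] by (simp add: p_def lor_bilinear m lor_sym[of "A *v _" m])
  have mp: "lor m p = 1" by (simp add: p_def lor_bilinear m)
  have pR: "lor p (R *v x) = - (h \<bullet> x)" for x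
  proof -
    have "x \<in> span (n ` {..<4})" using M(3) by simp
    then have "lor (R *v n 3) (R *v x) = - (h \<bullet> x)"
    proof (induction rule: span_induct_alt)
      case base
      then show ?case by (simp add: lor_def)
    next
      case (step a x y)
      then obtain i where i: "i < 4" "x = n i" by auto
      have "lor (R *v n 3) (R *v n i) = - (h \<bullet> n i)"
      proof -
        have "i = 0 \<or> i = 1 \<or> i = 2 \<or> i = 3" using i(1) by linarith
        then show ?thesis by (elim disjE) (simp_all add: Rorth hn del: One_nat_def)
      qed
      then show ?case using step.IH i(2)
        by (simp add: matrix_vector_right_distrib matrix_scale_lor lor_bilinear inner_add_right)
    qed
    then show ?thesis by (simp add: p_def lor_bilinear m Rv)
  qed
  interpret sphere_lift A p K' r r3 G c \<gamma> \<gamma>'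
  proof
    show "s = 0 \<and> y = 0" if "s *s p + A *v y = 0" for s y
    proof -
      have "lor m (s *s p + A *v y) = s" by (simp add: lor_bilinear m mp)
      then have s: "s = 0" unfolding that by (simp add: lor_def)
      then have "lor (A *v y) (A *v y) = 0" using that by (simp add: lor_def)
      then have "y = 0" using lor_neg_definite[OF assms(1), of y] by auto
      with s show ?thesis by blast
    qed
    show "lor (const_vec p) (lin_image A K') = - (r * r3)"
      using lor_const_lin_image[OF pR, of K3] by (simp add: pair3 flip: L L_def)
    show "lor (lin_image A K') (lin_image A K') = - (r * G)"
      by (simp add: F[symmetric] F_def L_def)
    show "bform 8 G x \<noteq> 0" if x: "x \<noteq> 0" "bform 2 r3 x = 0" for x :: "complex ^ 2"
    proof -
      have "x $ 2 \<noteq> 0" using x \<gamma>(2) by (auto simp: \<gamma>(3) vec_eq_iff forall_2)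
      have "x $ 1 = \<gamma> * x $ 2 \<or> x $ 1 = \<gamma>' * x $ 2" using x(2) \<gamma>(2) by (simp add: \<gamma>(3))
      then obtain z where z: "z \<in> {\<gamma>, \<gamma>'}" "x $ 1 = z * x $ 2" by blast
      then have xz: "x = x $ 2 *s affine_point z" by (simp add: vec_eq_iff forall_2)
      \<comment> \<open>At a root of \<open>r3\<close> the value of \<open>F\<close> is that of
        \<open>Q\<close>, nonzero by the choice of \<open>e\<close>.\<close>
      have "cpoly r z * cpoly G z = - cpoly F z" by (simp add: F cpoly_uminus cpoly_mult)
      also have "\<dots> \<noteq> 0" using z(1) e(2,3) by (auto simp: FQ K3_def)
      finally have "cpoly G z \<noteq> 0" by simp
      moreover have "bform 8 G x = (x $ 2) ^ 8 * cpoly G z"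
        by (subst xz) (simp add: bform_scale bform_affine_point dG)
      ultimately show ?thesis using \<open>x $ 2 \<noteq> 0\<close> by simp
    qed
  qed (use pp knot' dr deg dG \<gamma> in auto)
  have "p \<noteq> 0" using mp by (auto simp: lor_def)
  moreover have "proj p \<in> S3"
    using \<open>p \<noteq> 0\<close> pp unfolding S3_def lor_eq_0_iff power2_eq_square by blast
  moreover have "rigidly_isotopic 6 K K'"
  proof -
    \<comment> \<open>Perturbation and linear change run simultaneously: the curve follows a segment
      in the ball of knots while the matrix stays invertible. The end is \<open>K'\<close> itself,
      so the free scalar factor is 1.\<close>
    define \<Gamma> where "\<Gamma> = (\<lambda>u. lin_image ((1 - u) *\<^sub>R mat 1 + u *\<^sub>R M) (\<chi> j. K $ j + smult u (K3 $ j - K $ j)))"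
    have "real_rational_knot 6 (\<Gamma> u)" if u: "u \<in> {0..1}" for u
    proof -
      have "coeff_near \<delta> 6 K (\<chi> j. K $ j + smult u (K3 $ j - K $ j))"
        unfolding coeff_near_def
      proof (intro allI conjI impI)
        have dK: "degree (K $ j) \<le> 6" "degree (K3 $ j) \<le> 6" for j
          using assms(2) near3
          by (simp_all add: real_rational_knot_def real_rational_curve_def coeff_near_def)
        show "degree ((\<chi> j. K $ j + smult u (K3 $ j - K $ j)) $ j) \<le> 6" for j
          using dK by (auto intro!: degree_add_le degree_diff_le order.trans[OF degree_smult_le])
        fix i j assume "i \<le> (6::nat)"
        have "\<bar>u * (coeff (K3 $ j) i - coeff (K $ j) i)\<bar> \<le> \<bar>coeff (K3 $ j) i - coeff (K $ j) i\<bar>"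
          using u by (simp add: abs_mult mult_left_le_one_le)
        also have "\<dots> < \<delta>" using near3 \<open>i \<le> 6\<close> by (simp add: coeff_near_def)
        finally show "\<bar>coeff ((\<chi> j. K $ j + smult u (K3 $ j - K $ j)) $ j) i - coeff (K $ j) i\<bar> < \<delta>"
          by simp
      qed
      then show ?thesis unfolding \<Gamma>_def using u
        by (intro real_rational_knot_lin_image \<delta>(2) M(2)) auto
    qed
    moreover have "continuous_on {0..1} (\<lambda>u. coeff (\<Gamma> u $ j) i)" for i j
      unfolding \<Gamma>_def lin_image_nth by (auto simp: coeff_sum intro!: continuous_intros)
    moreover have "\<Gamma> 0 = K" by (simp add: \<Gamma>_def)
    moreover have "\<Gamma> 1 = (\<chi> j. smult 1 (K' $ j))" by (simp add: \<Gamma>_def K'_def)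
    ultimately show ?thesis unfolding rigidly_isotopic_def by (intro exI[of _ \<Gamma>]) auto
  qed
  ultimately show ?thesis
    using real_rational_curve_lift real_points_lift one_double_point_lift knot' stereographic_curve_lift
    by blast
qed

end
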